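(* Let $X$ be a compact metric space with metric $d$, $T:X\to X$ continuous, and $\Phi=\{\phi_n\}_{n\ge1}$ a supadditive potential on $X$. Then for every ergodic $T$-invariant Borel probability measure $\mu$, \[ P^*_\mu(T,\Phi)=\underline{CP}^*_\mu(T,\Phi)=\overline{CP}^*_\mu(T,\Phi)=P_\mu(T,\Phi)=h_\mu(T)+\Phi_*(\mu). \]
   Context: $h_\mu(T)$ is the measure-theoretic entropy. $d_n(x,y)=\max_{0\le i\le n-1}d(T^ix,T^iy)$, $B_n(x,\epsilon)=\{y:d_n(x,y)<\epsilon\}$. A supadditive potential is a sequence of continuous $\phi_n:X\to\mathbb{R}$ with $\phi_{n+m}(x)\ge\phi_n(x)+\phi_m(T^nx)$ for all $x$, $n,m\ge1$; $\Phi_*(\mu)=\lim_n\frac1n\int\phi_nd\mu=\sup_n\frac1n\int\phi_nd\mu$. Spanning pressure: for $0<\delta<1$, $F\subseteq X$ is $(n,\epsilon,\delta)$-spanning if $\mu(\bigcup_{x\in F}B_n(x,\epsilon))\ge1-\delta$; $P_\mu(T,\Phi,n,\epsilon,\delta)=\inf\{\sum_{x\in F}e^{\phi_n(x)}:F\ (n,\epsilon,\delta)\text{-spanning}\}$; $P_\mu(T,\Phi,\epsilon,\delta)=\limsup_{n\to\infty}\frac1n\log P_\mu(T,\Phi,n,\epsilon,\delta)$; $P_\mu(T,\Phi,\delta)=\lim_{\epsilon\to0}P_\mu(T,\Phi,\epsilon,\delta)$; $P_\mu(T,\Phi)=\lim_{\delta\to0}P_\mu(T,\Phi,\delta)$.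 Carathéodory pressure: for $Z\subseteq X$, $\epsilon>0$, a cover of $Z$ is a countable family $\Gamma=\{B_{n_i}(x_i,\epsilon)\}$ covering $Z$, $n(\Gamma)=\min n_i$; $M(Z,\Phi,s,N,\epsilon)=\inf_\Gamma\sum_i\exp(-sn_i+\phi_{n_i}(x_i))$ over covers with $n(\Gamma)\ge N$; $m(Z,\Phi,s,\epsilon)=\lim_NM(Z,\Phi,s,N,\epsilon)$; $P_Z(T,\Phi,\epsilon)=\inf\{s:m(Z,\Phi,s,\epsilon)=0\}=\sup\{s:m=+\infty\}$; $P_Z(T,\Phi)=\liminf_{\epsilon\to0}P_Z(T,\Phi,\epsilon)$; $P^*_\mu(T,\Phi,\epsilon)=\inf\{P_Z(T,\Phi,\epsilon):\mu(Z)=1\}$; $P^*_\mu(T,\Phi)=\liminf_{\epsilon\to0}P^*_\mu(T,\Phi,\epsilon)$. Capacity pressures: $\Lambda(Z,\Phi,N,\epsilon)=\inf\sum_ie^{\phi_N(x_i)}$ over covers $\{B_N(x_i,\epsilon)\}$ of $Z$; $\underline{CP}_Z(T,\Phi,\epsilon)$, $\overline{CP}_Z(T,\Phi,\epsilon)$ are the $\liminf$, $\limsup$ as $N\to\infty$ of $\frac1N\log\Lambda(Z,\Phi,N,\epsilon)$; $\underline{CP}^*_\mu(T,\Phi,\epsilon)=\lim_{\delta\to0}\inf\{\underline{CP}_Z(T,\Phi,\epsilon):\mu(Z)\ge1-\delta\}$, similarly $\overline{CP}^*_\mu(T,\Phi,\epsilon)$; $\underline{CP}^*_\mu(T,\Phi)=\liminf_{\epsilon\to0}\underline{CP}^*_\mu(T,\Phi,\epsilon)$,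 $\overline{CP}^*_\mu(T,\Phi)=\liminf_{\epsilon\to0}\overline{CP}^*_\mu(T,\Phi,\epsilon)$. *)

theory Defs
  imports "HOL-Probability.Probability"
begin

definition bowen_ball :: "'a::metric_space set \<Rightarrow> ('a \<Rightarrow> 'a) \<Rightarrow> nat \<Rightarrow> 'a \<Rightarrow> real \<Rightarrow> 'a set" where
  "bowen_ball X T n x eps = {y \<in> X. \<forall>i<n. dist ((T ^^ i) x) ((T ^^ i) y) < eps}"

definition supadditive_potential :: "'a::metric_space set \<Rightarrow> ('a \<Rightarrow> 'a) \<Rightarrow> (nat \<Rightarrow> 'a \<Rightarrow> real) \<Rightarrow> bool" where
  "supadditive_potential X T \<phi> \<longleftrightarrow>
     (\<forall>n\<ge>1. continuous_on X (\<phi> n)) \<and>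
     (\<forall>x\<in>X. \<forall>n\<ge>1. \<forall>m\<ge>1. \<phi> (n + m) x \<ge> \<phi> n x + \<phi> m ((T ^^ n) x))"

definition measure_preserving_map :: "'a measure \<Rightarrow> ('a \<Rightarrow> 'a) \<Rightarrow> bool" where
  "measure_preserving_map M T \<longleftrightarrow> T \<in> measurable M M \<and>
     (\<forall>A\<in>sets M. measure M (T -` A \<inter> space M) = measure M A)"

definition ergodic_map :: "'a measure \<Rightarrow> ('a \<Rightarrow> 'a) \<Rightarrow> bool" where
  "ergodic_map M T \<longleftrightarrow> measure_preserving_map M T \<and>
     (\<forall>A\<in>sets M. T -` A \<inter> space M = A \<longrightarrow> measure M A = 0 \<or> measure M A = 1)"

definition elog :: "real \<Rightarrow> ereal" where
  "elog x = (if x \<le> 0 then -\<infinity> else ereal (ln x))"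

definition finite_meas_partition :: "'a measure \<Rightarrow> 'a set set \<Rightarrow> bool" where
  "finite_meas_partition M P \<longleftrightarrow> finite P \<and> P \<subseteq> sets M \<and> \<Union>P = space M \<and> disjoint P"

definition part_join :: "'a measure \<Rightarrow> ('a \<Rightarrow> 'a) \<Rightarrow> 'a set set \<Rightarrow> nat \<Rightarrow> 'a set set" where
  "part_join M T P n = {space M \<inter> (\<Inter>i<n. (T ^^ i) -` a i) | a. \<forall>i<n. a i \<in> P}"

definition part_entropy :: "'a measure \<Rightarrow> 'a set set \<Rightarrow> real" where
  "part_entropy M P = - (\<Sum>A\<in>P. measure M A * ln (measure M A))"

definition part_entropy_rate :: "'a measure \<Rightarrow> ('a \<Rightarrow> 'a) \<Rightarrow> 'a set set \<Rightarrow> real" where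
  "part_entropy_rate M T P = lim (\<lambda>n. part_entropy M (part_join M T P n) / real n)"

definition ks_entropy :: "'a measure \<Rightarrow> ('a \<Rightarrow> 'a) \<Rightarrow> ereal" where
  "ks_entropy M T = (SUP P\<in>{P. finite_meas_partition M P}. ereal (part_entropy_rate M T P))"

text \<open>Phi_*(mu) = lim (1/n) int phi_n = sup_n (1/n) int phi_n.\<close>
definition pot_star :: "'a measure \<Rightarrow> (nat \<Rightarrow> 'a \<Rightarrow> real) \<Rightarrow> ereal" where
  "pot_star M \<phi> = (SUP n\<in>{1..}. ereal ((integral\<^sup>L M (\<phi> n)) / real n))"

definition span_sum :: "'a::metric_space set \<Rightarrow> ('a \<Rightarrow> 'a) \<Rightarrow> (nat \<Rightarrow> 'a \<Rightarrow> real) \<Rightarrow> 'a measure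
    \<Rightarrow> nat \<Rightarrow> real \<Rightarrow> real \<Rightarrow> real" where
  "span_sum X T \<phi> M n eps \<delta> = Inf {(\<Sum>x\<in>F. exp (\<phi> n x)) | F. finite F \<and> F \<subseteq> X \<and>
       measure M (\<Union>x\<in>F. bowen_ball X T n x eps) \<ge> 1 - \<delta>}"

definition span_pressure_eps_delta where
  "span_pressure_eps_delta X T \<phi> M eps \<delta> =
     limsup (\<lambda>n. elog (span_sum X T \<phi> M n eps \<delta>) / ereal (real n))"

definition span_pressure_delta where
  "span_pressure_delta X T \<phi> M \<delta> = Lim (at_right 0) (\<lambda>eps. span_pressure_eps_delta X T \<phi> M eps \<delta>)"

definition span_pressure :: "'a::metric_space set \<Rightarrow> ('a \<Rightarrow> 'a) \<Rightarrow> (nat \<Rightarrow> 'a \<Rightarrow> real) \<Rightarrow> 'a measure \<Rightarrow> ereal" where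
  "span_pressure X T \<phi> M = Lim (at_right 0) (\<lambda>\<delta>. span_pressure_delta X T \<phi> M \<delta>)"

definition car_M :: "'a::metric_space set \<Rightarrow> ('a \<Rightarrow> 'a) \<Rightarrow> (nat \<Rightarrow> 'a \<Rightarrow> real) \<Rightarrow> 'a set
    \<Rightarrow> real \<Rightarrow> nat \<Rightarrow> real \<Rightarrow> ennreal" where
  "car_M X T \<phi> Z s N eps = Inf {(\<Sum>\<^sub>\<infinity>p\<in>C. ennreal (exp (- s * real (snd p) + \<phi> (snd p) (fst p)))) | C.
       countable C \<and> C \<subseteq> X \<times> {N..} \<and> Z \<subseteq> (\<Union>p\<in>C. bowen_ball X T (snd p) (fst p) eps)}"

definition car_m where
  "car_m X T \<phi> Z s eps = lim (\<lambda>N. car_M X T \<phi> Z s N eps)"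

definition car_pressure_set_eps :: "'a::metric_space set \<Rightarrow> ('a \<Rightarrow> 'a) \<Rightarrow> (nat \<Rightarrow> 'a \<Rightarrow> real) \<Rightarrow> 'a set
    \<Rightarrow> real \<Rightarrow> ereal" where
  "car_pressure_set_eps X T \<phi> Z eps = Inf (ereal ` {s. car_m X T \<phi> Z s eps = 0})"

definition car_pressure_set where
  "car_pressure_set X T \<phi> Z = Liminf (at_right 0) (\<lambda>eps. car_pressure_set_eps X T \<phi> Z eps)"

definition car_pressure_meas_eps where
  "car_pressure_meas_eps X T \<phi> M eps =
     Inf {car_pressure_set_eps X T \<phi> Z eps | Z. Z \<in> sets M \<and> measure M Z = 1}"

definition car_pressure_meas :: "'a::metric_space set \<Rightarrow> ('a \<Rightarrow> 'a) \<Rightarrow> (nat \<Rightarrow> 'a \<Rightarrow> real) \<Rightarrow> 'a measure \<Rightarrow> ereal" where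
  "car_pressure_meas X T \<phi> M = Liminf (at_right 0) (\<lambda>eps. car_pressure_meas_eps X T \<phi> M eps)"

definition cap_Lambda :: "'a::metric_space set \<Rightarrow> ('a \<Rightarrow> 'a) \<Rightarrow> (nat \<Rightarrow> 'a \<Rightarrow> real) \<Rightarrow> 'a set
    \<Rightarrow> nat \<Rightarrow> real \<Rightarrow> real" where
  "cap_Lambda X T \<phi> Z N eps = Inf {(\<Sum>x\<in>F. exp (\<phi> N x)) | F. finite F \<and> F \<subseteq> X \<and>
       Z \<subseteq> (\<Union>x\<in>F. bowen_ball X T N x eps)}"

definition lower_cap_set_eps where
  "lower_cap_set_eps X T \<phi> Z eps = liminf (\<lambda>N. elog (cap_Lambda X T \<phi> Z N eps) / ereal (real N))"

definition upper_cap_set_eps where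
  "upper_cap_set_eps X T \<phi> Z eps = limsup (\<lambda>N. elog (cap_Lambda X T \<phi> Z N eps) / ereal (real N))"

definition lower_cap_meas_eps where
  "lower_cap_meas_eps X T \<phi> M eps = Lim (at_right 0) (\<lambda>\<delta>.
     Inf {lower_cap_set_eps X T \<phi> Z eps | Z. Z \<in> sets M \<and> measure M Z \<ge> 1 - \<delta>})"

definition upper_cap_meas_eps where
  "upper_cap_meas_eps X T \<phi> M eps = Lim (at_right 0) (\<lambda>\<delta>.
     Inf {upper_cap_set_eps X T \<phi> Z eps | Z. Z \<in> sets M \<and> measure M Z \<ge> 1 - \<delta>})"

definition lower_cap_meas :: "'a::metric_space set \<Rightarrow> ('a \<Rightarrow> 'a) \<Rightarrow> (nat \<Rightarrow> 'a \<Rightarrow> real) \<Rightarrow> 'a measure \<Rightarrow> ereal" where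
  "lower_cap_meas X T \<phi> M = Liminf (at_right 0) (\<lambda>eps. lower_cap_meas_eps X T \<phi> M eps)"

definition upper_cap_meas :: "'a::metric_space set \<Rightarrow> ('a \<Rightarrow> 'a) \<Rightarrow> (nat \<Rightarrow> 'a \<Rightarrow> real) \<Rightarrow> 'a measure \<Rightarrow> ereal" where
  "upper_cap_meas X T \<phi> M = Liminf (at_right 0) (\<lambda>eps. upper_cap_meas_eps X T \<phi> M eps)"

end

theory Submission
  imports Defs
begin

text \<open>Everything reduces to two estimates, the pressure being squeezed between
  Caratheodory covers from below and fixed-time covers from above.

  Upper bound. For a partition \<open>P\<close> of small diameter let \<open>a\<close> exceed the almost sure lower
  exponential decay rate of its cylinders. Typical orbits are tiled by long blocks with cylinders of
  measure at least \<open>exp (- a l)\<close>, so at most \<open>exp (n (a + o(1)))\<close> names of length \<open>n\<close> occur on a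
  fixed set of nearly full measure. The same count shows that the decay rate is the entropy of \<open>P\<close>.
  The tiling argument also gives \<open>\<phi> n x \<le> n (\<Phi>\<^sub>* + o(1))\<close> almost everywhere.

  Lower bound. Up to a small proportion of times, a small Bowen ball sees a single element of \<open>P\<close>
  (shrunk to a compact subset) at each time, so it meets few cylinders in the typical set \<open>G\<close>,
  each of measure at most \<open>exp (- n (h - o(1)))\<close>; and supadditivity bounds \<open>\<phi> n\<close> at its centre from
  below by an orbit sum of \<open>\<phi> k / k\<close> along a typical orbit in the ball. Hence the terms of a
  Caratheodory sum dominate the measures of the balls in \<open>G\<close>.\<close>

section \<open>Tiling typical orbits\<close>

text \<open>The potential has no distortion control: \<open>\<phi> n\<close> may vary by an
  uncontrolled amount over a Bowen ball, and a bound linear in \<open>n\<close> at all points is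
  available only from below. This makes the two estimates asymmetric. From above, the centres of the
  covers are chosen inside the typical set, so values of \<open>\<phi> n\<close> at different points
  are never compared. From below, the covers are prescribed and their centres may be atypical; there
  \<open>\<phi> n\<close> is first replaced by an orbit sum of \<open>\<phi> k\<close> with
  \<open>k\<close> fixed, and uniform continuity of this single function carries the bound from a
  typical point to the centre. The decay rate of cylinders is taken as a liminf, almost surely
  constant by a zero-one law. The liminf already bounds the measure of every long cylinder of a
  typical point from above; for the count of names, cylinders that are fat at infinitely many
  lengths suffice, because tiling fills almost all of the time with them. Entropy and
  \<open>pot_star\<close> may be infinite, so the lower bound is proved for one partition and one
  \<open>k\<close> at a time.\<close>

locale ergodic_system = prob_space M for M :: "'a measure" +
  fixes T :: "'a \<Rightarrow> 'a"
  assumes ergodic: "ergodic_map M T"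
begin

lemma T_measurable [measurable]: "T \<in> measurable M M"
  using ergodic by (simp add: ergodic_map_def measure_preserving_map_def)

lemma funpow_T_measurable [measurable]: "(T ^^ n) \<in> measurable M M"
  by (rule measurable_compose_n) (rule T_measurable)

lemma T_space: "x \<in> space M \<Longrightarrow> T x \<in> space M"
  using T_measurable by (rule measurable_space)

lemma funpow_T_space: "x \<in> space M \<Longrightarrow> (T ^^ n) x \<in> space M"
  using funpow_T_measurable by (rule measurable_space)

lemma prob_vimage_T: "A \<in> sets M \<Longrightarrow> prob (T -` A \<inter> space M) = prob A"
  using ergodic by (simp add: ergodic_map_def measure_preserving_map_def)

lemma prob_vimage_funpow_T:
  assumes "A \<in> sets M" shows "prob ((T ^^ n) -` A \<inter> space M) = prob A"
proof (induction n)
  case 0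
  then show ?case using assms sets.sets_into_space by (simp add: Int_absorb2)
next
  case (Suc n)
  have "(T ^^ Suc n) -` A \<inter> space M = T -` ((T ^^ n) -` A \<inter> space M) \<inter> space M"
    using T_space by (auto simp: funpow_Suc_right simp del: funpow.simps)
  then show ?case
    using prob_vimage_T[of "(T ^^ n) -` A \<inter> space M"] assms Suc
    by (simp del: funpow.simps)
qed

text \<open>Ergodicity is stated for strictly invariant sets, while limsup-type sets readily satisfy
  one inclusion only. The preimages of \<open>E\<close> decrease and all have the measure of
  \<open>E\<close>; their intersection is strictly invariant and keeps that measure.\<close>

lemma zero_one:
  assumes E [measurable]: "E \<in> sets M"
    and inv: "\<And>x. x \<in> space M \<Longrightarrow> T x \<in> E \<Longrightarrow> x \<in> E"
  shows "prob E = 0 \<or> prob E = 1"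
proof -
  let ?E = "\<lambda>n. (T ^^ n) -` E \<inter> space M"
  let ?F = "\<Inter>n. ?E n"
  have step: "?E (Suc n) \<subseteq> ?E n" for n
    using inv funpow_T_space by auto
  have dec: "decseq ?E" using step by (rule decseq_SucI)
  have "(\<lambda>n. prob (?E n)) \<longlonglongrightarrow> prob ?F"
    by (rule finite_Lim_measure_decseq) (use dec in auto)
  then have F: "prob ?F = prob E"
    by (simp add: prob_vimage_funpow_T[OF E] LIMSEQ_const_iff)
  have "T -` ?F \<inter> space M = (\<Inter>n. ?E (Suc n))"
    using T_space by (auto simp: funpow_Suc_right simp del: funpow.simps)
  also have "\<dots> = ?F"
  proof
    show "(\<Inter>n. ?E (Suc n)) \<subseteq> ?F" using step by blast
  qed blast
  finally have "T -` ?F \<inter> space M = ?F" .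
  moreover have "?F \<in> sets M" by measurable
  ultimately have "prob ?F = 0 \<or> prob ?F = 1"
    using ergodic unfolding ergodic_map_def by blast
  then show ?thesis unfolding F .
qed


definition visits :: "'a set \<Rightarrow> nat \<Rightarrow> 'a \<Rightarrow> nat" where
  "visits B n x = (\<Sum>i<n. indicator B ((T ^^ i) x))"

lemma funpow_T_add: "(T ^^ n) ((T ^^ m) x) = (T ^^ (m + n)) x"
  by (simp add: add.commute[of m n] funpow_add)

lemma visits_add: "visits B (m + n) x = visits B m x + visits B n ((T ^^ m) x)"
  by (induction n) (simp_all add: visits_def funpow_T_add)

lemma visits_1: "visits B (Suc 0) x = indicator B x"
  by (simp add: visits_def)

lemma real_visits: "real (visits B n x) = (\<Sum>i<n. indicator B ((T ^^ i) x))"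
  by (simp add: visits_def indicator_def of_nat_sum if_distrib cong: sum.cong)

lemma measurable_visits [measurable]:
  assumes [measurable]: "B \<in> sets M" shows "visits B n \<in> measurable M (count_space UNIV)"
  unfolding visits_def indicator_def by measurable

lemma integral_visits:
  assumes [measurable]: "B \<in> sets M"
  shows "integrable M (\<lambda>x. real (visits B n x))"
    and "(\<integral>x. real (visits B n x) \<partial>M) = real n * prob B"
proof -
  have ind: "indicat_real B ((T ^^ i) x) = indicat_real ((T ^^ i) -` B \<inter> space M) x"
    if "x \<in> space M" for i x
    using that by (simp add: indicator_def)
  have i: "has_bochner_integral M (\<lambda>x. indicat_real B ((T ^^ i) x)) (prob B)" for i
  proof -
    have "has_bochner_integral M (indicat_real ((T ^^ i) -` B \<inter> space M))
        (prob ((T ^^ i) -` B \<inter> space M))"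
      by (rule has_bochner_integral_real_indicator) (auto simp: emeasure_eq_measure)
    then show ?thesis
      by (simp add: prob_vimage_funpow_T ind cong: has_bochner_integral_cong)
  qed
  have "has_bochner_integral M (\<lambda>x. \<Sum>i<n. indicat_real B ((T ^^ i) x)) (\<Sum>i<n. prob B)"
    by (rule has_bochner_integral_sum) (rule i)
  then show "integrable M (\<lambda>x. real (visits B n x))"
    and "(\<integral>x. real (visits B n x) \<partial>M) = real n * prob B"
    by (auto simp: real_visits has_bochner_integral_iff)
qed

text \<open>One half of Kingman's theorem. If the limsup exceeded the mean, orbits could be tiled
  by boundedly long blocks on which \<^term>\<open>f\<close> is too large, up to a small proportion of the
  time; integrating the tiled lower bound contradicts the bound on the means.\<close>
lemma supadditive_AE_upper:
  fixes f :: "nat \<Rightarrow> 'a \<Rightarrow> real"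
  assumes int: "\<And>n. n \<ge> 1 \<Longrightarrow> integrable M (f n)"
    and super: "\<And>x m n. x \<in> space M \<Longrightarrow> m \<ge> 1 \<Longrightarrow> n \<ge> 1 \<Longrightarrow> f m x + f n ((T ^^ m) x) \<le> f (m + n) x"
    and low: "\<And>x. x \<in> space M \<Longrightarrow> - C \<le> f 1 x"
    and mean: "\<And>n. n \<ge> 1 \<Longrightarrow> (\<integral>x. f n x \<partial>M) \<le> real n * r"
    and "r < r'"
  shows "AE x in M. \<forall>\<^sub>F n in sequentially. f n x \<le> real n * r'"
proof -
  obtain s where s: "r < s" "s < r'" using \<open>r < r'\<close> dense by blast
  have meas [measurable]: "f n \<in> borel_measurable M" if "n \<ge> 1" for n
    using int[OF that] by (rule borel_measurable_integrable)
  \<comment> \<open>The rational \<open>q\<close> strictly above \<open>s\<close> makes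
    \<open>E\<close> a countable union and leaves slack: passing from \<open>T x\<close> to
    \<open>x\<close> costs the bounded amount \<open>C + q'\<close>, absorbed by lowering
    \<open>q\<close> to \<open>q'\<close> once \<open>n\<close> is large.\<close>
  define E where "E = {x \<in> space M. \<exists>q\<in>{q\<in>\<rat>. s < q}. \<forall>N. \<exists>n. n > N \<and> real n * q < f n x}"
  have pm: "Measurable.pred M (\<lambda>x. n > N \<and> real n * q < f n x)" for n N :: nat and q
  proof (cases "n > N")
    case True
    then have [measurable]: "f n \<in> borel_measurable M" by (intro meas) simp
    show ?thesis by measurable
  qed simp
  have E [measurable]: "E \<in> sets M"
  proof -
    have "{x \<in> space M. \<forall>N. \<exists>n. n > N \<and> real n * q < f n x} \<in> sets M" for q
      using pm by (intro predE pred_intros_countable)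
    moreover have "countable {q\<in>\<rat>. s < q}"
      using countable_rat by (rule countable_subset[rotated]) auto
    moreover have "E = (\<Union>q\<in>{q\<in>\<rat>. s < q}. {x \<in> space M. \<forall>N. \<exists>n. n > N \<and> real n * q < f n x})"
      by (auto simp: E_def)
    ultimately show ?thesis using sets.countable_UN'' by auto
  qed
  have "prob E = 0 \<or> prob E = 1"
  proof (rule zero_one[OF E])
    fix x assume x: "x \<in> space M" "T x \<in> E"
    then obtain q where q: "q \<in> \<rat>" "s < q" "\<And>N. \<exists>n. n > N \<and> real n * q < f n (T x)"
      by (auto simp: E_def)
    obtain q' where q': "q' \<in> \<rat>" "s < q'" "q' < q" using Rats_dense_in_real[OF q(2)] by blast
    have "\<exists>n. n > N \<and> real n * q' < f n x" for N
    proof -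
      obtain k where k: "(C + q') / (q - q') \<le> real k" using real_arch_simple by blast
      obtain n where n: "n > max N k" "real n * q < f n (T x)" using q(3) by blast
      have "C + q' \<le> real k * (q - q')" using k q' by (simp add: field_simps)
      also have "\<dots> \<le> real n * (q - q')" using n q' by (intro mult_right_mono) auto
      finally have "real (Suc n) * q' \<le> - C + real n * q" by (simp add: algebra_simps)
      also have "\<dots> < f 1 x + f n (T x)" using low[OF x(1)] n by linarith
      also have "\<dots> \<le> f (Suc n) x" using super[of x 1 n] x n by simp
      finally show ?thesis using n by (intro exI[of _ "Suc n"]) auto
    qed
    then show "x \<in> E" using x q' by (auto simp: E_def)
  qed
  moreover have "prob E \<noteq> 1"
  proof
    assume E1: "prob E = 1"
    define D where "D L = {x \<in> space M. \<exists>l\<in>{1..L}. real l * s < f l x}" for L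
    have D [measurable]: "D L \<in> sets M" for L unfolding D_def by measurable
    have "E \<subseteq> (\<Union>L. D L)"
    proof
      fix x assume x: "x \<in> E"
      then obtain q where q: "s < q" "\<And>N. \<exists>n. n > N \<and> real n * q < f n x"
        by (auto simp: E_def)
      then obtain n where n: "n > (0::nat)" "real n * q < f n x" by blast
      then have "real n * s < f n x" using q(1) by (smt (verit) mult_le_cancel_left_pos of_nat_0_less_iff)
      then show "x \<in> (\<Union>L. D L)" using x n by (auto simp: D_def E_def intro!: exI[of _ n])
    qed
    then have UD: "prob (\<Union>L. D L) = 1"
      using finite_measure_mono[of E "\<Union>L. D L"] E1 prob_le_1[of "\<Union>L. D L"]
      by (intro antisym) auto
    have "incseq D" by (auto simp: D_def incseq_def)
    then have "(\<lambda>L. prob (D L)) \<longlonglongrightarrow> prob (\<Union>L. D L)"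
      by (intro finite_Lim_measure_incseq) auto
    then have lim: "(\<lambda>L. prob (D L)) \<longlonglongrightarrow> 1" by (simp add: UD)
    \<comment> \<open>\<open>K\<close> exceeds \<open>s + C\<close>, the deficit against the slope
      \<open>s\<close> in a single step, where only \<open>f 1 x \<ge> - C\<close> is known. The
      final stretch of length at most \<open>L\<close> is charged at the same price.\<close>
    define K where "K = \<bar>s\<bar> + \<bar>C\<bar> + 1"
    have K: "K > 0" "s + C \<le> K" by (auto simp: K_def)
    have "1 - (s - r) / (2 * K) < 1" using K s by simp
    then obtain L where L: "prob (D L) > 1 - (s - r) / (2 * K)"
      using order_tendstoD(1)[OF lim] eventually_happens trivial_limit_sequentially by blast
    define B where "B = space M - D L"
    have B [measurable]: "B \<in> sets M" by (simp add: B_def)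
    have pB: "K * prob B \<le> (s - r) / 2"
      using L K by (simp add: B_def prob_compl field_simps)
    \<comment> \<open>Greedy tiling: from a point of \<open>D L\<close> jump over a block of length
      at most \<open>L\<close> with average above \<open>s\<close>; from a point of \<open>B\<close>
      advance one step and pay \<open>K\<close>.\<close>
    have tile: "s * real n - K * (real (visits B n x) + real L) \<le> f n x"
      if "n \<ge> 1" "x \<in> space M" for n x
      using that
    proof (induction n arbitrary: x rule: less_induct)
      case (less n)
      note x = less.prems(2)
      have small: "- C * real m \<le> f m x" if "m \<ge> 1" "x \<in> space M" for m x
        using that
      proof (induction m arbitrary: x rule: dec_induct)
        case base then show ?case using low by simp
      next
        case (step m)
        have "- C * real (Suc m) = - C + - C * real m" by (simp add: algebra_simps)
        also have "\<dots> \<le> f 1 x + f m (T x)" using step T_space low by (intro add_mono) auto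
        also have "\<dots> \<le> f (Suc m) x" using super[of x 1 m] step by simp
        finally show ?case .
      qed
      consider "n \<le> L" | "n > L" "x \<in> B" "n > 1" | "n > L" "x \<in> B" "n = 1" | "n > L" "x \<in> D L"
      proof -
        have "n \<le> L \<or> n > L" "n = 1 \<or> n > 1" "x \<in> B \<or> x \<in> D L"
          using less.prems by (auto simp: B_def)
        then show ?thesis using that by blast
      qed
      then show ?case
      proof cases
        case 1
        have "(s + C) * real n \<le> K * real n" by (intro mult_right_mono) (auto simp: K_def)
        also have "\<dots> \<le> K * (real (visits B n x) + real L)" using 1 K by (intro mult_left_mono) auto
        finally show ?thesis using small[OF less.prems] by (simp add: algebra_simps)
      next
        case 2
        have v: "visits B n x = 1 + visits B (n - 1) (T x)"
          using visits_add[of B 1 "n - 1" x] 2 by (simp add: visits_1)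
        have "s * real (n - 1) - K * (real (visits B (n - 1) (T x)) + real L) \<le> f (n - 1) (T x)"
          using less.IH[of "n - 1" "T x"] 2 T_space x by simp
        then have "s * real n - K * (real (visits B n x) + real L) \<le> f 1 x + f (n - 1) (T x)"
          using low[OF x] 2 by (simp add: v of_nat_diff algebra_simps) (use K in linarith)
        also have "\<dots> \<le> f n x" using super[of x 1 "n - 1"] 2 x by simp
        finally show ?thesis .
      next
        case 3
        have "0 \<le> K * real L" using K by simp
        then show ?thesis using 3 low[OF x] by (simp add: visits_1 algebra_simps) (use K in linarith)
      next
        case 4
        then obtain l where l: "1 \<le> l" "l \<le> L" "real l * s < f l x" by (auto simp: D_def)
        have v: "visits B n x = visits B l x + visits B (n - l) ((T ^^ l) x)"
          using visits_add[of B l "n - l" x] 4 l by simp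
        have "s * real (n - l) - K * (real (visits B (n - l) ((T ^^ l) x)) + real L)
            \<le> f (n - l) ((T ^^ l) x)"
          using less.IH[of "n - l" "(T ^^ l) x"] 4 l funpow_T_space x by simp
        moreover have "0 \<le> K * real (visits B l x)" using K by simp
        ultimately have "s * real n - K * (real (visits B n x) + real L)
            \<le> f l x + f (n - l) ((T ^^ l) x)"
          using l 4 by (simp add: v of_nat_diff algebra_simps)
        also have "\<dots> \<le> f n x" using super[of x l "n - l"] 4 l x by simp
        finally show ?thesis .
      qed
    qed
    have "real n * ((s - r) / 2) \<le> K * real L" if n: "n \<ge> 1" for n
    proof -
      have "s * real n - K * (real n * prob B + real L)
          = (\<integral>x. s * real n - K * (real (visits B n x) + real L) \<partial>M)"
        using integral_visits[OF B, of n] by (simp add: prob_space)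
      also have "\<dots> \<le> (\<integral>x. f n x \<partial>M)"
        using integral_visits(1)[OF B, of n] tile n by (intro integral_mono int) auto
      also have "\<dots> \<le> real n * r" by (rule mean[OF n])
      finally have "real n * (s - r) \<le> real n * (K * prob B) + K * real L"
        by (simp add: algebra_simps)
      also have "\<dots> \<le> real n * ((s - r) / 2) + K * real L"
        using pB K by (intro add_mono mult_left_mono) auto
      finally show ?thesis by (simp add: field_simps)
    qed
    moreover obtain n where "real n * ((s - r) / 2) > K * real L"
      using reals_Archimedean3[of "(s - r) / 2"] s by auto
    moreover have "n \<ge> 1" 
      using calculation(2) K by (cases n) (auto simp: mult_less_0_iff)
    ultimately show False by force
  qed
  ultimately have E0: "E \<in> null_sets M" by (simp add: null_sets_def emeasure_eq_measure)
  show ?thesis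
  proof (rule AE_I'[OF E0], intro subsetI)
    fix x assume "x \<in> {x \<in> space M. \<not> (\<forall>\<^sub>F n in sequentially. f n x \<le> real n * r')}"
    then have x: "x \<in> space M" and ne: "\<not> (\<forall>\<^sub>F n in sequentially. f n x \<le> real n * r')" by auto
    obtain q where q: "q \<in> \<rat>" "s < q" "q < r'" using Rats_dense_in_real[OF s(2)] by blast
    have "\<exists>n. n > N \<and> real n * q < f n x" for N
    proof -
      obtain n where "n \<ge> Suc N" "f n x > real n * r'"
        using ne by (auto simp: eventually_sequentially not_le)
      moreover have "real n * q \<le> real n * r'" using q by (intro mult_left_mono) auto
      ultimately show ?thesis by (intro exI[of _ n]) linarith
    qed
    then show "x \<in> E" using x q by (auto simp: E_def)
  qed
qed

text \<open>\<open>visits\<close> is additive along orbits, hence supadditive with equality, and its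
  one-step values are bounded below by \<open>0\<close>.\<close>

lemma visits_AE_upper:
  assumes [measurable]: "B \<in> sets M" and "prob B < \<eta>"
  shows "AE x in M. \<forall>\<^sub>F n in sequentially. real (visits B n x) \<le> real n * \<eta>"
proof (rule supadditive_AE_upper[where C = 0])
  show "integrable M (\<lambda>x. real (visits B n x))" for n by (rule integral_visits) measurable
  show "(\<integral>x. real (visits B n x) \<partial>M) \<le> real n * prob B" for n by (simp add: integral_visits)
qed (use assms in \<open>auto simp: visits_add\<close>)

text \<open>Egorov-type uniformity, by continuity of the measure along the increasing sets on which
  \<open>Q\<close> holds from \<open>N\<close> onwards. The later counts need one set that serves
  all large times.\<close>

lemma AE_eventually_uniform:
  assumes AE: "AE x in M. \<forall>\<^sub>F n in sequentially. Q n x"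
    and [measurable]: "\<And>n. Measurable.pred M (Q n)" and "\<delta> > 0"
  obtains Z N where "Z \<in> sets M" "prob Z > 1 - \<delta>" "\<And>n x. n \<ge> N \<Longrightarrow> x \<in> Z \<Longrightarrow> Q n x"
proof -
  define Z where "Z N = {x \<in> space M. \<forall>n\<in>{N..}. Q n x}" for N
  have [measurable]: "Z N \<in> sets M" for N unfolding Z_def by measurable
  have "AE x in M. x \<in> (\<Union>N. Z N)"
    using AE AE_space by eventually_elim (auto simp: Z_def eventually_sequentially)
  then have "prob (\<Union>N. Z N) = 1" by (intro prob_eq_1[THEN iffD2]) auto
  moreover have "incseq Z" by (auto simp: Z_def incseq_def)
  moreover have "range Z \<subseteq> sets M" by auto
  ultimately have "(\<lambda>N. prob (Z N)) \<longlonglongrightarrow> 1"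
    using finite_Lim_measure_incseq[of Z] by simp
  then have "\<forall>\<^sub>F N in sequentially. prob (Z N) > 1 - \<delta>" using \<open>\<delta> > 0\<close> by (intro order_tendstoD) auto
  then obtain N where "prob (Z N) > 1 - \<delta>"
    using eventually_happens trivial_limit_sequentially by blast
  then show ?thesis by (intro that[of "Z N" N]) (auto simp: Z_def)
qed

end

section \<open>Counting words\<close>

inductive parse :: "'b set \<Rightarrow> 'b list set \<Rightarrow> nat \<Rightarrow> 'b list \<Rightarrow> bool" for A W where
  parse_Nil: "parse A W b []"
| parse_word: "w \<in> W \<Longrightarrow> parse A W b v \<Longrightarrow> parse A W b (w @ v)"
| parse_letter: "c \<in> A \<Longrightarrow> parse A W b v \<Longrightarrow> parse A W (Suc b) (c # v)"

lemma parse_letters: "set v \<subseteq> A \<Longrightarrow> length v \<le> b \<Longrightarrow> parse A W b v"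
proof (induction v arbitrary: b)
  case (Cons c v)
  then show ?case by (cases b) (auto intro: parse.intros)
qed (rule parse.intros)

lemma parse_mono: "parse A W b v \<Longrightarrow> b \<le> b' \<Longrightarrow> parse A W b' v"
proof (induction arbitrary: b' rule: parse.induct)
  case (parse_letter c b v)
  then show ?case by (cases b') (auto intro: parse.intros)
qed (auto intro: parse.intros)

lemma parse_letters_in: "parse A W b v \<Longrightarrow> W \<subseteq> lists A \<Longrightarrow> v \<in> lists A"
  by (induction rule: parse.induct) auto

text \<open>A word of \<open>W\<close> of length \<open>l\<close> gets weight \<open>exp (- l s)\<close> and a single letter weight
  \<open>exp (- K)\<close>; the hypotheses say that the weights of all admissible first blocks add up to
  at most \<open>1\<close>.\<close>
lemma card_parse_le:
  assumes A: "finite A" and W: "W \<subseteq> lists A" "\<And>w. w \<in> W \<Longrightarrow> w \<noteq> []"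
    and weight: "\<And>n. (\<Sum>l=1..n. real (card {w \<in> W. length w = l}) * exp (- real l * s)) \<le> 1 / 2"
    and K: "real (card A) * exp (- K) \<le> 1 / 2" "K \<ge> 0" and s: "s \<ge> 0"
  shows "real (card {w. length w = n \<and> parse A W b w}) \<le> exp (real n * s + K * real b)"
proof (induction n arbitrary: b rule: less_induct)
  case (less n)
  define S where "S n b = {w. length w = n \<and> parse A W b w}" for n b
  have fS: "finite (S n b)" for n b
  proof (rule finite_subset)
    show "S n b \<subseteq> {w. set w \<subseteq> A \<and> length w = n}"
      using parse_letters_in[OF _ W(1)] by (auto simp: S_def)
  qed (rule finite_lists_length_eq[OF A])
  define W' where "W' l = {w \<in> W. length w = l}" for l
  have fW: "finite (W' l)" for l
  proof (rule finite_subset)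
    show "W' l \<subseteq> {w. set w \<subseteq> A \<and> length w = l}" using W(1) by (auto simp: W'_def)
  qed (rule finite_lists_length_eq[OF A])
  show ?case
  proof (cases "n = 0")
    case True
    have "{w. length w = n \<and> parse A W b w} \<subseteq> {[]}" using True by auto
    then have "card {w. length w = n \<and> parse A W b w} \<le> 1"
      by (metis card_mono card_Suc_eq finite.emptyI finite.insertI One_nat_def card.empty empty_iff)
    moreover have "1 \<le> exp (real n * s + K * real b)" using K s by (auto intro!: add_nonneg_nonneg)
    ultimately show ?thesis by linarith
  next
    case False
    \<comment> \<open>Split off the first block: \<open>U1\<close> collects the words that start
      with a block of \<open>W\<close>, \<open>U2\<close> those that start with a paid letter. By
      the induction hypothesis and the two weight conditions each contributes at most half of the
      bound.\<close>
    define U1 where "U1 = (\<Union>l\<in>{1..n}. (\<lambda>(u, v). u @ v) ` (W' l \<times> S (n - l) b))"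
    define U2 where "U2 = (if b = 0 then {} else (\<lambda>(c, v). c # v) ` (A \<times> S (n - 1) (b - 1)))"
    have "S n b \<subseteq> U1 \<union> U2"
    proof
      fix w assume "w \<in> S n b"
      then have len: "length w = n" and "parse A W b w" by (auto simp: S_def)
      from this(2) show "w \<in> U1 \<union> U2"
      proof cases
        case parse_Nil then show ?thesis using False len by simp
      next
        case (parse_word u v)
        then have "1 \<le> length u" using W(2) by (cases u) auto
        then have "length u \<in> {1..n}" "u \<in> W' (length u)" "v \<in> S (n - length u) b"
          using parse_word len by (auto simp: W'_def S_def)
        then show ?thesis using parse_word(1) unfolding U1_def by blast
      next
        case (parse_letter c b' v)
        then have "v \<in> S (n - 1) (b - 1)" "b \<noteq> 0" using len by (auto simp: S_def)
        then show ?thesis using parse_letter unfolding U2_def by auto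
      qed
    qed
    moreover have "finite U1" "finite U2"
      using fS fW A by (auto simp: U1_def U2_def)
    ultimately have "card (S n b) \<le> card U1 + card U2"
      by (meson card_Un_le card_mono finite_UnI le_trans)
    moreover have "real (card U1) \<le> exp (real n * s + K * real b) * (1 / 2)"
    proof -
      have "card U1 \<le> (\<Sum>l=1..n. card ((\<lambda>(u, v). u @ v) ` (W' l \<times> S (n - l) b)))"
        unfolding U1_def by (rule card_UN_le) simp
      also have "\<dots> \<le> (\<Sum>l=1..n. card (W' l) * card (S (n - l) b))"
        using fS fW by (intro sum_mono) (metis card_cartesian_product card_image_le finite_SigmaI)
      finally have "real (card U1) \<le> (\<Sum>l=1..n. real (card (W' l)) * real (card (S (n - l) b)))"
        unfolding of_nat_mult[symmetric] of_nat_sum[symmetric] of_nat_le_iff .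
      also have "\<dots> \<le> (\<Sum>l=1..n. real (card (W' l)) * exp (real (n - l) * s + K * real b))"
        using less.IH by (intro sum_mono mult_left_mono) (auto simp: S_def simp del: of_nat_diff)
      also have "\<dots> = exp (real n * s + K * real b)
          * (\<Sum>l=1..n. real (card (W' l)) * exp (- real l * s))"
        unfolding sum_distrib_left
        by (intro sum.cong) (auto simp: of_nat_diff algebra_simps simp flip: exp_add)
      also have "\<dots> \<le> exp (real n * s + K * real b) * (1 / 2)"
        using weight[of n] by (intro mult_left_mono) (auto simp: W'_def)
      finally show ?thesis .
    qed
    moreover have "real (card U2) \<le> exp (real n * s + K * real b) * (1 / 2)"
    proof (cases b)
      case 0 then show ?thesis by (simp add: U2_def)
    next
      case (Suc b')
      have "card U2 \<le> card A * card (S (n - 1) b')"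
        using fS A Suc by (simp add: U2_def)
          (metis card_cartesian_product card_image_le finite_SigmaI)
      then have "real (card U2) \<le> real (card A) * real (card (S (n - 1) b'))"
        by (metis of_nat_le_iff of_nat_mult)
      also have "\<dots> \<le> real (card A) * exp (real (n - 1) * s + K * real b')"
        using less.IH[of "n - 1" b'] False by (intro mult_left_mono) (auto simp: S_def)
      also have "\<dots> \<le> real (card A) * exp (- K + (real n * s + K * real b))"
        using s Suc by (intro mult_left_mono) (auto simp: algebra_simps intro!: mult_left_mono)
      also have "\<dots> = exp (real n * s + K * real b) * (real (card A) * exp (- K))"
        by (simp only: exp_add mult_ac)
      also have "\<dots> \<le> exp (real n * s + K * real b) * (1 / 2)"
        using K by (intro mult_left_mono) auto
      finally show ?thesis .
    qed
    ultimately show ?thesis unfolding S_def[symmetric] by linarith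
  qed
qed

lemma geometric_tail_le:
  fixes c :: real
  assumes "0 < k" "0 < c"
  obtains m where "m \<ge> 1" "\<And>n. (\<Sum>l=m..n. exp (- real l * k)) \<le> c"
proof -
  let ?r = "exp (- k)"
  have r: "0 < ?r" "?r < 1" using assms by auto
  have "(\<lambda>m. ?r ^ m / (1 - ?r)) \<longlonglongrightarrow> 0 / (1 - ?r)"
    using r by (intro tendsto_divide LIMSEQ_realpow_zero tendsto_const) auto
  then have "\<forall>\<^sub>F m in sequentially. ?r ^ m / (1 - ?r) < c"
    using assms by (intro order_tendstoD) auto
  then obtain m0 where m0: "\<And>m. m \<ge> m0 \<Longrightarrow> ?r ^ m / (1 - ?r) < c"
    by (auto simp: eventually_sequentially)
  define m where "m = max 1 m0"
  have "(\<Sum>l=m..n. exp (- real l * k)) \<le> c" for n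
  proof -
    have "(\<Sum>l=m..n. exp (- real l * k)) = (\<Sum>l=m..n. ?r ^ l)"
      by (intro sum.cong) (auto simp flip: exp_of_nat_mult)
    also have "\<dots> \<le> ?r ^ m / (1 - ?r)"
      using r by (subst sum_gp) (auto simp: divide_right_mono)
    also have "\<dots> \<le> c" using m0[of m] by (simp add: m_def)
    finally show ?thesis .
  qed
  then show ?thesis by (intro that[of m]) (auto simp: m_def)
qed

text \<open>Gibbs inequality, termwise from \<open>ln t \<le> t - 1\<close>. Allowing
  \<open>q\<close> a smaller total mass admits crude comparison weights that are not
  normalised.\<close>

lemma entropy_le_cross_entropy:
  fixes p q :: "'b \<Rightarrow> real"
  assumes "finite S" "\<And>w. w \<in> S \<Longrightarrow> p w \<ge> 0" "\<And>w. w \<in> S \<Longrightarrow> q w > 0" "sum q S \<le> sum p S"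
  shows "- (\<Sum>w\<in>S. p w * ln (p w)) \<le> - (\<Sum>w\<in>S. p w * ln (q w))"
proof -
  have "p w * ln (q w) - p w * ln (p w) \<le> q w - p w" if "w \<in> S" for w
  proof (cases "p w = 0")
    case False
    then have p: "p w > 0" using assms(2)[OF that] by simp
    have "p w * ln (q w) - p w * ln (p w) = p w * ln (q w / p w)"
      using p assms(3)[OF that] by (simp add: ln_div algebra_simps)
    also have "\<dots> \<le> p w * (q w / p w - 1)"
      using p assms(3)[OF that] by (intro mult_left_mono ln_le_minus_one) auto
    also have "\<dots> = q w - p w" using p by (simp add: field_simps)
    finally show ?thesis .
  qed (use assms(3)[OF that] in simp)
  then have "(\<Sum>w\<in>S. p w * ln (q w) - p w * ln (p w)) \<le> (\<Sum>w\<in>S. q w - p w)"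
    by (rule sum_mono)
  then show ?thesis using assms(4) by (simp add: sum_subtractf)
qed

section \<open>Cylinders of a partition\<close>

locale partition_system = ergodic_system +
  fixes P assumes P: "finite_meas_partition M P"
begin

definition label :: "'a \<Rightarrow> 'a set" where "label x = (THE A. A \<in> P \<and> x \<in> A)"

definition name :: "nat \<Rightarrow> 'a \<Rightarrow> 'a set list" where
  "name n x = map (\<lambda>i. label ((T ^^ i) x)) [0..<n]"

definition words :: "nat \<Rightarrow> 'a set list set" where
  "words n = {w. set w \<subseteq> P \<and> length w = n}"

text \<open>Defined through \<open>name\<close>, so that cylinders of different words of equal
  length are disjoint by construction; \<open>cyl_eq\<close> recovers the usual intersection of
  preimages.\<close>

definition cyl :: "'a set list \<Rightarrow> 'a set" where
  "cyl w = {x \<in> space M. name (length w) x = w}"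

lemma finite_P: "finite P" and P_sets: "A \<in> P \<Longrightarrow> A \<in> sets M"
  using P by (auto simp: finite_meas_partition_def)

lemma label_eq: "A \<in> P \<Longrightarrow> x \<in> A \<Longrightarrow> label x = A"
  using P unfolding label_def finite_meas_partition_def disjoint_def
  by (intro the_equality) blast+

lemma label_in: "x \<in> space M \<Longrightarrow> label x \<in> P" and in_label: "x \<in> space M \<Longrightarrow> x \<in> label x"
  using P label_eq[of _ x] unfolding finite_meas_partition_def by (metis UnionE)+

lemma length_name [simp]: "length (name n x) = n"
  by (simp add: name_def)

lemma nth_name: "i < n \<Longrightarrow> name n x ! i = label ((T ^^ i) x)"
  by (simp add: name_def)

lemma name_add: "name (m + n) x = name m x @ name n ((T ^^ m) x)"
  by (rule nth_equalityI) (auto simp: nth_append nth_name funpow_T_add)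

lemma name_in_words: "x \<in> space M \<Longrightarrow> name n x \<in> words n"
  using label_in funpow_T_space by (auto simp: words_def name_def)

lemma set_name: "x \<in> space M \<Longrightarrow> set (name n x) \<subseteq> P"
  using name_in_words by (auto simp: words_def)

lemma finite_words: "finite (words n)"
  unfolding words_def by (rule finite_lists_length_eq[OF finite_P])

lemma card_words: "card (words n) = card P ^ n"
  unfolding words_def by (rule card_lists_length_eq[OF finite_P])

lemma card_P: "card P \<ge> 1"
  using label_in not_empty finite_P by (metis One_nat_def Suc_leI card_gt_0_iff empty_iff ex_in_conv)

lemma cyl_eq: "set w \<subseteq> P \<Longrightarrow> cyl w = space M \<inter> (\<Inter>i<length w. (T ^^ i) -` (w ! i))"
proof -
  assume w: "set w \<subseteq> P"
  have "label ((T ^^ i) x) = w ! i \<longleftrightarrow> (T ^^ i) x \<in> w ! i" if "i < length w" "x \<in> space M" for i x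
    using label_eq[of "w ! i"] in_label[of "(T ^^ i) x"] that w funpow_T_space[of x i]
    by (metis nth_mem subsetD)
  then show ?thesis by (auto simp: cyl_def list_eq_iff_nth_eq nth_name)
qed

lemma cyl_sets: "set w \<subseteq> P \<Longrightarrow> cyl w \<in> sets M"
proof -
  assume w: "set w \<subseteq> P"
  have "(T ^^ i) -` (w ! i) \<inter> space M \<in> sets M" if "i < length w" for i
    using that w by (intro measurable_sets[OF funpow_T_measurable] P_sets) auto
  moreover have "cyl w = {x \<in> space M. \<forall>i\<in>{..<length w}. x \<in> (T ^^ i) -` (w ! i) \<inter> space M}"
    by (auto simp: cyl_eq[OF w])
  ultimately show ?thesis
    by (auto intro!: sets.sets_Collect_finite_All' simp: Int_def conj_commute)
qed

lemma cyl_words_sets: "w \<in> words n \<Longrightarrow> cyl w \<in> sets M"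
  by (rule cyl_sets) (simp add: words_def)

lemma disjoint_cyl: "disjoint_family_on cyl (words n)"
  by (auto simp: disjoint_family_on_def cyl_def words_def)

lemma in_cyl_name: "x \<in> space M \<Longrightarrow> x \<in> cyl (name n x)"
  by (simp add: cyl_def)

lemma prob_UN_cyl: "S \<subseteq> words n \<Longrightarrow> prob (\<Union>w\<in>S. cyl w) = (\<Sum>w\<in>S. prob (cyl w))"
  using disjoint_family_on_mono[OF _ disjoint_cyl] cyl_words_sets finite_subset[OF _ finite_words]
  by (intro finite_measure_finite_Union) auto

lemma sum_prob_cyl_le_1: "S \<subseteq> words n \<Longrightarrow> (\<Sum>w\<in>S. prob (cyl w)) \<le> 1"
  by (metis prob_UN_cyl prob_le_1)

lemma sum_prob_cyl: "(\<Sum>w\<in>words n. prob (cyl w)) = 1"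
proof -
  have "(\<Union>w\<in>words n. cyl w) = space M"
    by (auto intro: in_cyl_name name_in_words) (auto simp: cyl_def)
  then show ?thesis using prob_UN_cyl[of "words n" n] prob_space by simp
qed

lemma prob_le_sum_cyl:
  assumes "Z \<in> sets M" shows "prob Z \<le> (\<Sum>w\<in>name n ` Z. prob (cyl w))"
proof -
  have Z: "Z \<subseteq> space M" using assms by (rule sets.sets_into_space)
  then have S: "name n ` Z \<subseteq> words n" using name_in_words by auto
  have "Z \<subseteq> (\<Union>w\<in>name n ` Z. cyl w)" using Z in_cyl_name by blast
  moreover have "(\<Union>w\<in>name n ` Z. cyl w) \<in> sets M"
    using finite_subset[OF S finite_words] S cyl_words_sets by (intro sets.finite_UN) blast+
  ultimately have "prob Z \<le> prob (\<Union>w\<in>name n ` Z. cyl w)"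
    by (rule finite_measure_mono)
  then show ?thesis by (simp only: prob_UN_cyl[OF S])
qed

lemma card_large_cyl_le:
  assumes "S \<subseteq> words n" "\<And>w. w \<in> S \<Longrightarrow> t \<le> prob (cyl w)" shows "real (card S) * t \<le> 1"
proof -
  have "real (card S) * t \<le> (\<Sum>w\<in>S. prob (cyl w))" by (rule sum_bounded_below) (rule assms)
  also have "\<dots> \<le> 1" using assms by (intro sum_prob_cyl_le_1)
  finally show ?thesis .
qed

text \<open>There are finitely many names of length \<open>n\<close>, so any property of the name
  holds on a finite union of cylinders.\<close>

lemma pred_name [measurable]: "Measurable.pred M (\<lambda>x. R (name n x))"
proof -
  have "{x \<in> space M. R (name n x)} = (\<Union>w\<in>{w \<in> words n. R w}. cyl w)"
    using in_cyl_name name_in_words by (auto simp: cyl_def words_def)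
  also have "\<dots> \<in> sets M" using finite_words cyl_words_sets by (intro sets.finite_UN) auto
  finally show ?thesis by (simp add: pred_def)
qed

section \<open>Almost sure exponential decay rate of cylinder measures\<close>

lemma prob_cyl_name_Suc: 
  assumes "x \<in> space M" shows "prob (cyl (name (Suc n) x)) \<le> prob (cyl (name n (T x)))"
proof -
  have "cyl (name (Suc n) x) \<subseteq> T -` cyl (name n (T x)) \<inter> space M"
    using T_space name_add[of 1 n] by (auto simp: cyl_def)
  then have "prob (cyl (name (Suc n) x)) \<le> prob (T -` cyl (name n (T x)) \<inter> space M)"
    by (intro finite_measure_mono measurable_sets[OF T_measurable] cyl_sets set_name T_space assms)
  then show ?thesis by (simp add: prob_vimage_T cyl_sets set_name T_space assms)
qed

text \<open>The points at which the liminf of \<open>- ln (prob (cyl (name n x))) / n\<close> is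
  below \<open>a\<close>; the rational \<open>q\<close> strictly below \<open>a\<close> makes this a
  countable union.\<close>

definition fat :: "real \<Rightarrow> 'a set" where
  "fat a = {x \<in> space M. \<exists>q\<in>{q\<in>\<rat>. q < a}. \<forall>N. \<exists>n. n > N \<and> exp (- real n * q) < prob (cyl (name n x))}"

lemma fat_sets [measurable]: "fat a \<in> sets M"
proof -
  have "{x \<in> space M. \<forall>N. \<exists>n. n > N \<and> exp (- real n * q) < prob (cyl (name n x))} \<in> sets M" for q
    by (intro predE pred_intros_countable pred_name)
  moreover have "countable {q\<in>\<rat>. q < a}"
    using countable_rat by (rule countable_subset[rotated]) auto
  moreover have "fat a = (\<Union>q\<in>{q\<in>\<rat>. q < a}. {x \<in> space M. \<forall>N. \<exists>n. n > N \<and>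
      exp (- real n * q) < prob (cyl (name n x))})"
    by (auto simp: fat_def)
  ultimately show ?thesis using sets.countable_UN'' by auto
qed

lemma fat_mono: "a \<le> b \<Longrightarrow> fat a \<subseteq> fat b"
  unfolding fat_def by (blast intro: less_le_trans)

text \<open>Deleting the first letter of a name can only increase the measure of its cylinder, so
  \<open>fat a\<close> is forward invariant. \<open>zero_one\<close> asks for the opposite direction
  and is therefore applied to the complement.\<close>

lemma prob_fat: "prob (fat a) = 0 \<or> prob (fat a) = 1"
proof -
  have "prob (space M - fat a) = 0 \<or> prob (space M - fat a) = 1"
  proof (rule zero_one)
    fix x assume x: "x \<in> space M" "T x \<in> space M - fat a"
    have "T x \<in> fat a" if fat: "x \<in> fat a"
    proof -
      obtain q where q: "q \<in> \<rat>" "q < a"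
        "\<forall>N. \<exists>n. n > N \<and> exp (- real n * q) < prob (cyl (name n x))"
        using fat by (auto simp: fat_def)
      \<comment> \<open>Raising \<open>q\<close> to \<open>q'\<close> absorbs the factor lost when
        the length drops from \<open>Suc n\<close> to \<open>n\<close>.\<close>
      obtain q' where q': "q' \<in> \<rat>" "q < q'" "q' < a" using Rats_dense_in_real[OF q(2)] by blast
      have *: "\<exists>n. n > N \<and> exp (- real n * q') < prob (cyl (name n (T x)))" for N
      proof -
        obtain k where k: "q / (q' - q) \<le> real k" using real_arch_simple by blast
        obtain m where m: "m > Suc (max N k)" "exp (- real m * q) < prob (cyl (name m x))"
          using q(3) by blast
        obtain n where "m = Suc n" using m(1) by (cases m) auto
        then have n: "n > max N k" "exp (- real (Suc n) * q) < prob (cyl (name (Suc n) x))"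
          using m by simp_all
        have "q \<le> real k * (q' - q)" using k q' by (simp add: field_simps)
        also have "\<dots> \<le> real n * (q' - q)" using n q' by (intro mult_right_mono) auto
        finally have "exp (- real n * q') \<le> exp (- real (Suc n) * q)" by (simp add: algebra_simps)
        also have "\<dots> < prob (cyl (name n (T x)))"
          using n(2) prob_cyl_name_Suc[OF x(1)] by (rule less_le_trans)
        finally show ?thesis using n(1) by (intro exI[of _ n]) simp
      qed
      show ?thesis using q' x * by (auto simp: fat_def simp del: mult_minus_left)
    qed
    then show "x \<in> space M - fat a" using x by auto
  qed auto
  then show ?thesis by (auto simp: prob_compl)
qed

lemma prob_fat_nonpos: "a \<le> 0 \<Longrightarrow> prob (fat a) \<noteq> 1"
proof -
  assume a: "a \<le> 0"
  have "fat a = {}"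
  proof (rule equals0I)
    fix x assume "x \<in> fat a"
    then obtain q n where q: "q < a" "exp (- real n * q) < prob (cyl (name n x))"
      by (auto simp: fat_def)
    have "1 \<le> exp (- real n * q)" using q a by (simp add: mult_nonneg_nonpos)
    then show False using q prob_le_1[of "cyl (name n x)"] by linarith
  qed
  then show ?thesis by simp
qed

text \<open>Among the \<open>card P ^ n\<close> words, those of measure at most
  \<open>exp (- real n * q)\<close> have exponentially small total mass once
  \<open>q > ln (card P)\<close>. Hence the set defining \<open>rate\<close> is nonempty and its
  \<open>Inf\<close> is genuine.\<close>

lemma prob_fat_large: "prob (fat (ln (real (card P)) + 1)) = 1"
proof -
  let ?l = "ln (real (card P))"
  obtain q where q: "q \<in> \<rat>" "?l < q" "q < ?l + 1" using Rats_dense_in_real[of ?l "?l + 1"] by auto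
  define G where "G N = {x \<in> space M. \<exists>n. n > N \<and> exp (- real n * q) < prob (cyl (name n x))}" for N :: nat
  have [measurable]: "G N \<in> sets M" for N
    unfolding G_def by (intro predE pred_intros_countable pred_name)
  have "prob (space M - G N) = 0" for N
  proof -
    have "prob (space M - G N) \<le> exp (- real n * (q - ?l))" if "n > N" for n
    proof -
      define S where "S = {w \<in> words n. prob (cyl w) \<le> exp (- real n * q)}"
      have "x \<in> (\<Union>w\<in>S. cyl w)" if "x \<in> space M - G N" for x
      proof
        show "x \<in> cyl (name n x)" using that by (intro in_cyl_name) auto
        have "\<not> exp (- real n * q) < prob (cyl (name n x))"
          using that \<open>n > N\<close> unfolding G_def by blast
        then show "name n x \<in> S" using that by (auto simp: S_def name_in_words)
      qed
      then have "space M - G N \<subseteq> (\<Union>w\<in>S. cyl w)" by blast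
      then have "prob (space M - G N) \<le> prob (\<Union>w\<in>S. cyl w)"
        using cyl_words_sets finite_words by (intro finite_measure_mono sets.finite_UN) (auto simp: S_def)
      also have "\<dots> = (\<Sum>w\<in>S. prob (cyl w))" by (rule prob_UN_cyl) (auto simp: S_def)
      also have "\<dots> \<le> real (card S) * exp (- real n * q)"
        by (rule sum_bounded_above) (simp add: S_def)
      also have "\<dots> \<le> real (card (words n)) * exp (- real n * q)"
        using finite_words by (intro mult_right_mono) (auto simp: S_def intro!: card_mono)
      also have "real (card (words n)) = exp (real n * ?l)"
        using card_P by (simp add: card_words exp_of_nat_mult)
      finally show ?thesis by (simp add: algebra_simps flip: exp_add)
    qed
    then have "\<forall>\<^sub>F n in sequentially. prob (space M - G N) \<le> exp (- real n * (q - ?l))"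
      by (auto simp: eventually_sequentially intro!: exI[of _ "Suc N"])
    moreover have "(\<lambda>n. exp (- real n * (q - ?l))) \<longlonglongrightarrow> 0"
    proof -
      have "(\<lambda>n. exp (- (q - ?l)) ^ n) \<longlonglongrightarrow> 0" using q by (intro LIMSEQ_realpow_zero) auto
      then show ?thesis by (simp add: algebra_simps flip: exp_of_nat_mult)
    qed
    ultimately have "prob (space M - G N) \<le> 0"
      using tendsto_lowerbound trivial_limit_sequentially by blast
    then show ?thesis by (simp add: measure_le_0_iff)
  qed
  then have "AE x in M. x \<in> G N" for N
    by (subst prob_eq_1[symmetric]) (auto simp: prob_compl)
  then have "AE x in M. \<forall>N. x \<in> G N" by (simp add: AE_all_countable)
  then have "AE x in M. x \<in> fat (?l + 1)"
    by eventually_elim (use q in \<open>unfold G_def fat_def, blast\<close>)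
  then show ?thesis by (subst prob_eq_1) auto
qed

text \<open>The almost sure value of \<open>liminf - ln (prob (cyl (name n x))) / n\<close>.\<close>
definition rate :: real where "rate = Inf {a. prob (fat a) = 1}"

lemma bdd_fat: "bdd_below {a. prob (fat a) = 1}"
  using prob_fat_nonpos by (intro bdd_belowI[of _ 0]) (meson linear mem_Collect_eq)

lemma rate_nonneg: "0 \<le> rate"
  unfolding rate_def using prob_fat_large prob_fat_nonpos
  by (intro cInf_greatest) (auto, meson linear)

lemma prob_fat_above: "rate < a \<Longrightarrow> prob (fat a) = 1"
proof -
  assume "rate < a"
  then obtain b where b: "prob (fat b) = 1" "b < a"
    unfolding rate_def using cInf_lessD[of "{a. prob (fat a) = 1}" a] prob_fat_large by auto
  then have "prob (fat b) \<le> prob (fat a)" by (intro finite_measure_mono fat_mono) auto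
  then show ?thesis using b prob_le_1[of "fat a"] by simp
qed

text \<open>For \<open>b < rate\<close> the zero-one alternative makes \<open>fat b\<close> a null
  set; off it, the bound can fail at finitely many lengths only.\<close>

lemma AE_cyl_small:
  assumes "a < rate"
  shows "AE x in M. \<forall>\<^sub>F n in sequentially. prob (cyl (name n x)) \<le> exp (- real n * a)"
proof -
  obtain b where b: "a < b" "b < rate" using assms dense by blast
  obtain q where q: "q \<in> \<rat>" "a < q" "q < b" using Rats_dense_in_real[OF b(1)] by blast
  have "prob (fat b) \<noteq> 1"
    using b(2) cInf_lower[OF _ bdd_fat, of b] by (auto simp: rate_def)
  then have "fat b \<in> null_sets M"
    using prob_fat[of b] by (auto simp: null_sets_def emeasure_eq_measure)
  then have "AE x in M. x \<notin> fat b" by (rule AE_not_in)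
  then show ?thesis using AE_space
  proof eventually_elim
    case (elim x)
    then have "\<not> (\<forall>N. \<exists>n. n > N \<and> exp (- real n * q) < prob (cyl (name n x)))"
      using q unfolding fat_def by blast
    then obtain N where N: "\<And>n. n > N \<Longrightarrow> prob (cyl (name n x)) \<le> exp (- real n * q)"
      by (meson not_less)
    have "prob (cyl (name n x)) \<le> exp (- real n * a)" if "n > N" for n
    proof -
      have "exp (- real n * q) \<le> exp (- real n * a)" using q by (auto intro!: mult_left_mono)
      then show ?thesis using N[OF that] by linarith
    qed
    then show ?case by (auto simp: eventually_sequentially intro!: exI[of _ "Suc N"])
  qed
qed

end

section \<open>Block entropy\<close>

lemma finite_parse:
  assumes "finite A" "W \<subseteq> lists A" shows "finite {w. length w = n \<and> parse A W b w}"
proof (rule finite_subset)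
  show "{w. length w = n \<and> parse A W b w} \<subseteq> {w. set w \<subseteq> A \<and> length w = n}"
    using parse_letters_in[OF _ assms(2)] by auto
qed (rule finite_lists_length_eq[OF assms(1)])

context partition_system
begin

text \<open>Typical orbits can be tiled, up to a small proportion of the time, by boundedly long
  blocks whose cylinders are fat; there are few names of such blocks, so the names of typical
  points are parsed words as counted in \<open>card_parse_le\<close>.\<close>
lemma few_names:
  assumes "rate < a" "\<delta> > 0"
  obtains Z N where "Z \<in> sets M" "prob Z > 1 - \<delta>"
    "\<And>n. n \<ge> N \<Longrightarrow> real (card (name n ` Z)) \<le> exp (real n * a)"
proof -
  \<comment> \<open>The gap \<open>a - rate\<close> is split into four: the level \<open>a0\<close>
    of fat blocks, the decay of the block weights, the letters paid on visits to \<open>B\<close>,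
    and the last \<open>L\<close> letters use one \<open>d\<close> each.\<close>
  define d where "d = (a - rate) / 4"
  have d: "d > 0" using assms by (simp add: d_def)
  define a0 where "a0 = rate + d"
  \<comment> \<open>Makes the total weight of single letters equal to \<open>1 / 2\<close>, the
    share that \<open>card_parse_le\<close> leaves for them.\<close>
  define K where "K = ln (2 * real (card P))"
  have K: "K \<ge> 0" "real (card P) * exp (- K) \<le> 1 / 2"
    using card_P by (auto simp: K_def exp_minus field_simps)
  \<comment> \<open>Blocks shorter than \<open>m\<close> are discarded, so that the block weights,
    at most \<open>exp (- real l * d)\<close> in each length \<open>l\<close>, sum to at most
    \<open>1 / 2\<close>.\<close>
  obtain m where m: "m \<ge> 1" "\<And>n. (\<Sum>l=m..n. exp (- real l * d)) \<le> 1 / 2"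
    using geometric_tail_le[OF d, of "1 / 2"] by auto
  define D where "D L = {x \<in> space M. \<exists>l\<in>{m..L}. exp (- real l * a0) < prob (cyl (name l x))}" for L
  have D [measurable]: "D L \<in> sets M" for L
    unfolding D_def by (intro predE pred_intros_finite pred_name) auto
  have "fat a0 \<subseteq> (\<Union>L. D L)"
  proof
    fix x assume "x \<in> fat a0"
    then obtain q where x: "x \<in> space M" and q: "q < a0"
      and *: "\<forall>N. \<exists>n. n > N \<and> exp (- real n * q) < prob (cyl (name n x))"
      by (auto simp: fat_def)
    obtain n where n: "n > m" "exp (- real n * q) < prob (cyl (name n x))" using * by blast
    moreover have "exp (- real n * a0) \<le> exp (- real n * q)" using q by (auto intro!: mult_left_mono)
    ultimately have "exp (- real n * a0) < prob (cyl (name n x))" by linarith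
    then have "x \<in> D n" using x n by (auto simp: D_def intro!: bexI[of _ n])
    then show "x \<in> (\<Union>L. D L)" by blast
  qed
  then have "prob (\<Union>L. D L) = 1"
    using finite_measure_mono[of "fat a0" "\<Union>L. D L"] prob_fat_above[of a0] d prob_le_1[of "\<Union>L. D L"]
    by (intro antisym) (auto simp: a0_def)
  moreover have "incseq D" by (force simp: D_def incseq_def)
  moreover have "range D \<subseteq> sets M" by auto
  ultimately have lim: "(\<lambda>L. prob (D L)) \<longlonglongrightarrow> 1"
    using finite_Lim_measure_incseq[of D] by simp
  define \<eta> where "\<eta> = d / (K + 1)"
  have \<eta>: "\<eta> > 0" "K * \<eta> \<le> d" using K d by (auto simp: \<eta>_def field_simps)
  have "1 - \<eta> < 1" using \<eta> by simp
  then obtain L where L: "prob (D L) > 1 - \<eta>"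
    using order_tendstoD(1)[OF lim] eventually_happens trivial_limit_sequentially by blast
  define B where "B = space M - D L"
  have B [measurable]: "B \<in> sets M" by (simp add: B_def)
  have "prob B < \<eta>" using L by (simp add: B_def prob_compl)
  note AE = visits_AE_upper[OF B this]
  have pm: "Measurable.pred M (\<lambda>x. real (visits B n x) \<le> real n * \<eta>)" for n by measurable
  obtain Z N where Z: "Z \<in> sets M" "prob Z > 1 - \<delta>"
    and N: "\<And>n x. n \<ge> N \<Longrightarrow> x \<in> Z \<Longrightarrow> real (visits B n x) \<le> real n * \<eta>"
    using AE_eventually_uniform[OF AE pm \<open>\<delta> > 0\<close>] by blast
  define W where "W = {w. \<exists>l\<in>{m..L}. w \<in> words l \<and> exp (- real l * a0) < prob (cyl w)}"
  have W: "W \<subseteq> lists P" "\<And>w. w \<in> W \<Longrightarrow> w \<noteq> []"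
    using m by (auto simp: W_def words_def)
  have weight: "(\<Sum>l=1..n. real (card {w \<in> W. length w = l}) * exp (- real l * (a0 + d))) \<le> 1 / 2" for n
  proof -
    have "(\<Sum>l=1..n. real (card {w \<in> W. length w = l}) * exp (- real l * (a0 + d)))
        = (\<Sum>l=m..n. real (card {w \<in> W. length w = l}) * exp (- real l * (a0 + d)))"
    proof (intro sum.mono_neutral_right ballI)
      fix l assume "l \<in> {1..n} - {m..n}"
      then have none: "{w \<in> W. length w = l} = {}" by (auto simp: W_def words_def)
      show "real (card {w \<in> W. length w = l}) * exp (- real l * (a0 + d)) = 0"
        unfolding none by simp
    qed (use m in auto)
    \<comment> \<open>At most \<open>exp (real l * a0)\<close> words of length \<open>l\<close> have
      a cylinder of measure above \<open>exp (- real l * a0)\<close>.\<close>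
    also have "\<dots> \<le> (\<Sum>l=m..n. exp (- real l * d))"
    proof (rule sum_mono)
      fix l
      have "real (card {w \<in> W. length w = l}) * exp (- real l * a0) \<le> 1"
        by (rule card_large_cyl_le[of _ l]) (auto simp: W_def words_def)
      then have "real (card {w \<in> W. length w = l}) * exp (- real l * a0) * exp (- real l * d)
          \<le> 1 * exp (- real l * d)"
        by (intro mult_right_mono) auto
      moreover have "exp (- real l * (a0 + d)) = exp (- real l * a0) * exp (- real l * d)"
        by (simp add: algebra_simps flip: exp_add)
      ultimately show "real (card {w \<in> W. length w = l}) * exp (- real l * (a0 + d)) \<le> exp (- real l * d)"
        by (simp only: mult.assoc mult_1)
    qed
    also have "\<dots> \<le> 1 / 2" by (rule m)
    finally show ?thesis .
  qed
  \<comment> \<open>Greedy parsing along the orbit: a visit to \<open>B\<close> costs one letter, a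
    point of \<open>D L\<close> opens a block of \<open>W\<close>, and the extra \<open>L\<close>
    pays for the end, once at most \<open>L\<close> letters remain.\<close>
  have parse: "parse P W (visits B n x + L) (name n x)" if "x \<in> space M" for n x
    using that
  proof (induction n arbitrary: x rule: less_induct)
    case (less n)
    note x = less.prems
    consider "n \<le> L" | "n > L" "x \<in> B" "n > 0" | "n > L" "x \<in> D L"
    proof -
      have "n \<le> L \<or> n > L" "n = 0 \<or> n > 0" "x \<in> B \<or> x \<in> D L" using x by (auto simp: B_def)
      then show ?thesis using that by blast
    qed
    then show ?case
    proof cases
      case 1
      then show ?thesis using set_name[OF x] by (intro parse_letters) auto
    next
      case 2
      have "visits B n x = Suc (visits B (n - 1) (T x))"
        using visits_add[of B 1 "n - 1" x] 2 by (simp add: visits_1)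
      moreover have "name n x = label x # name (n - 1) (T x)"
        using name_add[of 1 "n - 1" x] 2 by (simp add: name_def)
      ultimately show ?thesis
        using less.IH[of "n - 1" "T x"] 2 x T_space label_in by (auto intro: parse_letter)
    next
      case 3
      then obtain l where l: "m \<le> l" "l \<le> L" "exp (- real l * a0) < prob (cyl (name l x))"
        by (auto simp: D_def)
      then have "name l x \<in> W" using name_in_words[OF x] unfolding W_def by (intro CollectI bexI[of _ l]) auto
      moreover have "parse P W (visits B (n - l) ((T ^^ l) x) + L) (name (n - l) ((T ^^ l) x))"
        using 3 l m funpow_T_space x by (intro less.IH) auto
      ultimately have "parse P W (visits B (n - l) ((T ^^ l) x) + L) (name l x @ name (n - l) ((T ^^ l) x))"
        by (rule parse_word)
      moreover have "name n x = name l x @ name (n - l) ((T ^^ l) x)"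
        using name_add[of l "n - l" x] 3 l by simp
      moreover have "visits B n x = visits B l x + visits B (n - l) ((T ^^ l) x)"
        using visits_add[of B l "n - l" x] 3 l by simp
      ultimately show ?thesis by (auto elim: parse_mono)
    qed
  qed
  obtain N' where N': "K * real L / d \<le> real N'" using real_arch_simple by blast
  have "real (card (name n ` Z)) \<le> exp (real n * a)" if n: "n \<ge> max N N'" for n
  proof -
    define b where "b = nat \<lfloor>real n * \<eta>\<rfloor> + L"
    have b: "real b \<le> real n * \<eta> + real L" using \<eta> by (auto simp: b_def)
    have "name n ` Z \<subseteq> {w. length w = n \<and> parse P W b w}"
    proof safe
      fix x assume x: "x \<in> Z"
      then have "real (visits B n x) \<le> real n * \<eta>" using N n by simp
      then have "visits B n x + L \<le> b" by (simp add: b_def le_nat_floor)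
      moreover have "x \<in> space M" using Z x sets.sets_into_space by blast
      ultimately show "parse P W b (name n x)" using parse parse_mono by blast
    qed simp
    then have "card (name n ` Z) \<le> card {w. length w = n \<and> parse P W b w}"
      by (intro card_mono finite_parse finite_P W)
    then have "real (card (name n ` Z)) \<le> exp (real n * (a0 + d) + K * real b)"
      using card_parse_le[OF finite_P W weight K(2,1), of n b] rate_nonneg d
      by (simp add: a0_def)
    also have "real n * (a0 + d) + K * real b \<le> real n * a"
    proof -
      have "K * real b \<le> K * (real n * \<eta> + real L)" using b K by (intro mult_left_mono)
      also have "\<dots> = real n * (K * \<eta>) + K * real L" by (simp add: algebra_simps)
      also have "\<dots> \<le> real n * d + real n * d"
      proof (intro add_mono mult_left_mono \<eta>)
        have "K * real L \<le> real N' * d" using N' d by (simp add: field_simps)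
        also have "\<dots> \<le> real n * d" using n d by (intro mult_right_mono) auto
        finally show "K * real L \<le> real n * d" .
      qed simp
      finally have "real n * (a0 + d) + K * real b \<le> real n * (a0 + d) + (real n * d + real n * d)"
        by simp
      also have "\<dots> = real n * (a0 + 3 * d)" by (simp add: algebra_simps)
      also have "a0 + 3 * d = a" by (simp add: a0_def d_def field_simps)
      finally show ?thesis .
    qed
    finally show ?thesis by simp
  qed
  then show ?thesis using that[of Z "max N N'"] Z by blast
qed

definition block_entropy :: "nat \<Rightarrow> real" where
  "block_entropy n = - (\<Sum>w\<in>words n. prob (cyl w) * ln (prob (cyl w)))"

lemma entropy_term_nonneg: "0 \<le> - (prob A * ln (prob A))"
  using prob_le_1[of A] measure_nonneg[of M A]
  by (cases "prob A = 0") (auto simp: mult_le_0_iff zero_less_measure_iff)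

lemma block_entropy_nonneg: "0 \<le> block_entropy n"
  unfolding block_entropy_def sum_negf[symmetric] by (rule sum_nonneg) (rule entropy_term_nonneg)

text \<open>The names of a typical set carry mass above \<open>1 - \<delta>\<close>, and each of
  their cylinders that is not null has \<open>- ln\<close> of its measure at least
  \<open>n * a\<close>; the remaining terms are nonnegative.\<close>

lemma block_entropy_lower:
  assumes "a < rate" "0 \<le> a" "\<delta> > 0"
  shows "\<forall>\<^sub>F n in sequentially. (1 - \<delta>) * real n * a \<le> block_entropy n"
proof -
  obtain Z N where Z: "Z \<in> sets M" "prob Z > 1 - \<delta>"
    and N: "\<And>n x. n \<ge> N \<Longrightarrow> x \<in> Z \<Longrightarrow> prob (cyl (name n x)) \<le> exp (- real n * a)"
    using AE_cyl_small[OF assms(1)] \<open>\<delta> > 0\<close> pred_name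
    by (elim AE_eventually_uniform[where Q = "\<lambda>n x. prob (cyl (name n x)) \<le> exp (- real n * a)"]) auto
  have "(1 - \<delta>) * real n * a \<le> block_entropy n" if n: "n \<ge> N" for n
  proof -
    have ZS: "Z \<subseteq> space M" using Z sets.sets_into_space by blast
    then have S: "name n ` Z \<subseteq> words n" using name_in_words by auto
    have "(1 - \<delta>) * (real n * a) \<le> (\<Sum>w\<in>name n ` Z. prob (cyl w)) * (real n * a)"
      using Z prob_le_sum_cyl[OF Z(1), of n] assms by (intro mult_right_mono) auto
    also have "\<dots> \<le> (\<Sum>w\<in>name n ` Z. - (prob (cyl w) * ln (prob (cyl w))))"
      unfolding sum_distrib_right
    proof (rule sum_mono)
      fix w assume w: "w \<in> name n ` Z"
      show "prob (cyl w) * (real n * a) \<le> - (prob (cyl w) * ln (prob (cyl w)))"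
      proof (cases "prob (cyl w) = 0")
        case False
        then have pos: "prob (cyl w) > 0" by (simp add: zero_less_measure_iff)
        have "prob (cyl w) \<le> exp (- real n * a)" using N n w by auto
        then have "ln (prob (cyl w)) \<le> - real n * a" using pos by (metis exp_gt_zero ln_exp ln_le_cancel_iff)
        then have "prob (cyl w) * (real n * a) \<le> prob (cyl w) * - ln (prob (cyl w))"
          using pos by (intro mult_left_mono) auto
        then show ?thesis by simp
      qed simp
    qed
    also have "\<dots> \<le> (\<Sum>w\<in>words n. - (prob (cyl w) * ln (prob (cyl w))))"
      using S finite_words entropy_term_nonneg by (intro sum_mono2) auto
    also have "\<dots> = block_entropy n" by (simp add: block_entropy_def sum_negf)
    finally show ?thesis by (simp add: mult.assoc)
  qed
  then show ?thesis by (auto simp: eventually_sequentially)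
qed

text \<open>Comparison with weights that give at most half their mass to the few typical names and
  at most half to the other words: a typical name costs \<open>ln 2 + n * a\<close>, any other
  \<open>ln 2 + n * ln (card P)\<close>, and the latter carry mass at most
  \<open>\<delta>\<close>.\<close>

lemma block_entropy_upper:
  assumes "rate < a" "\<delta> > 0"
  shows "\<forall>\<^sub>F n in sequentially.
    block_entropy n \<le> ln 2 + real n * a + \<delta> * real n * ln (real (card P))"
proof -
  obtain Z N where Z: "Z \<in> sets M" "prob Z > 1 - \<delta>"
    and N: "\<And>n. n \<ge> N \<Longrightarrow> real (card (name n ` Z)) \<le> exp (real n * a)"
    using few_names[OF assms] by metis
  have ZS: "Z \<subseteq> space M" using Z sets.sets_into_space by blast
  let ?l = "ln (real (card P))"
  have l: "?l \<ge> 0" using card_P by simp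
  have "block_entropy n \<le> ln 2 + real n * a + \<delta> * real n * ?l" if n: "n \<ge> N" for n
  proof -
    let ?p = "\<lambda>w. prob (cyl w)"
    let ?S = "name n ` Z"
    have S: "?S \<subseteq> words n" using name_in_words ZS by auto
    have fS: "finite ?S" using S finite_words by (rule finite_subset)
    define q where "q w = (if w \<in> ?S then exp (- real n * a) / 2 else exp (- real n * ?l) / 2)" for w
    have split: "(\<Sum>w\<in>words n. g w) = (\<Sum>w\<in>?S. g w) + (\<Sum>w\<in>words n - ?S. g w)" for g :: "'a set list \<Rightarrow> real"
      using sum.subset_diff[OF S finite_words, of g] by simp
    have cw: "real (card (words n)) = exp (real n * ?l)"
      using card_P by (simp add: card_words exp_of_nat_mult)
    have "(\<Sum>w\<in>?S. q w) \<le> exp (real n * a) * (exp (- real n * a) / 2)"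
      using N[OF n] by (simp add: q_def)
    also have "\<dots> = 1 / 2" by (simp flip: exp_add)
    finally have q1: "(\<Sum>w\<in>?S. q w) \<le> 1 / 2" .
    have "(\<Sum>w\<in>words n - ?S. q w) = real (card (words n - ?S)) * (exp (- real n * ?l) / 2)"
      by (simp add: q_def)
    also have "\<dots> \<le> real (card (words n)) * (exp (- real n * ?l) / 2)"
      using finite_words by (intro mult_right_mono) (auto intro!: card_mono)
    also have "\<dots> = 1 / 2" by (simp add: cw flip: exp_add)
    finally have q2: "(\<Sum>w\<in>words n. q w) \<le> 1" using q1 by (simp add: split)
    have "block_entropy n \<le> - (\<Sum>w\<in>words n. ?p w * ln (q w))"
      unfolding block_entropy_def using q2
      by (intro entropy_le_cross_entropy finite_words) (auto simp: sum_prob_cyl q_def)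
    also have "\<dots> = (\<Sum>w\<in>words n. ?p w * - ln (q w))" by (simp add: sum_negf)
    also have "\<dots> = (\<Sum>w\<in>?S. ?p w * (ln 2 + real n * a)) + (\<Sum>w\<in>words n - ?S. ?p w * (ln 2 + real n * ?l))"
      unfolding split by (intro arg_cong2[of _ _ _ _ "(+)"] sum.cong) (auto simp: q_def ln_div)
    also have "\<dots> = ln 2 * (\<Sum>w\<in>words n. ?p w) + (\<Sum>w\<in>?S. ?p w) * (real n * a)
        + (\<Sum>w\<in>words n - ?S. ?p w) * (real n * ?l)"
      by (simp add: split algebra_simps sum.distrib sum_distrib_left)
    also have "\<dots> \<le> ln 2 * 1 + 1 * (real n * a) + \<delta> * (real n * ?l)"
    proof (intro add_mono mult_right_mono)
      show "(\<Sum>w\<in>?S. ?p w) \<le> 1" by (rule sum_prob_cyl_le_1[OF S])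
      show "(\<Sum>w\<in>words n - ?S. ?p w) \<le> \<delta>"
        using split[of ?p] sum_prob_cyl[of n] Z prob_le_sum_cyl[OF Z(1), of n] by linarith
    qed (use l rate_nonneg assms sum_prob_cyl in auto)
    finally show ?thesis by (simp add: mult.assoc)
  qed
  then show ?thesis by (auto simp: eventually_sequentially)
qed

text \<open>The upper and lower bounds share the leading coefficient, so the whole sequence
  converges although \<open>rate\<close> comes from a liminf.\<close>

lemma block_entropy_tendsto: "(\<lambda>n. block_entropy n / real n) \<longlonglongrightarrow> rate"
proof (rule order_tendstoI)
  fix a assume a: "a < rate"
  show "\<forall>\<^sub>F n in sequentially. a < block_entropy n / real n"
  proof (cases "a < 0")
    case True
    have "0 \<le> block_entropy n / real n" for n using block_entropy_nonneg by simp
    then show ?thesis using True by (auto intro!: always_eventually intro: less_le_trans)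
  next
    case False
    define a' where "a' = (a + rate) / 2"
    have a': "a < a'" "a' < rate" "0 < a'" using a False by (auto simp: a'_def)
    \<comment> \<open>Chosen so that \<open>(1 - \<delta>) * a'\<close> is the midpoint of
      \<open>a\<close> and \<open>a'\<close>.\<close>
    define \<delta> where "\<delta> = (a' - a) / (2 * a')"
    have \<delta>: "\<delta> > 0" "a < (1 - \<delta>) * a'" using a' by (auto simp: \<delta>_def field_simps)
    have "\<forall>\<^sub>F n in sequentially. (1 - \<delta>) * real n * a' \<le> block_entropy n"
      using a' \<delta> by (intro block_entropy_lower) auto
    then show ?thesis using eventually_gt_at_top[of 0]
    proof eventually_elim
      case (elim n)
      then have "(1 - \<delta>) * a' \<le> block_entropy n / real n" by (simp add: field_simps)
      then show ?case using \<delta> by linarith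
    qed
  qed
next
  fix a assume a: "rate < a"
  define d where "d = (a - rate) / 4"
  have d: "d > 0" using a by (simp add: d_def)
  have l: "ln (real (card P)) \<ge> 0" using card_P by simp
  define \<delta> where "\<delta> = d / (ln (real (card P)) + 1)"
  have \<delta>: "\<delta> > 0" "\<delta> * ln (real (card P)) \<le> d" using d l by (auto simp: \<delta>_def field_simps)
  have "\<forall>\<^sub>F n in sequentially. block_entropy n \<le> ln 2 + real n * (rate + d) + \<delta> * real n * ln (real (card P))"
    using d \<delta> by (intro block_entropy_upper) auto
  moreover have "\<forall>\<^sub>F n in sequentially. ln 2 / d \<le> real n"
    using eventually_ge_at_top[of "nat \<lceil>ln 2 / d\<rceil>"] by eventually_elim linarith
  ultimately show "\<forall>\<^sub>F n in sequentially. block_entropy n / real n < a"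
    using eventually_gt_at_top[of 0]
  proof eventually_elim
    case (elim n)
    have "ln 2 \<le> real n * d" using elim(2) d by (simp add: field_simps)
    moreover have "real n * (\<delta> * ln (real (card P))) \<le> real n * d"
      using \<delta> by (intro mult_left_mono) auto
    ultimately have "block_entropy n \<le> real n * (rate + 3 * d)"
      using elim(1) by (simp add: algebra_simps)
    also have "\<dots> < real n * (rate + 4 * d)" using elim(3) d by (intro mult_strict_left_mono) auto
    also have "rate + 4 * d = a" by (simp add: d_def field_simps)
    finally show ?case using elim(3) by (simp add: field_simps)
  qed
qed

lemma part_join_eq: "part_join M T P n = cyl ` words n"
proof (intro equalityI subsetI)
  fix A assume "A \<in> part_join M T P n"
  then obtain a where a: "\<forall>i<n. a i \<in> P" "A = space M \<inter> (\<Inter>i<n. (T ^^ i) -` a i)"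
    by (auto simp: part_join_def)
  then have *: "set (map a [0..<n]) \<subseteq> P" by auto
  then have "map a [0..<n] \<in> words n" "A = cyl (map a [0..<n])"
    by (auto simp: words_def cyl_eq[OF *] a(2))
  then show "A \<in> cyl ` words n" by blast
next
  fix A assume "A \<in> cyl ` words n"
  then obtain w where "set w \<subseteq> P" "length w = n" "A = cyl w" by (auto simp: words_def)
  then show "A \<in> part_join M T P n"
    unfolding part_join_def by (auto simp: cyl_eq intro!: exI[of _ "(!) w"])
qed

lemma part_entropy_rate_eq: "part_entropy_rate M T P = rate"
proof -
  have "part_entropy M (part_join M T P n) = block_entropy n" for n
  proof -
    have "(\<Sum>A\<in>cyl ` words n. prob A * ln (prob A)) = (\<Sum>w\<in>words n. prob (cyl w) * ln (prob (cyl w)))"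
    \<comment> \<open>\<open>part_join\<close> is a set of sets and counts a repeated cylinder once.
      Distinct words share a cylinder only if it is empty, and the entropy term of the empty set is
      zero.\<close>
    proof (subst sum.reindex_nontrivial[OF finite_words])
      fix v w assume "v \<in> words n" "w \<in> words n" "v \<noteq> w" "cyl v = cyl w"
      then have "cyl v = {}" using disjoint_cyl[of n] by (auto simp: disjoint_family_on_def)
      then show "prob (cyl v) * ln (prob (cyl v)) = 0" by simp
    qed (simp add: o_def)
    then show ?thesis by (simp add: part_entropy_def part_join_eq block_entropy_def)
  qed
  then show ?thesis
    unfolding part_entropy_rate_def using block_entropy_tendsto by (simp add: limI)
qed

end

section \<open>Comparison of the pressures\<close>

text \<open>\<open>Lim\<close> is meaningful only once convergence is known. Quantities that grow as
  the scale shrinks do converge, and their limit at \<open>0\<close> is the supremum over all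
  positive scales.\<close>

lemma antimono_tendsto_SUP_at_right:
  fixes f :: "real \<Rightarrow> ereal"
  assumes "\<And>x y. 0 < x \<Longrightarrow> x \<le> y \<Longrightarrow> f y \<le> f x"
  shows "(f \<longlongrightarrow> (SUP x\<in>{0<..}. f x)) (at_right 0)"
proof (rule order_tendstoI)
  fix a assume "a < (SUP x\<in>{0<..}. f x)"
  then obtain x where x: "x > 0" "a < f x" by (auto simp: less_SUP_iff)
  show "\<forall>\<^sub>F y in at_right 0. a < f y"
    using eventually_at_right_real[OF x(1)]
    by eventually_elim (use x assms in \<open>auto intro: less_le_trans\<close>)
next
  fix a assume "(SUP x\<in>{0<..}. f x) < a"
  then show "\<forall>\<^sub>F y in at_right 0. f y < a"
    using eventually_at_right_real[of 0 1]
    by (auto elim!: eventually_mono intro: le_less_trans[OF SUP_upper])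
qed

lemma Lim_at_right_eq_SUP:
  fixes f :: "real \<Rightarrow> ereal"
  assumes "\<And>x y. 0 < x \<Longrightarrow> x \<le> y \<Longrightarrow> f y \<le> f x"
  shows "Lim (at_right 0) f = (SUP x\<in>{0<..}. f x)"
  by (rule tendsto_Lim[OF _ antimono_tendsto_SUP_at_right[OF assms]]) auto

lemma Liminf_at_right_eq_SUP:
  fixes f :: "real \<Rightarrow> ereal"
  assumes "\<And>x y. 0 < x \<Longrightarrow> x \<le> y \<Longrightarrow> f y \<le> f x"
  shows "Liminf (at_right 0) f = (SUP x\<in>{0<..}. f x)"
  by (rule lim_imp_Liminf[OF _ antimono_tendsto_SUP_at_right[OF assms]]) auto

lemma ereal_le_if_below_reals:
  fixes x y :: ereal
  assumes "\<And>s :: real. y < ereal s \<Longrightarrow> x \<le> ereal s" shows "x \<le> y"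
proof (rule ccontr)
  assume "\<not> x \<le> y"
  then obtain s where "y < ereal s" "ereal s < x" using ereal_dense2[of y x] by (auto simp: not_le)
  then show False using assms[of s] by simp
qed

lemma elog_mono: "x \<le> y \<Longrightarrow> elog x \<le> elog y"
  by (simp add: elog_def)

text \<open>Valid at \<open>n = 0\<close> too, where the division multiplies by infinity, a
  nonnegative factor; so termwise comparison covers every index of a limsup.\<close>

lemma elog_div_mono: "x \<le> y \<Longrightarrow> elog x / ereal (real n) \<le> elog y / ereal (real n)"
  unfolding divide_ereal_def by (intro ereal_mult_right_mono elog_mono) (auto simp: inverse_ereal.simps)

lemma elog_div_le: "0 < n \<Longrightarrow> x \<le> exp (real n * s) \<Longrightarrow> elog x / ereal (real n) \<le> ereal s"
proof -
  assume n: "0 < n" and x: "x \<le> exp (real n * s)"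
  have "elog x / ereal (real n) \<le> elog (exp (real n * s)) / ereal (real n)" by (rule elog_div_mono[OF x])
  also have "\<dots> = ereal s" using n by (simp add: elog_def)
  finally show ?thesis .
qed

lemma elog_div_less: "0 < n \<Longrightarrow> elog x / ereal (real n) < ereal s \<Longrightarrow> x < exp (real n * s)"
proof (rule ccontr)
  assume n: "0 < n" and x: "elog x / ereal (real n) < ereal s" "\<not> x < exp (real n * s)"
  have "ereal s = elog (exp (real n * s)) / ereal (real n)" using n by (simp add: elog_def)
  also have "\<dots> \<le> elog x / ereal (real n)" using x by (intro elog_div_mono) simp
  finally show False using x by simp
qed

lemma sum_UN_le:
  fixes f :: "'b \<Rightarrow> real"
  assumes "finite I" "\<And>i. i \<in> I \<Longrightarrow> finite (A i)" "\<And>x. f x \<ge> 0"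
  shows "(\<Sum>x\<in>(\<Union>i\<in>I. A i). f x) \<le> (\<Sum>i\<in>I. \<Sum>x\<in>A i. f x)"
  using assms(1,2)
proof (induction I rule: finite_induct)
  case (insert i I)
  have "(\<Sum>x\<in>(\<Union>j\<in>insert i I. A j). f x) \<le> (\<Sum>x\<in>A i. f x) + (\<Sum>x\<in>(\<Union>j\<in>I. A j). f x)"
    using insert.prems insert.hyps assms(3)
    by (simp add: sum_Un sum_nonneg)
  then show ?case using insert by simp
qed simp

locale supadditive_system = ergodic_system M T
  for M :: "'a::metric_space measure" and T +
  fixes X :: "'a set" and \<phi> :: "nat \<Rightarrow> 'a \<Rightarrow> real"
  assumes compact_X: "compact X"
    and continuous_T: "continuous_on X T"
    and potential: "supadditive_potential X T \<phi>"
    and space_M: "space M = X"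
    and sets_M: "sets M = sets (restrict_space borel X)"
begin

section \<open>Topology and measurability on the compact space\<close>

lemma funpow_X: "x \<in> X \<Longrightarrow> (T ^^ n) x \<in> X"
  using funpow_T_space by (simp add: space_M)

lemma continuous_funpow: "continuous_on X (T ^^ n)"
proof (induction n)
  case (Suc n)
  have "continuous_on X (T \<circ> (T ^^ n))"
    using funpow_X by (intro continuous_on_compose Suc continuous_on_subset[OF continuous_T]) auto
  then show ?case by simp
qed (simp add: continuous_on_id')

lemma open_sets: "open U \<Longrightarrow> X \<inter> U \<in> sets M"
  by (auto simp: sets_M sets_restrict_space)

lemma closed_sets: "closed U \<Longrightarrow> X \<inter> U \<in> sets M"
  by (auto simp: sets_M sets_restrict_space)

lemma openin_sets: "openin (top_of_set X) U \<Longrightarrow> U \<in> sets M"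
  by (auto simp: openin_open open_sets)

lemma continuous_measurable: "continuous_on X f \<Longrightarrow> f \<in> borel_measurable M"
  for f :: "'a \<Rightarrow> real"
  using borel_measurable_continuous_on_restrict measurable_cong_sets[OF sets_M refl] by blast

lemma continuous_bounded:
  fixes f :: "'a \<Rightarrow> real"
  assumes "continuous_on X f" obtains C where "C \<ge> 0" "\<And>x. x \<in> X \<Longrightarrow> \<bar>f x\<bar> \<le> C"
proof -
  have "bounded (f ` X)" using compact_X assms by (intro compact_imp_bounded compact_continuous_image)
  then obtain C where "\<And>x. x \<in> X \<Longrightarrow> \<bar>f x\<bar> \<le> C" by (auto simp: bounded_iff)
  then show ?thesis using that[of "max C 0"] by (meson max.coboundedI1 max.cobounded2)
qed

lemma continuous_integrable:
  fixes f :: "'a \<Rightarrow> real"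
  assumes "continuous_on X f" shows "integrable M f"
proof -
  obtain C where "\<And>x. x \<in> X \<Longrightarrow> \<bar>f x\<bar> \<le> C" using assms continuous_bounded by metis
  then show ?thesis
    using continuous_measurable[OF assms] by (intro integrable_const_bound[of _ C]) (auto simp: space_M)
qed

lemma continuous_\<phi>: "n \<ge> 1 \<Longrightarrow> continuous_on X (\<phi> n)"
  using potential by (simp add: supadditive_potential_def)

lemma \<phi>_add: "x \<in> X \<Longrightarrow> n \<ge> 1 \<Longrightarrow> m \<ge> 1 \<Longrightarrow> \<phi> n x + \<phi> m ((T ^^ n) x) \<le> \<phi> (n + m) x"
  using potential by (simp add: supadditive_potential_def)

section \<open>Bowen balls, finite covers and their exponential sums\<close>

lemma openin_bowen_ball:
  assumes "x \<in> X" shows "openin (top_of_set X) (bowen_ball X T n x e)"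
proof (induction n)
  case 0
  then show ?case by (simp add: bowen_ball_def)
next
  case (Suc n)
  have "openin (top_of_set X) (X \<inter> (T ^^ n) -` ball ((T ^^ n) x) e)"
    by (intro continuous_openin_preimage_gen continuous_funpow) simp
  moreover have "bowen_ball X T (Suc n) x e
      = bowen_ball X T n x e \<inter> (X \<inter> (T ^^ n) -` ball ((T ^^ n) x) e)"
    by (auto simp: bowen_ball_def less_Suc_eq)
  ultimately show ?case using Suc by (simp add: openin_Int)
qed

lemma bowen_ball_sets: "x \<in> X \<Longrightarrow> bowen_ball X T n x e \<in> sets M"
  by (intro openin_sets openin_bowen_ball)

lemma UN_bowen_ball_sets: "finite F \<Longrightarrow> F \<subseteq> X \<Longrightarrow> (\<Union>x\<in>F. bowen_ball X T n x e) \<in> sets M"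
  using bowen_ball_sets by (intro sets.finite_UN) auto

lemma bowen_ball_mono: "e \<le> e' \<Longrightarrow> bowen_ball X T n x e \<subseteq> bowen_ball X T n x e'"
  by (force simp: bowen_ball_def)

text \<open>Besides compactness, the point is that the sets of sums behind \<open>cap_Lambda\<close>
  and \<open>span_sum\<close> become nonempty, so that their real \<open>Inf\<close> is approximated
  by actual finite covers.\<close>

lemma finite_bowen_cover:
  assumes "e > 0" obtains F where "finite F" "F \<subseteq> X" "X \<subseteq> (\<Union>x\<in>F. bowen_ball X T n x e)"
proof -
  let ?C = "(\<lambda>x. bowen_ball X T n x e) ` X"
  have "X \<subseteq> \<Union>?C" using assms by (auto simp: bowen_ball_def)
  moreover have "\<forall>c\<in>?C. openin (top_of_set X) c" using openin_bowen_ball by auto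
  ultimately obtain D where D: "D \<subseteq> ?C" "finite D" "X \<subseteq> \<Union>D"
    using compact_X unfolding compact_eq_openin_cover by metis
  obtain F where "F \<subseteq> X" "finite F" "D = (\<lambda>x. bowen_ball X T n x e) ` F"
    using finite_subset_image[OF D(2,1)] by blast
  then show ?thesis using that D(3) by auto
qed

lemma cap_Lambda_less:
  assumes "cap_Lambda X T \<phi> Z n e < t" "Z \<subseteq> X" "e > 0"
  obtains F where "finite F" "F \<subseteq> X" "Z \<subseteq> (\<Union>x\<in>F. bowen_ball X T n x e)" "(\<Sum>x\<in>F. exp (\<phi> n x)) < t"
proof -
  obtain F where F: "finite F" "F \<subseteq> X" "X \<subseteq> (\<Union>x\<in>F. bowen_ball X T n x e)"
    using finite_bowen_cover[OF assms(3)] .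
  then have ne: "{(\<Sum>x\<in>F. exp (\<phi> n x)) | F. finite F \<and> F \<subseteq> X \<and> Z \<subseteq> (\<Union>x\<in>F. bowen_ball X T n x e)} \<noteq> {}"
    using assms(2) by blast
  show ?thesis
    using cInf_lessD[OF ne assms(1)[unfolded cap_Lambda_def]] that by blast
qed

lemma span_sum_less:
  assumes "span_sum X T \<phi> M n e \<delta> < t" "e > 0" "\<delta> > 0"
  obtains F where "finite F" "F \<subseteq> X" "1 - \<delta> \<le> prob (\<Union>x\<in>F. bowen_ball X T n x e)"
    "(\<Sum>x\<in>F. exp (\<phi> n x)) < t"
proof -
  obtain F where F: "finite F" "F \<subseteq> X" "X \<subseteq> (\<Union>x\<in>F. bowen_ball X T n x e)"
    using finite_bowen_cover[OF assms(2)] .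
  then have "prob X \<le> prob (\<Union>x\<in>F. bowen_ball X T n x e)"
    by (intro finite_measure_mono UN_bowen_ball_sets)
  then have "1 - \<delta> \<le> prob (\<Union>x\<in>F. bowen_ball X T n x e)"
    using prob_space assms(3) by (simp add: space_M)
  then have ne: "{(\<Sum>x\<in>F. exp (\<phi> n x)) | F. finite F \<and> F \<subseteq> X \<and>
       measure M (\<Union>x\<in>F. bowen_ball X T n x e) \<ge> 1 - \<delta>} \<noteq> {}"
    using F by blast
  show ?thesis
    using cInf_lessD[OF ne assms(1)[unfolded span_sum_def]] that by blast
qed

lemma bdd_below_exp_sums: "bdd_below {(\<Sum>x\<in>F. exp (\<phi> n x)) | F. R F}"
  by (rule bdd_belowI[of _ 0]) (auto intro: sum_nonneg)

lemma cap_Lambda_le: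
  assumes "finite F" "F \<subseteq> X" "Z \<subseteq> (\<Union>x\<in>F. bowen_ball X T n x e)"
  shows "cap_Lambda X T \<phi> Z n e \<le> (\<Sum>x\<in>F. exp (\<phi> n x))"
  unfolding cap_Lambda_def using assms by (intro cInf_lower bdd_below_exp_sums) blast

lemma span_sum_le:
  assumes "finite F" "F \<subseteq> X" "1 - \<delta> \<le> prob (\<Union>x\<in>F. bowen_ball X T n x e)"
  shows "span_sum X T \<phi> M n e \<delta> \<le> (\<Sum>x\<in>F. exp (\<phi> n x))"
  unfolding span_sum_def using assms by (intro cInf_lower bdd_below_exp_sums) blast

lemma span_sum_le_cap_Lambda:
  assumes "Z \<in> sets M" "1 - \<delta> \<le> prob Z" "e > 0"
  shows "span_sum X T \<phi> M n e \<delta> \<le> cap_Lambda X T \<phi> Z n e"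
proof (rule ccontr)
  assume "\<not> ?thesis"
  moreover have "Z \<subseteq> X" using assms sets.sets_into_space by (simp add: space_M[symmetric])
  ultimately obtain F where F: "finite F" "F \<subseteq> X" "Z \<subseteq> (\<Union>x\<in>F. bowen_ball X T n x e)"
    "(\<Sum>x\<in>F. exp (\<phi> n x)) < span_sum X T \<phi> M n e \<delta>"
    using assms by (metis cap_Lambda_less not_le)
  moreover have "prob Z \<le> prob (\<Union>x\<in>F. bowen_ball X T n x e)"
    using F by (intro finite_measure_mono UN_bowen_ball_sets)
  ultimately show False using span_sum_le[of F \<delta> n e] assms by linarith
qed

lemma cap_Lambda_antimono:
  assumes "0 < e" "e \<le> e'" "Z \<subseteq> X" shows "cap_Lambda X T \<phi> Z n e' \<le> cap_Lambda X T \<phi> Z n e"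
proof (rule ccontr)
  assume "\<not> ?thesis"
  then obtain F where F: "finite F" "F \<subseteq> X" "Z \<subseteq> (\<Union>x\<in>F. bowen_ball X T n x e)"
    "(\<Sum>x\<in>F. exp (\<phi> n x)) < cap_Lambda X T \<phi> Z n e'"
    using assms by (metis cap_Lambda_less not_le)
  moreover have "Z \<subseteq> (\<Union>x\<in>F. bowen_ball X T n x e')" using F bowen_ball_mono[OF assms(2)] by blast
  ultimately show False using cap_Lambda_le[of F Z n e'] by linarith
qed

lemma span_sum_antimono:
  assumes "0 < e" "e \<le> e'" "0 < \<delta>" "\<delta> \<le> \<delta>'"
  shows "span_sum X T \<phi> M n e' \<delta>' \<le> span_sum X T \<phi> M n e \<delta>"
proof (rule ccontr)
  assume "\<not> ?thesis"
  then obtain F where F: "finite F" "F \<subseteq> X" "1 - \<delta> \<le> prob (\<Union>x\<in>F. bowen_ball X T n x e)"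
    "(\<Sum>x\<in>F. exp (\<phi> n x)) < span_sum X T \<phi> M n e' \<delta>'"
    using assms by (metis span_sum_less not_le)
  moreover have "prob (\<Union>x\<in>F. bowen_ball X T n x e) \<le> prob (\<Union>x\<in>F. bowen_ball X T n x e')"
    using F bowen_ball_mono[OF assms(2)] by (intro finite_measure_mono UN_bowen_ball_sets UN_mono) auto
  ultimately show False using span_sum_le[of F \<delta>' n e'] assms by linarith
qed

section \<open>Monotonicity in scale and mass; limits as suprema\<close>

lemma span_pressure_eps_delta_antimono:
  assumes "0 < e" "e \<le> e'" "0 < \<delta>" "\<delta> \<le> \<delta>'"
  shows "span_pressure_eps_delta X T \<phi> M e' \<delta>' \<le> span_pressure_eps_delta X T \<phi> M e \<delta>"
  unfolding span_pressure_eps_delta_def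
  by (intro Limsup_mono always_eventually allI elog_div_mono span_sum_antimono assms)

lemma span_pressure_delta_eq:
  "0 < \<delta> \<Longrightarrow> span_pressure_delta X T \<phi> M \<delta> = (SUP e\<in>{0<..}. span_pressure_eps_delta X T \<phi> M e \<delta>)"
  unfolding span_pressure_delta_def
  by (intro Lim_at_right_eq_SUP span_pressure_eps_delta_antimono) auto

lemma span_pressure_eq:
  "span_pressure X T \<phi> M = (SUP \<delta>\<in>{0<..}. SUP e\<in>{0<..}. span_pressure_eps_delta X T \<phi> M e \<delta>)"
proof -
  have "span_pressure X T \<phi> M = (SUP \<delta>\<in>{0<..}. span_pressure_delta X T \<phi> M \<delta>)"
    unfolding span_pressure_def
  proof (rule Lim_at_right_eq_SUP)
    fix \<delta> \<delta>' :: real assume "0 < \<delta>" "\<delta> \<le> \<delta>'"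
    then show "span_pressure_delta X T \<phi> M \<delta>' \<le> span_pressure_delta X T \<phi> M \<delta>"
      by (auto simp: span_pressure_delta_eq intro!: SUP_mono' SUP_mono span_pressure_eps_delta_antimono)
  qed
  then show ?thesis by (simp add: span_pressure_delta_eq)
qed

lemma Inf_large_sets_antimono:
  fixes g :: "'a set \<Rightarrow> ereal"
  assumes "\<delta> \<le> \<delta>'"
  shows "Inf {g Z | Z. Z \<in> sets M \<and> 1 - \<delta>' \<le> prob Z} \<le> Inf {g Z | Z. Z \<in> sets M \<and> 1 - \<delta> \<le> prob Z}"
  using assms by (intro Inf_superset_mono) force

lemma lower_cap_meas_eps_eq:
  "lower_cap_meas_eps X T \<phi> M e =
    (SUP \<delta>\<in>{0<..}. Inf {lower_cap_set_eps X T \<phi> Z e | Z. Z \<in> sets M \<and> 1 - \<delta> \<le> prob Z})"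
  unfolding lower_cap_meas_eps_def by (intro Lim_at_right_eq_SUP Inf_large_sets_antimono)

lemma upper_cap_meas_eps_eq:
  "upper_cap_meas_eps X T \<phi> M e =
    (SUP \<delta>\<in>{0<..}. Inf {upper_cap_set_eps X T \<phi> Z e | Z. Z \<in> sets M \<and> 1 - \<delta> \<le> prob Z})"
  unfolding upper_cap_meas_eps_def by (intro Lim_at_right_eq_SUP Inf_large_sets_antimono)

lemma upper_cap_set_eps_antimono:
  assumes "0 < e" "e \<le> e'" "Z \<in> sets M"
  shows "upper_cap_set_eps X T \<phi> Z e' \<le> upper_cap_set_eps X T \<phi> Z e"
  unfolding upper_cap_set_eps_def
  using sets.sets_into_space[OF assms(3)]
  by (intro Limsup_mono always_eventually allI elog_div_mono cap_Lambda_antimono assms) (simp add: space_M)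

lemma upper_cap_meas_eq: "upper_cap_meas X T \<phi> M = (SUP e\<in>{0<..}. upper_cap_meas_eps X T \<phi> M e)"
  unfolding upper_cap_meas_def
proof (rule Liminf_at_right_eq_SUP)
  fix e e' :: real assume e: "0 < e" "e \<le> e'"
  show "upper_cap_meas_eps X T \<phi> M e' \<le> upper_cap_meas_eps X T \<phi> M e"
    unfolding upper_cap_meas_eps_eq
  proof (intro SUP_mono' Inf_mono)
    fix \<delta> b assume "b \<in> {upper_cap_set_eps X T \<phi> Z e | Z. Z \<in> sets M \<and> 1 - \<delta> \<le> prob Z}"
    then show "\<exists>a\<in>{upper_cap_set_eps X T \<phi> Z e' | Z. Z \<in> sets M \<and> 1 - \<delta> \<le> prob Z}. a \<le> b"
      using upper_cap_set_eps_antimono[OF e] by blast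
  qed
qed

section \<open>Inequalities between the four pressures\<close>

lemma lower_cap_meas_le_upper_cap_meas: "lower_cap_meas X T \<phi> M \<le> upper_cap_meas X T \<phi> M"
  unfolding lower_cap_meas_def upper_cap_meas_def
proof (intro Liminf_mono always_eventually allI)
  fix e
  have "lower_cap_set_eps X T \<phi> Z e \<le> upper_cap_set_eps X T \<phi> Z e" for Z
    unfolding lower_cap_set_eps_def upper_cap_set_eps_def by (rule Liminf_le_Limsup) simp
  then show "lower_cap_meas_eps X T \<phi> M e \<le> upper_cap_meas_eps X T \<phi> M e"
    unfolding lower_cap_meas_eps_eq upper_cap_meas_eps_eq
    by (intro SUP_mono' Inf_mono) blast
qed

text \<open>The centres of a finite Bowen cover of a set of measure at least
  \<open>1 - \<delta>\<close> form a spanning set.\<close>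

lemma span_pressure_le_upper_cap_meas: "span_pressure X T \<phi> M \<le> upper_cap_meas X T \<phi> M"
  unfolding span_pressure_eq
proof (intro SUP_least)
  fix \<delta> e :: real assume "\<delta> \<in> {0<..}" "e \<in> {0<..}"
  then have pos: "\<delta> > 0" "e > 0" by auto
  have "span_pressure_eps_delta X T \<phi> M e \<delta> \<le> upper_cap_set_eps X T \<phi> Z e"
    if "Z \<in> sets M" "1 - \<delta> \<le> prob Z" for Z
    unfolding span_pressure_eps_delta_def upper_cap_set_eps_def
    using that pos by (intro Limsup_mono always_eventually allI elog_div_mono span_sum_le_cap_Lambda)
  then have "span_pressure_eps_delta X T \<phi> M e \<delta>
      \<le> Inf {upper_cap_set_eps X T \<phi> Z e | Z. Z \<in> sets M \<and> 1 - \<delta> \<le> prob Z}"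
    by (intro Inf_greatest) blast
  also have "\<dots> \<le> upper_cap_meas_eps X T \<phi> M e"
    unfolding upper_cap_meas_eps_eq using pos by (intro SUP_upper) simp
  also have "\<dots> \<le> upper_cap_meas X T \<phi> M"
    unfolding upper_cap_meas_eq using pos by (intro SUP_upper) simp
  finally show "span_pressure_eps_delta X T \<phi> M e \<delta> \<le> upper_cap_meas X T \<phi> M" .
qed

text \<open>The limsup of good covered sets \<open>A j\<close> with \<open>prob (A j) \<ge> 1 - 1 / (j + 1)\<close> has full
  measure, and its tails are Caratheodory covers with geometrically small sums.\<close>
lemma car_pressure_meas_eps_le:
  assumes "\<And>\<delta> N. \<delta> > 0 \<Longrightarrow> \<exists>n\<ge>N. \<exists>F. finite F \<and> F \<subseteq> X \<and>
      1 - \<delta> \<le> prob (\<Union>x\<in>F. bowen_ball X T n x e) \<and> (\<Sum>x\<in>F. exp (\<phi> n x)) \<le> exp (real n * s)"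
  shows "car_pressure_meas_eps X T \<phi> M e \<le> ereal s"
proof (rule ereal_le_epsilon2)
  fix d :: real assume d: "d > 0"
  have "\<forall>j. \<exists>n F. n \<ge> j \<and> finite F \<and> F \<subseteq> X \<and>
      1 - inverse (real (Suc j)) \<le> prob (\<Union>x\<in>F. bowen_ball X T n x e) \<and>
      (\<Sum>x\<in>F. exp (\<phi> n x)) \<le> exp (real n * s)"
    using assms by (metis inverse_positive_iff_positive of_nat_0_less_iff zero_less_Suc)
  then obtain n F where nF: "\<And>j. n j \<ge> j" "\<And>j. finite (F j)" "\<And>j. F j \<subseteq> X"
      "\<And>j. 1 - inverse (real (Suc j)) \<le> prob (\<Union>x\<in>F j. bowen_ball X T (n j) x e)"
      "\<And>j. (\<Sum>x\<in>F j. exp (\<phi> (n j) x)) \<le> exp (real (n j) * s)"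
    by metis
  define A where "A j = (\<Union>x\<in>F j. bowen_ball X T (n j) x e)" for j
  have A [measurable]: "A j \<in> sets M" for j unfolding A_def by (intro UN_bowen_ball_sets nF)
  define Z where "Z = (\<Inter>J. \<Union>j\<in>{J..}. A j)"
  have Z [measurable]: "Z \<in> sets M" unfolding Z_def by measurable
  have "AE x in M. x \<in> (\<Union>j\<in>{J..}. A j)" for J
  proof -
    have "(\<lambda>j. 1 - inverse (real (Suc j))) \<longlonglongrightarrow> 1 - 0"
      by (intro tendsto_diff tendsto_const LIMSEQ_inverse_real_of_nat)
    moreover have "1 - inverse (real (Suc j)) \<le> prob (\<Union>j\<in>{J..}. A j)" if "j \<ge> J" for j
    proof -
      have "prob (A j) \<le> prob (\<Union>j\<in>{J..}. A j)" using that by (intro finite_measure_mono) auto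
      then show ?thesis using nF(4)[of j] by (simp add: A_def)
    qed
    ultimately have "1 \<le> prob (\<Union>j\<in>{J..}. A j)" by (intro LIMSEQ_le_const2) auto
    then have "prob (\<Union>j\<in>{J..}. A j) = 1" by (intro antisym prob_le_1)
    then show ?thesis by (subst (asm) prob_eq_1) auto
  qed
  then have "AE x in M. x \<in> Z" by (simp add: Z_def AE_all_countable)
  then have prob_Z: "prob Z = 1" by (subst prob_eq_1) auto
  have "car_M X T \<phi> Z (s + d) N e = 0" for N
  proof -
    have *: "car_M X T \<phi> Z (s + d) N e \<le> 0 + ennreal c" if c: "c > 0" for c
    proof -
      obtain m where m: "\<And>k. (\<Sum>l=m..k. exp (- real l * d)) \<le> c"
        using geometric_tail_le[OF d c] by blast
      \<comment> \<open>With exponent \<open>s + d\<close> the cover at time \<open>n j\<close> sums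
        to at most \<open>exp (- real (n j) * d)\<close>, hence to at most
        \<open>exp (- real j * d)\<close> since \<open>n j \<ge> j\<close>. Starting from
        \<open>m\<close> makes the tail small, starting from \<open>N\<close> keeps all times
        admissible.\<close>
      define J where "J = max m N"
      define C where "C = (\<Union>j\<in>{J..}. F j \<times> {n j})"
      define g where "g p = exp (- (s + d) * real (snd p) + \<phi> (snd p) (fst p))" for p :: "'a \<times> nat"
      have "countable C" unfolding C_def using nF(2)
        by (intro countable_UN countable_SIGMA) (auto intro: countable_finite)
      moreover have "C \<subseteq> X \<times> {N..}" using nF(1,3) by (force simp: C_def J_def intro: order_trans)
      moreover have "Z \<subseteq> (\<Union>p\<in>C. bowen_ball X T (snd p) (fst p) e)"
        by (force simp: Z_def A_def C_def)
      ultimately have "car_M X T \<phi> Z (s + d) N e \<le> (\<Sum>\<^sub>\<infinity>p\<in>C. ennreal (g p))"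
        unfolding car_M_def g_def by (intro Inf_lower) blast
      also have "\<dots> = (SUP G\<in>{G. finite G \<and> G \<subseteq> C}. \<Sum>p\<in>G. ennreal (g p))"
        by (rule nonneg_infsum_complete) simp
      also have "\<dots> \<le> ennreal c"
      proof (rule SUP_least)
        fix G assume "G \<in> {G. finite G \<and> G \<subseteq> C}"
        then have G: "finite G" "G \<subseteq> C" by auto
        have "\<exists>k. G \<subseteq> (\<Union>j\<in>{J..k}. F j \<times> {n j})" using G
        proof (induction G rule: finite_induct)
          case (insert p G)
          then obtain k where "G \<subseteq> (\<Union>j\<in>{J..k}. F j \<times> {n j})" by auto
          moreover obtain j where "j \<ge> J" "p \<in> F j \<times> {n j}" using insert by (auto simp: C_def)
          ultimately have "insert p G \<subseteq> (\<Union>j\<in>{J..max j k}. F j \<times> {n j})" by fastforce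
          then show ?case by blast
        qed auto
        then obtain k where k: "G \<subseteq> (\<Union>j\<in>{J..k}. F j \<times> {n j})" by blast
        have "(\<Sum>p\<in>G. g p) \<le> (\<Sum>p\<in>(\<Union>j\<in>{J..k}. F j \<times> {n j}). g p)"
          using k nF(2) by (intro sum_mono2) (auto simp: g_def)
        \<comment> \<open>Only an inequality, since different \<open>j\<close> may share the same
          time \<open>n j\<close> and their sets may then overlap.\<close>
        also have "\<dots> \<le> (\<Sum>j=J..k. \<Sum>p\<in>F j \<times> {n j}. g p)"
          using nF(2) by (intro sum_UN_le) (auto simp: g_def)
        also have "\<dots> \<le> (\<Sum>j=J..k. exp (- real j * d))"
        proof (rule sum_mono)
          fix j
          have "(\<Sum>p\<in>F j \<times> {n j}. g p) = (\<Sum>x\<in>F j. g (x, n j))"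
            by (rule sum.reindex_bij_witness[of _ "\<lambda>x. (x, n j)" fst]) auto
          also have "\<dots> = exp (- (s + d) * real (n j)) * (\<Sum>x\<in>F j. exp (\<phi> (n j) x))"
            by (simp add: g_def exp_add sum_distrib_left)
          also have "\<dots> \<le> exp (- (s + d) * real (n j)) * exp (real (n j) * s)"
            using nF(5) by (intro mult_left_mono) auto
          also have "\<dots> = exp (- real (n j) * d)" by (simp add: algebra_simps flip: exp_add)
          also have "\<dots> \<le> exp (- real j * d)" using nF(1)[of j] d by simp
          finally show "(\<Sum>p\<in>F j \<times> {n j}. g p) \<le> exp (- real j * d)" .
        qed
        also have "\<dots> \<le> (\<Sum>j=m..k. exp (- real j * d))"
          by (intro sum_mono2) (auto simp: J_def)
        also have "\<dots> \<le> c" by (rule m)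
        finally have "(\<Sum>p\<in>G. g p) \<le> c" .
        then show "(\<Sum>p\<in>G. ennreal (g p)) \<le> ennreal c"
          by (subst sum_ennreal) (auto simp: g_def intro: ennreal_leI)
      qed
      finally show ?thesis by simp
    qed
    have "car_M X T \<phi> Z (s + d) N e \<le> 0" by (rule ennreal_le_epsilon) (rule *)
    then show ?thesis by simp
  qed
  then have "(\<lambda>N. car_M X T \<phi> Z (s + d) N e) = (\<lambda>_. 0)" by blast
  then have "car_m X T \<phi> Z (s + d) e = 0" by (simp only: car_m_def limI[OF tendsto_const])
  then have "car_pressure_set_eps X T \<phi> Z e \<le> ereal (s + d)"
    unfolding car_pressure_set_eps_def by (intro Inf_lower) auto
  moreover have "car_pressure_meas_eps X T \<phi> M e \<le> car_pressure_set_eps X T \<phi> Z e"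
    unfolding car_pressure_meas_eps_def using Z prob_Z by (intro Inf_lower) auto
  ultimately show "car_pressure_meas_eps X T \<phi> M e \<le> ereal s + ereal d" by simp
qed

text \<open>A liminf below \<open>s\<close> yields a good time beyond every \<open>N\<close>, which
  is what \<open>car_pressure_meas_eps_le\<close> asks for each \<open>\<delta>\<close>; the covered
  set may change with \<open>\<delta>\<close>.\<close>

lemma car_pressure_meas_le_lower_cap_meas: "car_pressure_meas X T \<phi> M \<le> lower_cap_meas X T \<phi> M"
  unfolding car_pressure_meas_def lower_cap_meas_def
proof (rule Liminf_mono)
  have "car_pressure_meas_eps X T \<phi> M e \<le> lower_cap_meas_eps X T \<phi> M e" if e: "e > 0" for e
  proof (rule ereal_le_if_below_reals, rule car_pressure_meas_eps_le)
    fix s \<delta> :: real and N assume s: "lower_cap_meas_eps X T \<phi> M e < ereal s" and \<delta>: "\<delta> > 0"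
    have "Inf {lower_cap_set_eps X T \<phi> Z e | Z. Z \<in> sets M \<and> 1 - \<delta> \<le> prob Z} < ereal s"
      using s \<delta> unfolding lower_cap_meas_eps_eq by (meson SUP_lessD greaterThan_iff)
    then obtain Z where Z: "Z \<in> sets M" "1 - \<delta> \<le> prob Z" "lower_cap_set_eps X T \<phi> Z e < ereal s"
      by (auto simp: Inf_less_iff)
    have "\<not> (\<forall>\<^sub>F n in sequentially. ereal s \<le> elog (cap_Lambda X T \<phi> Z n e) / ereal (real n))"
    proof
      assume "\<forall>\<^sub>F n in sequentially. ereal s \<le> elog (cap_Lambda X T \<phi> Z n e) / ereal (real n)"
      then have "ereal s \<le> lower_cap_set_eps X T \<phi> Z e"
        unfolding lower_cap_set_eps_def by (rule Liminf_bounded)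
      then show False using Z(3) by simp
    qed
    \<comment> \<open>\<open>Suc N\<close> keeps \<open>n\<close> positive, as the passage from
      \<open>elog\<close> back to \<open>exp\<close> requires.\<close>
    then obtain n where n: "n \<ge> Suc N" "elog (cap_Lambda X T \<phi> Z n e) / ereal (real n) < ereal s"
      unfolding eventually_sequentially by (meson not_le)
    then have "cap_Lambda X T \<phi> Z n e < exp (real n * s)" by (intro elog_div_less) auto
    moreover have "Z \<subseteq> X" using Z sets.sets_into_space by (simp add: space_M[symmetric])
    ultimately obtain F where F: "finite F" "F \<subseteq> X" "Z \<subseteq> (\<Union>x\<in>F. bowen_ball X T n x e)"
        "(\<Sum>x\<in>F. exp (\<phi> n x)) < exp (real n * s)"
      using e by (rule cap_Lambda_less)
    moreover have "prob Z \<le> prob (\<Union>x\<in>F. bowen_ball X T n x e)"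
      using F by (intro finite_measure_mono UN_bowen_ball_sets)
    ultimately show "\<exists>n\<ge>N. \<exists>F. finite F \<and> F \<subseteq> X \<and>
      1 - \<delta> \<le> prob (\<Union>x\<in>F. bowen_ball X T n x e) \<and> (\<Sum>x\<in>F. exp (\<phi> n x)) \<le> exp (real n * s)"
      using Z(2) n(1) by (intro exI[of _ n] conjI exI[of _ F]) auto
  qed
  then show "\<forall>\<^sub>F e in at_right 0. car_pressure_meas_eps X T \<phi> M e \<le> lower_cap_meas_eps X T \<phi> M e"
    using eventually_at_right_real[of 0 1] by (auto elim: eventually_mono)
qed

text \<open>Spanning sets at different times may cover unrelated sets; the limsup construction of
  \<open>car_pressure_meas_eps_le\<close> assembles them into covers of one set of full
  measure.\<close>

lemma car_pressure_meas_le_span_pressure: "car_pressure_meas X T \<phi> M \<le> span_pressure X T \<phi> M"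
proof -
  have "car_pressure_meas_eps X T \<phi> M e \<le> span_pressure X T \<phi> M" if e: "e > 0" for e
  proof (rule ereal_le_if_below_reals, rule car_pressure_meas_eps_le)
    fix s \<delta> :: real and N assume s: "span_pressure X T \<phi> M < ereal s" and \<delta>: "\<delta> > 0"
    have "span_pressure_eps_delta X T \<phi> M e \<delta> \<le> span_pressure X T \<phi> M"
      unfolding span_pressure_eq using e \<delta> by (intro SUP_upper2[of \<delta>] SUP_upper) auto
    then have "\<forall>\<^sub>F n in sequentially. elog (span_sum X T \<phi> M n e \<delta>) / ereal (real n) < ereal s"
      using s unfolding span_pressure_eps_delta_def by (intro Limsup_lessD) auto
    then obtain n where n: "n \<ge> Suc N" "elog (span_sum X T \<phi> M n e \<delta>) / ereal (real n) < ereal s"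
      unfolding eventually_sequentially by (meson nle_le)
    then have "span_sum X T \<phi> M n e \<delta> < exp (real n * s)" by (intro elog_div_less) auto
    then obtain F where "finite F" "F \<subseteq> X" "1 - \<delta> \<le> prob (\<Union>x\<in>F. bowen_ball X T n x e)"
        "(\<Sum>x\<in>F. exp (\<phi> n x)) < exp (real n * s)"
      using e \<delta> by (rule span_sum_less)
    then show "\<exists>n\<ge>N. \<exists>F. finite F \<and> F \<subseteq> X \<and>
      1 - \<delta> \<le> prob (\<Union>x\<in>F. bowen_ball X T n x e) \<and> (\<Sum>x\<in>F. exp (\<phi> n x)) \<le> exp (real n * s)"
      using n(1) by (intro exI[of _ n] conjI exI[of _ F]) auto
  qed
  then have "\<forall>\<^sub>F e in at_right 0. car_pressure_meas_eps X T \<phi> M e \<le> span_pressure X T \<phi> M"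
    using eventually_at_right_real[of 0 1] by (auto elim: eventually_mono)
  then have "car_pressure_meas X T \<phi> M \<le> Liminf (at_right (0 :: real)) (\<lambda>_. span_pressure X T \<phi> M)"
    unfolding car_pressure_meas_def by (rule Liminf_mono)
  then show ?thesis by (simp add: Liminf_const)
qed

end

section \<open>The upper bound\<close>

lemma (in prob_space) prob_Int_ge:
  assumes "A \<in> events" "B \<in> events" shows "prob A + prob B - 1 \<le> prob (A \<inter> B)"
proof -
  have "prob (space M - A \<inter> B) \<le> prob ((space M - A) \<union> (space M - B))"
    using assms by (intro finite_measure_mono) auto
  also have "\<dots> \<le> prob (space M - A) + prob (space M - B)"
    using assms by (intro measure_Un_le) auto
  finally show ?thesis using assms by (simp add: prob_compl)
qed

context supadditive_system
begin

lemma small_partition: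
  assumes "e > 0"
  obtains P where "finite_meas_partition M P" "\<forall>A\<in>P. \<forall>x\<in>A. \<forall>y\<in>A. dist x y < e"
proof -
  obtain F where F: "finite F" "F \<subseteq> X" "X \<subseteq> (\<Union>x\<in>F. bowen_ball X T 1 x (e / 2))"
    using finite_bowen_cover[of "e / 2" 1] assms by auto
  \<comment> \<open>The atoms of the algebra generated by the covering balls: \<open>A S\<close>
    holds the points that lie in exactly the balls centred in \<open>S\<close>. Each nonempty atom
    lies in a ball of radius \<open>e / 2\<close>.\<close>
  define A where "A S = {y \<in> X. \<forall>x\<in>F. dist x y < e / 2 \<longleftrightarrow> x \<in> S}" for S
  have "A S \<in> sets M" for S
  proof -
    have m: "{y \<in> X. dist x y < e / 2} \<in> sets M" for x
      using open_sets[OF open_ball, of x "e / 2"] by (simp only: ball_def Int_def mem_Collect_eq)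
    have "{y \<in> space M. dist x y < e / 2 \<longleftrightarrow> x \<in> S} \<in> sets M" for x
    proof (cases "x \<in> S")
      case True then show ?thesis using m[of x] by (simp add: space_M)
    next
      case False
      have "{y \<in> space M. dist x y < e / 2 \<longleftrightarrow> x \<in> S} = space M - {y \<in> X. dist x y < e / 2}"
        using False by (auto simp: space_M)
      then show ?thesis using m[of x] by simp
    qed
    then have "{y \<in> space M. \<forall>x\<in>F. dist x y < e / 2 \<longleftrightarrow> x \<in> S} \<in> sets M"
      by (intro sets.sets_Collect_finite_All F(1)) auto
    then show ?thesis by (simp add: A_def space_M)
  qed
  moreover have "X \<subseteq> \<Union>(A ` Pow F)"
  proof
    fix y assume "y \<in> X"
    then have "y \<in> A {x \<in> F. dist x y < e / 2}" by (auto simp: A_def)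
    moreover have "{x \<in> F. dist x y < e / 2} \<in> Pow F" by auto
    ultimately show "y \<in> \<Union>(A ` Pow F)" by (intro UnionI[OF imageI])
  qed
  moreover have "disjoint (A ` Pow F)"
    unfolding disjoint_def
  proof (clarify, rule ccontr)
    fix S S' assume S: "S \<subseteq> F" "S' \<subseteq> F" "A S \<noteq> A S'" "A S \<inter> A S' \<noteq> {}"
    then obtain y where "y \<in> A S" "y \<in> A S'" by blast
    then have "x \<in> S \<longleftrightarrow> x \<in> S'" if "x \<in> F" for x using that unfolding A_def by blast
    then have "S = S'" using S(1,2) by blast
    then show False using S(3) by simp
  qed
  ultimately have part: "finite_meas_partition M (A ` Pow F)"
    using F(1) by (auto simp: finite_meas_partition_def space_M A_def)
  have diam: "dist x y < e" if B: "B \<in> A ` Pow F" "x \<in> B" "y \<in> B" for B x y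
  proof -
    obtain S where S: "x \<in> A S" "y \<in> A S" using B by blast
    then have "x \<in> X" by (simp add: A_def)
    then obtain z where z: "z \<in> F" "dist z x < e / 2" using F(3) by (auto simp: bowen_ball_def)
    then have "dist z y < e / 2" using S unfolding A_def by blast
    then show ?thesis using z(2) by (rule dist_triangle_half_r[rotated])
  qed
  show ?thesis by (rule that[OF part]) (intro ballI diam)
qed

lemma ks_entropy_ge: "finite_meas_partition M P \<Longrightarrow> ereal (part_entropy_rate M T P) \<le> ks_entropy M T"
  unfolding ks_entropy_def by (intro SUP_upper) simp

lemma ks_entropy_nonneg: "0 \<le> ks_entropy M T"
proof -
  have P: "finite_meas_partition M {space M}"
    by (auto simp: finite_meas_partition_def disjoint_def)
  interpret partition_system M T "{space M}" by unfold_locales (rule P)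
  have "0 \<le> ereal (part_entropy_rate M T {space M})"
    using rate_nonneg by (simp add: part_entropy_rate_eq)
  also have "\<dots> \<le> ks_entropy M T" by (rule ks_entropy_ge[OF P])
  finally show ?thesis .
qed

lemma pot_star_ge: "n \<ge> 1 \<Longrightarrow> ereal ((\<integral>x. \<phi> n x \<partial>M) / real n) \<le> pot_star M \<phi>"
  unfolding pot_star_def by (intro SUP_upper) simp

text \<open>Pick one point of the typical set for each name occurring there. Points with equal names
  stay \<open>e\<close>-close because the elements of \<open>P\<close> are small, so these points
  are centres of a cover; \<open>few_names\<close> bounds their number and
  \<open>supadditive_AE_upper\<close> the value of \<open>\<phi> n\<close> at each of them.\<close>

lemma upper_cap_set_eps_le:
  assumes part: "finite_meas_partition M P" and diam: "\<forall>A\<in>P. \<forall>x\<in>A. \<forall>y\<in>A. dist x y < e"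
    and h: "part_entropy_rate M T P < h"
    and p: "\<And>n. n \<ge> 1 \<Longrightarrow> (\<integral>x. \<phi> n x \<partial>M) \<le> real n * p" "p < p'" and "\<delta> > 0"
  shows "\<exists>Z\<in>sets M. 1 - \<delta> \<le> prob Z \<and> upper_cap_set_eps X T \<phi> Z e \<le> ereal (h + p')"
proof -
  interpret partition_system M T P by unfold_locales (rule part)
  have h: "rate < h" using h by (simp add: part_entropy_rate_eq)
  have d: "\<delta> / 2 > 0" using \<open>\<delta> > 0\<close> by simp
  obtain Z1 N1 where Z1: "Z1 \<in> sets M" "prob Z1 > 1 - \<delta> / 2"
    "\<And>n. n \<ge> N1 \<Longrightarrow> real (card (name n ` Z1)) \<le> exp (real n * h)"
    using few_names[OF h d] by metis
  obtain C where C: "\<And>x. x \<in> X \<Longrightarrow> \<bar>\<phi> 1 x\<bar> \<le> C"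
    using continuous_bounded[OF continuous_\<phi>[of 1]] by auto
  have "AE x in M. \<forall>\<^sub>F n in sequentially. \<phi> n x \<le> real n * p'"
  proof (rule supadditive_AE_upper[where C = C, OF _ _ _ p])
    show "- C \<le> \<phi> 1 x" if "x \<in> space M" for x using C[of x] that by (simp add: space_M abs_le_iff)
  qed (use continuous_integrable continuous_\<phi> \<phi>_add space_M in auto)
  \<comment> \<open>\<open>\<phi> 0\<close> is arbitrary, possibly not measurable; the guard takes
    it out of the predicate.\<close>
  then have AE: "AE x in M. \<forall>\<^sub>F n in sequentially. n \<ge> 1 \<longrightarrow> \<phi> n x \<le> real n * p'"
    by eventually_elim (auto elim: eventually_mono)
  have pm: "Measurable.pred M (\<lambda>x. n \<ge> 1 \<longrightarrow> \<phi> n x \<le> real n * p')" for n :: nat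
  proof (cases "n \<ge> 1")
    case True
    then have [measurable]: "\<phi> n \<in> borel_measurable M"
      by (intro continuous_measurable continuous_\<phi>)
    show ?thesis by measurable
  qed simp
  obtain Z2 N2 where Z2: "Z2 \<in> sets M" "prob Z2 > 1 - \<delta> / 2"
    "\<And>n x. n \<ge> N2 \<Longrightarrow> x \<in> Z2 \<Longrightarrow> n \<ge> 1 \<longrightarrow> \<phi> n x \<le> real n * p'"
    using AE_eventually_uniform[OF AE pm d] by blast
  define Z where "Z = Z1 \<inter> Z2"
  have Z: "Z \<in> sets M" using Z1 Z2 by (simp add: Z_def)
  have "prob Z \<ge> 1 - \<delta>"
    using Z1 Z2 prob_Int_ge[of Z1 Z2] by (simp add: Z_def)
  moreover have "upper_cap_set_eps X T \<phi> Z e \<le> ereal (h + p')"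
    unfolding upper_cap_set_eps_def
  proof (rule Limsup_bounded)
    have "elog (cap_Lambda X T \<phi> Z n e) / ereal (real n) \<le> ereal (h + p')"
      if n: "n \<ge> Suc (max N1 N2)" for n
    proof -
      define g where "g w = (SOME x. x \<in> Z \<and> name n x = w)" for w
      have g: "g w \<in> Z" "name n (g w) = w" if "w \<in> name n ` Z" for w
        using someI_ex[of "\<lambda>x. x \<in> Z \<and> name n x = w"] that by (auto simp: g_def)
      have ZX: "Z \<subseteq> X" using Z sets.sets_into_space by (simp add: space_M[symmetric])
      have fin1: "finite (name n ` Z1)"
        using Z1(1) sets.sets_into_space name_in_words
        by (intro finite_subset[OF _ finite_words[of n]]) blast
      have fin: "finite (name n ` Z)" by (rule finite_subset[OF _ fin1]) (auto simp: Z_def)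
      define F where "F = g ` name n ` Z"
      have F: "finite F" "F \<subseteq> Z" using fin g by (auto simp: F_def)
      have "y \<in> bowen_ball X T n (g (name n y)) e" if y: "y \<in> Z" for y
        unfolding bowen_ball_def
      proof (intro CollectI conjI allI impI)
        show "y \<in> X" using y ZX by auto
        fix i assume i: "i < n"
        have gy: "g (name n y) \<in> X" "name n (g (name n y)) = name n y" using g y ZX by auto
        then have "label ((T ^^ i) (g (name n y))) = label ((T ^^ i) y)"
          using nth_name[OF i] by metis
        then show "dist ((T ^^ i) (g (name n y))) ((T ^^ i) y) < e"
          using diam label_in in_label funpow_T_space gy(1) \<open>y \<in> X\<close> by (metis space_M)
      qed
      then have "Z \<subseteq> (\<Union>x\<in>F. bowen_ball X T n x e)" by (auto simp: F_def)
      then have "cap_Lambda X T \<phi> Z n e \<le> (\<Sum>x\<in>F. exp (\<phi> n x))"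
        using F ZX by (intro cap_Lambda_le) auto
      also have "\<dots> \<le> (\<Sum>x\<in>F. exp (real n * p'))"
        using F Z2(3)[of n] n by (intro sum_mono) (auto simp: Z_def)
      also have "\<dots> = real (card F) * exp (real n * p')" by simp
      also have "\<dots> \<le> exp (real n * h) * exp (real n * p')"
      proof (rule mult_right_mono)
        have "card F \<le> card (name n ` Z)" using fin by (simp add: F_def card_image_le)
        also have "\<dots> \<le> card (name n ` Z1)" using fin1 by (intro card_mono) (auto simp: Z_def)
        finally have "real (card F) \<le> real (card (name n ` Z1))" by simp
        also have "\<dots> \<le> exp (real n * h)" using n by (intro Z1(3)) simp
        finally show "real (card F) \<le> exp (real n * h)" .
      qed simp
      also have "\<dots> = exp (real n * (h + p'))" by (simp add: algebra_simps flip: exp_add)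
      finally show ?thesis using n by (intro elog_div_le) auto
    qed
    then show "\<forall>\<^sub>F n in sequentially. elog (cap_Lambda X T \<phi> Z n e) / ereal (real n) \<le> ereal (h + p')"
      unfolding eventually_sequentially by blast
  qed
  ultimately show ?thesis using Z by blast
qed

lemma upper_cap_meas_le: "upper_cap_meas X T \<phi> M \<le> ks_entropy M T + pot_star M \<phi>"
proof (rule ereal_le_if_below_reals)
  fix s :: real assume s: "ks_entropy M T + pot_star M \<phi> < ereal s"
  \<comment> \<open>Neither summand is minus infinity, so a sum below a real number forces both to
    be real.\<close>
  have "pot_star M \<phi> \<noteq> - \<infinity>" using pot_star_ge[of 1] by auto
  moreover have "ks_entropy M T \<noteq> - \<infinity>" using ks_entropy_nonneg by auto
  ultimately obtain h p where hp: "ks_entropy M T = ereal h" "pot_star M \<phi> = ereal p"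
    using s by (cases "ks_entropy M T"; cases "pot_star M \<phi>") auto
  define d where "d = (s - h - p) / 2"
  have d: "d > 0" using s hp by (simp add: d_def)
  show "upper_cap_meas X T \<phi> M \<le> ereal s"
    unfolding upper_cap_meas_eq upper_cap_meas_eps_eq
  proof (intro SUP_least)
    fix e \<delta> :: real assume "e \<in> {0<..}" "\<delta> \<in> {0<..}"
    then have pos: "e > 0" "\<delta> > 0" by auto
    obtain P where P: "finite_meas_partition M P"
      "\<forall>A\<in>P. \<forall>x\<in>A. \<forall>y\<in>A. dist x y < e"
      using small_partition[OF pos(1)] by blast
    have "part_entropy_rate M T P < h + d" using ks_entropy_ge[OF P(1)] d hp by simp
    moreover have "(\<integral>x. \<phi> n x \<partial>M) \<le> real n * p" if "n \<ge> 1" for n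
      using pot_star_ge[OF that] hp that by (simp add: field_simps)
    ultimately obtain Z where Z: "Z \<in> sets M" "1 - \<delta> \<le> prob Z"
      "upper_cap_set_eps X T \<phi> Z e \<le> ereal (h + d + (p + d))"
      using upper_cap_set_eps_le[where h = "h + d" and p = p and p' = "p + d" and \<delta> = \<delta>, OF P] d pos
      by auto
    have "Inf {upper_cap_set_eps X T \<phi> Z e | Z. Z \<in> sets M \<and> 1 - \<delta> \<le> prob Z}
        \<le> upper_cap_set_eps X T \<phi> Z e"
      using Z by (intro Inf_lower) blast
    also have "\<dots> \<le> ereal (h + d + (p + d))" by (rule Z(3))
    also have "h + d + (p + d) = s" by (simp add: d_def field_simps)
    finally show "Inf {upper_cap_set_eps X T \<phi> Z e | Z. Z \<in> sets M \<and> 1 - \<delta> \<le> prob Z} \<le> ereal s" .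
  qed
qed

end

section \<open>Regularity and orbit sums\<close>

lemma compact_separated:
  fixes K L :: "'a::metric_space set"
  assumes "compact K" "compact L" "K \<inter> L = {}"
  obtains d where "d > 0" "\<And>x y. x \<in> K \<Longrightarrow> y \<in> L \<Longrightarrow> d \<le> dist x y"
proof (cases "K = {} \<or> L = {}")
  case True
  then show ?thesis using that[of 1] by auto
next
  case False
  have "continuous_on K (\<lambda>x. infdist x L)" by (intro continuous_intros)
  then obtain z where z: "z \<in> K" "\<And>x. x \<in> K \<Longrightarrow> infdist z L \<le> infdist x L"
    using continuous_attains_inf[OF assms(1)] False by blast
  have "infdist z L > 0"
    using z(1) assms False in_closed_iff_infdist_zero[OF compact_imp_closed[OF assms(2)], of z]
      infdist_nonneg[of z L] by force
  moreover have "infdist z L \<le> dist x y" if "x \<in> K" "y \<in> L" for x y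
    using z(2)[OF that(1)] infdist_le[OF that(2)] by (rule order_trans)
  ultimately show ?thesis using that by blast
qed

text \<open>Chernoff-type count of the words that differ from the template \<open>c\<close> in at
  most \<open>b\<close> places. With weight \<open>exp (- K)\<close> per mismatch, all words of
  length \<open>n\<close> weigh at most \<open>(1 + card P * exp (- K)) ^ n\<close>, while a word of
  the ball weighs at least \<open>exp (- K * b)\<close>. The induction on the last letter carries
  this out, also for templates with values outside \<open>P\<close>.\<close>

lemma card_hamming_ball_le:
  fixes c :: "nat \<Rightarrow> 'b"
  assumes P: "finite P" and K: "1 + real (card P) * exp (- K) \<le> exp k" "K \<ge> 0"
  shows "finite {w. set w \<subseteq> P \<and> length w = n \<and> card {i. i < n \<and> w ! i \<noteq> c i} \<le> b}"
    and "real (card {w. set w \<subseteq> P \<and> length w = n \<and> card {i. i < n \<and> w ! i \<noteq> c i} \<le> b})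
      \<le> exp (k * real n + K * real b)"
proof -
  define H where "H n b = {w. set w \<subseteq> P \<and> length w = n \<and> card {i. i < n \<and> w ! i \<noteq> c i} \<le> b}" for n b
  have fin: "finite (H n b)" for n b
  proof (rule finite_subset)
    show "H n b \<subseteq> {w. set w \<subseteq> P \<and> length w = n}" by (auto simp: H_def)
  qed (rule finite_lists_length_eq[OF P])
  have "real (card (H n b)) \<le> exp (k * real n + K * real b)" for b
  proof (induction n arbitrary: b)
    case 0
    have "H 0 b \<subseteq> {[]}" by (auto simp: H_def)
    then have "card (H 0 b) \<le> 1" using card_mono[of "{[] :: 'b list}" "H 0 b"] by simp
    moreover have "1 \<le> exp (k * real 0 + K * real b)" using K by simp
    ultimately show ?case by linarith
  next
    case (Suc n)
    let ?E = "exp (k * real n + K * real b)"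
    let ?V = "if b = 0 then {} else (\<lambda>(v, p). v @ [p]) ` (H n (b - 1) \<times> P)"
    have "H (Suc n) b \<subseteq> (\<lambda>v. v @ [c n]) ` H n b \<union> ?V"
    proof
      fix w assume w: "w \<in> H (Suc n) b"
      then obtain v p where vp: "w = v @ [p]" "length v = n" "set v \<subseteq> P" "p \<in> P"
        by (cases w rule: rev_cases) (auto simp: H_def)
      have eq: "{i. i < Suc n \<and> w ! i \<noteq> c i}
          = {i. i < n \<and> v ! i \<noteq> c i} \<union> (if p = c n then {} else {n})"
        using vp by (auto simp: nth_append less_Suc_eq)
      have card: "card {i. i < Suc n \<and> w ! i \<noteq> c i}
          = card {i. i < n \<and> v ! i \<noteq> c i} + (if p = c n then 0 else 1)"
        unfolding eq by (subst card_Un_disjoint) auto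
      show "w \<in> (\<lambda>v. v @ [c n]) ` H n b \<union> ?V"
      proof (cases "p = c n")
        case True
        then show ?thesis using vp w card by (auto simp: H_def)
      next
        case False
        then have "b \<noteq> 0" "v \<in> H n (b - 1)" using vp w card by (auto simp: H_def)
        then show ?thesis using vp by auto
      qed
    qed
    then have "card (H (Suc n) b) \<le> card ((\<lambda>v. v @ [c n]) ` H n b) + card ?V"
      using fin P by (intro order_trans[OF card_mono card_Un_le]) auto
    also have "\<dots> \<le> card (H n b) + card ?V" by (intro add_mono card_image_le fin order_refl)
    finally have "real (card (H (Suc n) b)) \<le> real (card (H n b)) + real (card ?V)" by linarith
    also have "real (card ?V) \<le> ?E * (real (card P) * exp (- K))"
    proof (cases b)
      case (Suc b')
      have "card ?V \<le> card (H n b') * card P"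
        using Suc fin P by simp (metis card_cartesian_product card_image_le finite_SigmaI)
      then have "real (card ?V) \<le> real (card (H n b')) * real (card P)"
        by (metis of_nat_le_iff of_nat_mult)
      also have "\<dots> \<le> exp (k * real n + K * real b') * real (card P)"
        by (intro mult_right_mono Suc.IH) simp
      also have "\<dots> = ?E * (real (card P) * exp (- K))"
        using Suc by (simp add: algebra_simps flip: exp_add)
      finally show ?thesis .
    qed simp
    also have "real (card (H n b)) + ?E * (real (card P) * exp (- K)) \<le> ?E + ?E * (real (card P) * exp (- K))"
      by (intro add_right_mono Suc.IH)
    also have "\<dots> = ?E * (1 + real (card P) * exp (- K))" by (simp add: algebra_simps)
    also have "\<dots> \<le> ?E * exp k" by (intro mult_left_mono K) simp
    also have "\<dots> = exp (k * real (Suc n) + K * real b)" by (simp add: algebra_simps flip: exp_add)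
    finally show ?case by simp
  qed
  then show "real (card {w. set w \<subseteq> P \<and> length w = n \<and> card {i. i < n \<and> w ! i \<noteq> c i} \<le> b})
      \<le> exp (k * real n + K * real b)"
    and "finite {w. set w \<subseteq> P \<and> length w = n \<and> card {i. i < n \<and> w ! i \<noteq> c i} \<le> b}"
    using fin by (auto simp: H_def)
qed

context ergodic_system
begin

lemma funpow_T_integral:
  fixes f :: "'a \<Rightarrow> real"
  assumes [measurable]: "integrable M f"
  shows "integrable M (\<lambda>x. f ((T ^^ n) x))" and "(\<integral>x. f ((T ^^ n) x) \<partial>M) = (\<integral>x. f x \<partial>M)"
proof -
  have d: "distr M M (T ^^ n) = M"
    by (rule measure_eqI)
      (auto simp: emeasure_distr emeasure_eq_measure prob_vimage_funpow_T)
  show "integrable M (\<lambda>x. f ((T ^^ n) x))"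
    using integrable_distr[of "T ^^ n" M M f] assms by (simp add: d)
  show "(\<integral>x. f ((T ^^ n) x) \<partial>M) = (\<integral>x. f x \<partial>M)"
    using integral_distr[of "T ^^ n" M M f] by (simp add: d)
qed

text \<open>Negated Birkhoff sums are additive, so the upper estimate for supadditive sequences
  applies to them; the upper bound \<open>C\<close> of \<open>g\<close> becomes their one-step lower
  bound.\<close>

lemma birkhoff_AE_lower:
  fixes g :: "'a \<Rightarrow> real"
  assumes g: "integrable M g" "\<And>x. x \<in> space M \<Longrightarrow> g x \<le> C" and r: "r < (\<integral>x. g x \<partial>M)"
  shows "AE x in M. \<forall>\<^sub>F n in sequentially. real n * r \<le> (\<Sum>i<n. g ((T ^^ i) x))"
proof -
  have sum_add: "(\<Sum>i<m + n. g ((T ^^ i) x)) = (\<Sum>i<m. g ((T ^^ i) x)) + (\<Sum>i<n. g ((T ^^ i) ((T ^^ m) x)))"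
    for m n x
    by (induction n) (simp_all add: funpow_T_add)
  have "AE x in M. \<forall>\<^sub>F n in sequentially. - (\<Sum>i<n. g ((T ^^ i) x)) \<le> real n * - r"
  proof (rule supadditive_AE_upper)
    show "integrable M (\<lambda>x. - (\<Sum>i<n. g ((T ^^ i) x)))" for n
      using funpow_T_integral(1)[OF g(1)] by auto
    show "(\<integral>x. - (\<Sum>i<n. g ((T ^^ i) x)) \<partial>M) \<le> real n * - (\<integral>x. g x \<partial>M)" for n
      using funpow_T_integral[OF g(1)] by simp
    show "- (\<Sum>i<m. g ((T ^^ i) x)) + - (\<Sum>i<n. g ((T ^^ i) ((T ^^ m) x))) \<le> - (\<Sum>i<m + n. g ((T ^^ i) x))"
      for m n x by (simp add: sum_add)
  qed (use g r in auto)
  then show ?thesis by eventually_elim (auto elim: eventually_mono)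
qed

end

text \<open>The names occurring in \<open>V\<close> lie in a Hamming ball around the template
  \<open>c\<close>, so few cylinders cover \<open>V\<close>, each of measure at most
  \<open>t\<close>.\<close>

lemma (in partition_system) prob_le_hamming:
  assumes V: "V \<in> sets M" and K: "1 + real (card P) * exp (- K) \<le> exp k" "K \<ge> 0" and "t \<ge> 0"
    and cyl: "\<And>x. x \<in> V \<Longrightarrow> prob (cyl (name n x)) \<le> t"
    and c: "\<And>x. x \<in> V \<Longrightarrow> card {i. i < n \<and> label ((T ^^ i) x) \<noteq> c i} \<le> b"
  shows "prob V \<le> exp (k * real n + K * real b) * t"
proof -
  let ?H = "{w. set w \<subseteq> P \<and> length w = n \<and> card {i. i < n \<and> w ! i \<noteq> c i} \<le> b}"
  have "name n ` V \<subseteq> ?H"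
  proof (intro image_subsetI CollectI conjI)
    fix x assume x: "x \<in> V"
    then have "x \<in> space M" using V sets.sets_into_space by blast
    then show "set (name n x) \<subseteq> P" by (rule set_name)
    have "{i. i < n \<and> name n x ! i \<noteq> c i} = {i. i < n \<and> label ((T ^^ i) x) \<noteq> c i}"
      by (intro Collect_cong conj_cong refl) (simp add: nth_name)
    then show "card {i. i < n \<and> name n x ! i \<noteq> c i} \<le> b" using c[OF x] by simp
  qed simp
  then have "card (name n ` V) \<le> card ?H"
    by (intro card_mono card_hamming_ball_le(1)[OF finite_P K])
  then have card: "real (card (name n ` V)) \<le> exp (k * real n + K * real b)"
    using card_hamming_ball_le(2)[OF finite_P K, of n c b] by linarith
  have "prob V \<le> (\<Sum>w\<in>name n ` V. prob (cyl w))" by (rule prob_le_sum_cyl[OF V])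
  also have "\<dots> \<le> real (card (name n ` V)) * t" by (rule sum_bounded_above) (use cyl in auto)
  also have "\<dots> \<le> exp (k * real n + K * real b) * t" using card \<open>t \<ge> 0\<close> by (rule mult_right_mono)
  finally show ?thesis .
qed

context supadditive_system
begin

text \<open>The sets squeezed between closed and open sets with small difference form a
  sigma-algebra containing the open sets. Intersecting with \<open>X\<close> only when measuring
  allows the induction to run over Borel sets of the whole type.\<close>

lemma regular:
  assumes "B \<in> sets borel"
  shows "\<forall>d>0. \<exists>K U. closed K \<and> open U \<and> K \<subseteq> B \<and> B \<subseteq> U \<and> prob (X \<inter> (U - K)) < d"
proof -
  have sets: "X \<inter> (U - K) \<in> sets M" if "open U" "closed K" for U K
    using that open_sets[of "U - K"] by (simp add: open_Diff)
  have "B \<in> sigma_sets UNIV {S. open S}" using assms by (simp add: borel_def)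
  then show ?thesis
  proof (induction rule: sigma_sets.induct)
    case (Basic U)
    then have U: "open U" by simp
    show ?case
    proof (intro allI impI)
      fix d :: real assume d: "d > 0"
      \<comment> \<open>Closed inner approximations by the points at distance at least
        \<open>1 / (n + 1)\<close> from the complement. \<open>U = UNIV\<close> is treated apart
        because \<open>infdist\<close> to the empty set is \<open>0\<close> by convention.\<close>
      define K where "K n = {x. inverse (real (Suc n)) \<le> infdist x (- U)}" for n
      have closed_K: "closed (K n)" for n
        unfolding K_def by (intro closed_Collect_le continuous_intros)
      show "\<exists>K V. closed K \<and> open V \<and> K \<subseteq> U \<and> U \<subseteq> V \<and> prob (X \<inter> (V - K)) < d"
      proof (cases "U = UNIV")
        case True
        then show ?thesis using d by (intro exI[of _ UNIV]) simp
      next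
        case False
        have K_U: "K n \<subseteq> U" for n
        proof
          fix x assume x: "x \<in> K n"
          show "x \<in> U"
          proof (rule ccontr)
            assume "x \<notin> U"
            then have "infdist x (- U) = 0" by simp
            then show False using x by (simp add: K_def)
          qed
        qed
        have "(\<Inter>n. X \<inter> (U - K n)) = {}"
        proof (rule equals0I)
          fix x assume x: "x \<in> (\<Inter>n. X \<inter> (U - K n))"
          then have "0 < infdist x (- U)"
            using U False in_closed_iff_infdist_zero[of "- U" x] infdist_nonneg[of x "- U"] by force
          then obtain n where "inverse (real (Suc n)) < infdist x (- U)"
            using reals_Archimedean by blast
          then have "x \<in> K n" by (simp add: K_def)
          then show False using x by auto
        qed
        moreover have "(\<lambda>n. prob (X \<inter> (U - K n))) \<longlonglongrightarrow> prob (\<Inter>n. X \<inter> (U - K n))"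
        proof (rule finite_Lim_measure_decseq)
          show "range (\<lambda>n. X \<inter> (U - K n)) \<subseteq> sets M" using sets[OF U closed_K] by auto
          have "X \<inter> (U - K n) \<subseteq> X \<inter> (U - K m)" if "m \<le> n" for m n
          proof -
            have "inverse (real (Suc n)) \<le> inverse (real (Suc m))" using that by simp
            then have "x \<in> K n" if "x \<in> K m" for x
              using that unfolding K_def mem_Collect_eq by linarith
            then show ?thesis by blast
          qed
          then show "decseq (\<lambda>n. X \<inter> (U - K n))" by (simp add: decseq_def)
        qed
        ultimately have "(\<lambda>n. prob (X \<inter> (U - K n))) \<longlonglongrightarrow> 0" by (simp only: measure_empty)
        then have "\<forall>\<^sub>F n in sequentially. prob (X \<inter> (U - K n)) < d" using d by (rule order_tendstoD)
        then obtain n where "prob (X \<inter> (U - K n)) < d"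
          using eventually_happens trivial_limit_sequentially by blast
        then show ?thesis using K_U closed_K U by blast
      qed
    qed
  next
    case Empty
    show ?case by (intro allI impI exI[of _ "{}"]) simp
  next
    case (Compl B)
    show ?case
    proof (intro allI impI)
      fix d :: real assume "d > 0"
      then obtain K U where KU: "closed K" "open U" "K \<subseteq> B" "B \<subseteq> U" "prob (X \<inter> (U - K)) < d"
        using Compl.IH by meson
      moreover have "X \<inter> (- K - - U) = X \<inter> (U - K)" by auto
      ultimately show "\<exists>K U. closed K \<and> open U \<and> K \<subseteq> UNIV - B \<and> UNIV - B \<subseteq> U \<and> prob (X \<inter> (U - K)) < d"
        by (intro exI[of _ "- U"] exI[of _ "- K"]) auto
    qed
  next
    case (Union B)
    show ?case
    proof (intro allI impI)
      fix d :: real assume d: "d > 0"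
      have "\<exists>K U. closed K \<and> open U \<and> K \<subseteq> B i \<and> B i \<subseteq> U \<and> prob (X \<inter> (U - K)) < d / 2 * (1 / 2) ^ Suc i" for i
        by (rule Union.IH[rule_format]) (use d in simp)
      then obtain K U where KU: "\<And>i. closed (K i)" "\<And>i. open (U i)" "\<And>i. K i \<subseteq> B i" "\<And>i. B i \<subseteq> U i"
        "\<And>i. prob (X \<inter> (U i - K i)) < d / 2 * (1 / 2) ^ Suc i" by metis
      have op: "open (\<Union>i. U i)" using KU by auto
      have cl: "closed (\<Union>i<n. K i)" for n using KU by auto
      \<comment> \<open>An infinite union of closed sets may fail to be closed, so only finitely
        many \<open>K i\<close> are kept. The errors sum to at most \<open>d / 2\<close>, and
        continuity from above brings \<open>?D n\<close> below \<open>d\<close> for some finite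
        \<open>n\<close>.\<close>
      let ?D = "\<lambda>n. X \<inter> ((\<Union>i. U i) - (\<Union>i<n. K i))"
      have "(\<lambda>n. prob (?D n)) \<longlonglongrightarrow> prob (\<Inter>n. ?D n)"
      proof (rule finite_Lim_measure_decseq)
        show "range ?D \<subseteq> sets M" using sets[OF op cl] by auto
        have "(\<Union>i<m. K i) \<subseteq> (\<Union>i<n. K i)" if "m \<le> n" for m n using that by (intro UN_mono) auto
        then have "?D n \<subseteq> ?D m" if "m \<le> n" for m n using that by (meson Diff_mono Int_mono order_refl)
        then show "decseq ?D" by (simp add: decseq_def)
      qed
      moreover have "prob (\<Inter>n. ?D n) < d"
      proof -
        have sm: "X \<inter> (U i - K i) \<in> sets M" for i using sets KU by blast
        have sums: "(\<lambda>i. d / 2 * (1 / 2) ^ Suc i) sums (d / 2 * 1)"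
          by (rule sums_mult[OF power_half_series])
        note s = sums_summable[OF sums]
        have s': "summable (\<lambda>i. prob (X \<inter> (U i - K i)))"
          by (rule summable_comparison_test'[OF s, of 0]) (use KU(5) in \<open>auto intro: less_imp_le\<close>)
        have "(\<Inter>n. ?D n) \<subseteq> (\<Union>i. X \<inter> (U i - K i))"
        proof
          fix x assume x: "x \<in> (\<Inter>n. ?D n)"
          then obtain i where i: "x \<in> X" "x \<in> U i" by auto
          moreover have "x \<in> ?D (Suc i)" using x by (rule INT_E) auto
          then have "x \<notin> K i" by auto
          ultimately show "x \<in> (\<Union>i. X \<inter> (U i - K i))" by auto
        qed
        then have "prob (\<Inter>n. ?D n) \<le> prob (\<Union>i. X \<inter> (U i - K i))"
        proof (rule finite_measure_mono)
          show "(\<Union>i. X \<inter> (U i - K i)) \<in> sets M" by (rule sets.countable_UN) (use sm in blast)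
        qed
        also have "\<dots> \<le> (\<Sum>i. prob (X \<inter> (U i - K i)))"
          by (rule finite_measure_subadditive_countably[OF _ s']) (use sm in blast)
        also have "\<dots> \<le> (\<Sum>i. d / 2 * (1 / 2) ^ Suc i)"
          using KU(5) by (intro suminf_le s s') (auto intro: less_imp_le)
        also have "\<dots> = d / 2" using sums_unique[OF sums] by simp
        also have "\<dots> < d" using d by simp
        finally show ?thesis .
      qed
      ultimately have "\<forall>\<^sub>F n in sequentially. prob (?D n) < d" by (rule order_tendstoD)
      then obtain n where "prob (?D n) < d"
        using eventually_happens trivial_limit_sequentially by blast
      moreover have "(\<Union>i<n. K i) \<subseteq> (\<Union>i. B i)" using KU(3) by (intro UN_mono) auto
      moreover have "(\<Union>i. B i) \<subseteq> (\<Union>i. U i)" using KU(4) by (intro UN_mono) auto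
      ultimately show "\<exists>K U. closed K \<and> open U \<and> K \<subseteq> (\<Union>i. B i) \<and> (\<Union>i. B i) \<subseteq> U \<and> prob (X \<inter> (U - K)) < d"
        using op cl by (intro exI[of _ "\<Union>i<n. K i"] exI[of _ "\<Union>i. U i"] conjI)
    qed
  qed
qed

lemma inner_regular_compact:
  assumes "A \<in> sets M" "d > 0"
  obtains K where "compact K" "K \<in> sets M" "K \<subseteq> A" "prob (A - K) < d"
proof -
  obtain B where B: "B \<in> sets borel" "A = X \<inter> B"
    using assms by (auto simp: sets_M sets_restrict_space)
  obtain K U where KU: "closed K" "open U" "K \<subseteq> B" "B \<subseteq> U" "prob (X \<inter> (U - K)) < d"
    using regular[OF B(1)] assms(2) by meson
  have "X \<inter> (U - K) \<in> sets M" using open_sets[of "U - K"] KU by (simp add: open_Diff)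
  then have "prob (A - X \<inter> K) \<le> prob (X \<inter> (U - K))"
    using B KU by (intro finite_measure_mono) auto
  then show ?thesis
    using that[of "X \<inter> K"] KU B compact_X closed_sets[of K] by (auto simp: compact_Int_closed)
qed

section \<open>Lower bounds for the potential by orbit sums\<close>

lemma \<phi>_linear_lower:
  obtains C where "C \<ge> 0" "\<And>n x. n \<ge> 1 \<Longrightarrow> x \<in> X \<Longrightarrow> - C * real n \<le> \<phi> n x"
proof -
  obtain C where C: "C \<ge> 0" "\<And>x. x \<in> X \<Longrightarrow> \<bar>\<phi> 1 x\<bar> \<le> C"
    using continuous_bounded[OF continuous_\<phi>[of 1]] by auto
  have "- C * real n \<le> \<phi> n x" if "n \<ge> 1" "x \<in> X" for n x
    using that
  proof (induction n arbitrary: x rule: dec_induct)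
    case base
    then show ?case using C(2)[of x] by simp
  next
    case (step n)
    have "- C * real (Suc n) = - C + - C * real n" by (simp add: algebra_simps)
    also have "\<dots> \<le> \<phi> 1 x + \<phi> n (T x)"
      using step C(2)[of x] funpow_X[of x 1] by (intro add_mono) auto
    also have "\<dots> \<le> \<phi> (Suc n) x" using \<phi>_add[of x 1 n] step by simp
    finally show ?case .
  qed
  then show ?thesis using that C(1) by blast
qed

text \<open>\<open>k * \<phi> n\<close> dominates up to a constant the sum \<open>u n\<close> of the \<open>k\<close> shifted values
  \<open>\<phi> (n - j) \<circ> T ^^ j\<close>, and \<open>u\<close> gains at least \<open>\<phi> k\<close> in each step of the orbit.\<close>
lemma \<phi>_ge_birkhoff_sum:
  assumes k: "k \<ge> 1"
  obtains C where "\<And>n x. n \<ge> 1 \<Longrightarrow> x \<in> X \<Longrightarrow> (\<Sum>i<n. \<phi> k ((T ^^ i) x)) - C \<le> real k * \<phi> n x"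
proof -
  obtain C where C: "C \<ge> 0" "\<And>n x. n \<ge> 1 \<Longrightarrow> x \<in> X \<Longrightarrow> - C * real n \<le> \<phi> n x"
    using \<phi>_linear_lower by blast
  obtain B where B: "B \<ge> 0" "\<And>x. x \<in> X \<Longrightarrow> \<bar>\<phi> k x\<bar> \<le> B"
    using continuous_bounded[OF continuous_\<phi>[OF k]] by blast
  have sum_B: "(\<Sum>i\<in>I. \<phi> k ((T ^^ i) x)) \<le> real (card I) * B" if "x \<in> X" for I x
    using B(2)[OF funpow_X[OF that]] by (intro sum_bounded_above) (simp add: abs_le_iff)
  define u where "u n x = (\<Sum>j<k. \<phi> (n - j) ((T ^^ j) x))" for n x
  \<comment> \<open>Passing from \<open>(n, x)\<close> to \<open>(n - 1, T x)\<close> shifts the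
    summation index by one, so the difference telescopes to its two end terms, which supadditivity
    compares.\<close>
  have step: "\<phi> k x + u (n - 1) (T x) \<le> u n x" if "n > k" "x \<in> X" for n x
  proof -
    have "u (n - 1) (T x) - u n x
        = (\<Sum>j<k. \<phi> (n - Suc j) ((T ^^ Suc j) x) - \<phi> (n - j) ((T ^^ j) x))"
      by (simp add: u_def sum_subtractf funpow_Suc_right del: funpow.simps)
    also have "\<dots> = \<phi> (n - k) ((T ^^ k) x) - \<phi> n x"
      by (subst sum_lessThan_telescope) simp
    finally have "u (n - 1) (T x) - u n x = \<phi> (n - k) ((T ^^ k) x) - \<phi> n x" .
    moreover have "\<phi> k x + \<phi> (n - k) ((T ^^ k) x) \<le> \<phi> n x"
      using \<phi>_add[of x k "n - k"] that k by simp
    ultimately show ?thesis by linarith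
  qed
  \<comment> \<open>The recursion stops at \<open>n = k\<close>, where all indices
    \<open>k - j\<close> are still at least \<open>1\<close>; \<open>\<phi> 0\<close> is
    unconstrained.\<close>
  have u_lower: "- C * real k * real k \<le> u k x" if "x \<in> X" for x
  proof -
    have "- C * real k \<le> \<phi> (k - j) ((T ^^ j) x)" if j: "j \<in> {..<k}" for j
    proof -
      have "- C * real k \<le> - C * real (k - j)" using C(1) by (simp add: mult_left_mono)
      also have "\<dots> \<le> \<phi> (k - j) ((T ^^ j) x)" using j \<open>x \<in> X\<close> funpow_X by (intro C(2)) auto
      finally show ?thesis .
    qed
    then have "(\<Sum>j<k. - C * real k) \<le> u k x" unfolding u_def by (rule sum_mono)
    then show ?thesis by (simp add: algebra_simps)
  qed
  have main: "(\<Sum>i<m. \<phi> k ((T ^^ i) x)) - C * real k * real k \<le> u (k + m) x" if "x \<in> X" for m x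
    using that
  proof (induction m arbitrary: x)
    case 0
    then show ?case using u_lower by simp
  next
    case (Suc m)
    have "(\<Sum>i<Suc m. \<phi> k ((T ^^ i) x)) = \<phi> k x + (\<Sum>i<m. \<phi> k ((T ^^ i) (T x)))"
      by (subst sum.lessThan_Suc_shift) (simp add: funpow_Suc_right del: funpow.simps)
    then have "(\<Sum>i<Suc m. \<phi> k ((T ^^ i) x)) - C * real k * real k \<le> \<phi> k x + u (k + m) (T x)"
      using Suc.IH[of "T x"] Suc.prems funpow_X[of x 1] by simp
    also have "\<dots> \<le> u (k + Suc m) x" using step[of "k + Suc m" x] Suc.prems by simp
    finally show ?case .
  qed
  have "(\<Sum>i<n. \<phi> k ((T ^^ i) x)) - (real k * B + 2 * (C * real k * real k)) \<le> real k * \<phi> n x"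
    if n: "n \<ge> 1" and x: "x \<in> X" for n x
  proof (cases "n < k")
    case True
    have "(\<Sum>i<n. \<phi> k ((T ^^ i) x)) \<le> real n * B" using sum_B[OF x, of "{..<n}"] by simp
    also have "\<dots> \<le> real k * B" using True B by (intro mult_right_mono) auto
    moreover have "real k * (- C * real n) \<le> real k * \<phi> n x" using C(2)[OF n x] by (intro mult_left_mono) auto
    moreover have "C * real k * real n \<le> C * real k * real k" using True C(1) by (intro mult_left_mono) auto
    moreover have "0 \<le> C * real k * real k" using C(1) by simp
    ultimately show ?thesis by (simp add: mult_ac)
  next
    case False
    \<comment> \<open>Supadditivity splits off the first \<open>j\<close> steps, and
      \<open>\<phi> j\<close> is at least \<open>- C * real j\<close>.\<close>
    have "\<phi> (n - j) ((T ^^ j) x) \<le> \<phi> n x + C * real k" if j: "j < k" for j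
    proof (cases "j = 0")
      case True
      then show ?thesis using C(1) by simp
    next
      case j0: False
      have "C * real j \<le> C * real k" using j C(1) by (intro mult_left_mono) auto
      then show ?thesis
        using \<phi>_add[of x j "n - j"] C(2)[of j x] x j j0 False
        by (simp add: Suc_le_eq)
    qed
    then have "u n x \<le> (\<Sum>j<k. \<phi> n x + C * real k)" unfolding u_def by (intro sum_mono) auto
    then have "u n x \<le> real k * \<phi> n x + C * real k * real k" by (simp add: algebra_simps)
    moreover have "(\<Sum>i<n - k. \<phi> k ((T ^^ i) x)) - C * real k * real k \<le> u n x"
      using main[OF x, of "n - k"] False by simp
    moreover have "(\<Sum>i<n. \<phi> k ((T ^^ i) x))
        = (\<Sum>i<n - k. \<phi> k ((T ^^ i) x)) + (\<Sum>i=n - k..<n. \<phi> k ((T ^^ i) x))"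
      using sum.atLeastLessThan_concat[of 0 "n - k" n "\<lambda>i. \<phi> k ((T ^^ i) x)"]
      by (simp add: lessThan_atLeast0)
    moreover have "(\<Sum>i=n - k..<n. \<phi> k ((T ^^ i) x)) \<le> real k * B"
      using sum_B[OF x, of "{n - k..<n}"] False by simp
    ultimately show ?thesis by linarith
  qed
  then show ?thesis by (rule that[of "real k * B + 2 * (C * real k * real k)"])
qed

end

section \<open>The lower bound\<close>

context supadditive_system
begin

text \<open>Fewer covers are admissible as \<open>N\<close> grows, so the infima increase and the
  \<open>lim\<close> is their supremum.\<close>

lemma car_M_le_car_m: "car_M X T \<phi> Z s N e \<le> car_m X T \<phi> Z s e"
proof -
  have "incseq (\<lambda>N. car_M X T \<phi> Z s N e)"
    unfolding car_M_def
  proof (intro incseq_SucI Inf_superset_mono)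
    fix N
    show "{\<Sum>\<^sub>\<infinity>p\<in>C. ennreal (exp (- s * real (snd p) + \<phi> (snd p) (fst p))) | C.
        countable C \<and> C \<subseteq> X \<times> {Suc N..} \<and> Z \<subseteq> (\<Union>p\<in>C. bowen_ball X T (snd p) (fst p) e)}
      \<subseteq> {\<Sum>\<^sub>\<infinity>p\<in>C. ennreal (exp (- s * real (snd p) + \<phi> (snd p) (fst p))) | C.
        countable C \<and> C \<subseteq> X \<times> {N..} \<and> Z \<subseteq> (\<Union>p\<in>C. bowen_ball X T (snd p) (fst p) e)}"
    proof clarify
      fix C assume C: "countable C" "C \<subseteq> X \<times> {Suc N..}" "Z \<subseteq> (\<Union>p\<in>C. bowen_ball X T (snd p) (fst p) e)"
      have "X \<times> {Suc N..} \<subseteq> X \<times> {N..}" by auto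
      then have "C \<subseteq> X \<times> {N..}" using C(2) by (rule subset_trans[rotated])
      then show "\<exists>D. (\<Sum>\<^sub>\<infinity>p\<in>C. ennreal (exp (- s * real (snd p) + \<phi> (snd p) (fst p))))
          = (\<Sum>\<^sub>\<infinity>p\<in>D. ennreal (exp (- s * real (snd p) + \<phi> (snd p) (fst p)))) \<and>
          countable D \<and> D \<subseteq> X \<times> {N..} \<and> Z \<subseteq> (\<Union>p\<in>D. bowen_ball X T (snd p) (fst p) e)"
        using C by (intro exI[of _ C] conjI refl)
    qed
  qed
  then have "(\<lambda>N. car_M X T \<phi> Z s N e) \<longlonglongrightarrow> (SUP N. car_M X T \<phi> Z s N e)" by (rule LIMSEQ_SUP)
  then have "car_m X T \<phi> Z s e = (SUP N. car_M X T \<phi> Z s N e)" unfolding car_m_def by (rule limI)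
  then show ?thesis by (simp only:) (rule SUP_upper, simp)
qed

text \<open>Mass distribution principle: a cover of the full-measure set \<open>Z\<close> covers
  almost all of \<open>G\<close>, so the measures of its balls within \<open>G\<close> add up to at
  least \<open>prob G\<close>, and each is dominated by its Caratheodory term.\<close>

lemma car_M_ge:
  assumes G: "G \<in> sets M" and Z: "Z \<in> sets M" "prob Z = 1"
    and le: "\<And>n x. n \<ge> N \<Longrightarrow> x \<in> X \<Longrightarrow> prob (bowen_ball X T n x e \<inter> G) \<le> exp (- s * real n + \<phi> n x)"
  shows "ennreal (prob G) \<le> car_M X T \<phi> Z s N e"
  unfolding car_M_def
proof (rule Inf_greatest)
  fix v assume "v \<in> {\<Sum>\<^sub>\<infinity>p\<in>C. ennreal (exp (- s * real (snd p) + \<phi> (snd p) (fst p))) | C.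
      countable C \<and> C \<subseteq> X \<times> {N..} \<and> Z \<subseteq> (\<Union>p\<in>C. bowen_ball X T (snd p) (fst p) e)}"
  then obtain C where v: "v = (\<Sum>\<^sub>\<infinity>p\<in>C. ennreal (exp (- s * real (snd p) + \<phi> (snd p) (fst p))))"
    and C: "countable C" "C \<subseteq> X \<times> {N..}" "Z \<subseteq> (\<Union>p\<in>C. bowen_ball X T (snd p) (fst p) e)" by auto
  define g where "g p = exp (- s * real (snd p) + \<phi> (snd p) (fst p))" for p :: "'a \<times> nat"
  define B where "B p = bowen_ball X T (snd p) (fst p) e \<inter> G" for p
  have B: "B p \<in> sets M" "prob (B p) \<le> g p" if "p \<in> C" for p
    using that C(2) le[of "snd p" "fst p"] bowen_ball_sets G by (auto simp: B_def g_def)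
  have "C \<noteq> {}" using C(3) Z(2) by auto
  \<comment> \<open>The cover is nonempty because \<open>Z\<close> has measure one; a finite cover
    is enumerated with repetitions, which the images under \<open>h\<close> do not see.\<close>
  define h where "h = from_nat_into C"
  have h: "range h = C" unfolding h_def using \<open>C \<noteq> {}\<close> C(1) by (rule range_from_nat_into)
  define D where "D n = (\<Union>p\<in>h ` {..<n}. B p)" for n
  have hC: "h ` {..<n} \<subseteq> C" for n using h by auto
  have D: "D n \<in> sets M" for n
    unfolding D_def by (intro sets.finite_UN) (use B(1) hC in blast)+
  have "incseq D" unfolding D_def incseq_def by force
  then have lim: "(\<lambda>n. prob (D n)) \<longlonglongrightarrow> prob (\<Union>n. D n)"
    using D by (intro finite_Lim_measure_incseq) auto
  have bound: "ennreal (prob (D n)) \<le> v" for n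
  proof -
    have "prob (D n) \<le> (\<Sum>p\<in>h ` {..<n}. prob (B p))"
      unfolding D_def by (intro finite_measure_subadditive_finite) (use B(1) hC in blast)+
    also have "\<dots> \<le> (\<Sum>p\<in>h ` {..<n}. g p)" by (intro sum_mono B(2)) (use hC in blast)
    finally have "ennreal (prob (D n)) \<le> ennreal (\<Sum>p\<in>h ` {..<n}. g p)" by (rule ennreal_leI)
    also have "\<dots> = (\<Sum>p\<in>h ` {..<n}. ennreal (g p))" by (rule sum_ennreal[symmetric]) (simp add: g_def)
    also have "\<dots> \<le> (SUP F\<in>{F. finite F \<and> F \<subseteq> C}. \<Sum>p\<in>F. ennreal (g p))"
      using hC by (intro SUP_upper) auto
    also have "\<dots> = v"
      unfolding v g_def by (rule nonneg_infsum_complete[symmetric]) simp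
    finally show ?thesis .
  qed
  have "ennreal (prob (\<Union>n. D n)) \<le> v"
    by (rule LIMSEQ_le_const2[OF tendsto_ennrealI[OF lim]]) (use bound in blast)
  moreover have "prob G \<le> prob (\<Union>n. D n)"
  proof -
    have "G \<inter> Z \<subseteq> (\<Union>n. D n)"
    proof
      fix x assume x: "x \<in> G \<inter> Z"
      then obtain p where p: "p \<in> C" "x \<in> B p" using C(3) unfolding B_def by blast
      then obtain i where "p = h i" using h by auto
      then have "x \<in> D (Suc i)" using p by (auto simp: D_def)
      then show "x \<in> (\<Union>n. D n)" by blast
    qed
    then have "prob (G \<inter> Z) \<le> prob (\<Union>n. D n)" using D by (intro finite_measure_mono) auto
    then show ?thesis using prob_Int_ge[OF G Z(1)] Z(2) by linarith
  qed
  ultimately show "ennreal (prob G) \<le> v" by (meson ennreal_leI order_trans)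
qed

text \<open>One set \<open>G\<close> serves every \<open>Z\<close> of full measure. Lowering the
  exponent only enlarges the terms, so every \<open>s' \<le> s\<close> keeps the Caratheodory sums
  at least \<open>prob G\<close>, and \<open>car_m\<close> cannot vanish there.\<close>

lemma car_pressure_meas_eps_ge:
  assumes G: "G \<in> sets M" "prob G > 0"
    and le: "\<And>n x. n \<ge> N \<Longrightarrow> x \<in> X \<Longrightarrow> prob (bowen_ball X T n x e \<inter> G) \<le> exp (- s * real n + \<phi> n x)"
  shows "ereal s \<le> car_pressure_meas_eps X T \<phi> M e"
  unfolding car_pressure_meas_eps_def
proof (rule Inf_greatest)
  fix v assume "v \<in> {car_pressure_set_eps X T \<phi> Z e | Z. Z \<in> sets M \<and> prob Z = 1}"
  then obtain Z where Z: "Z \<in> sets M" "prob Z = 1" and v: "v = car_pressure_set_eps X T \<phi> Z e" by auto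
  show "ereal s \<le> v"
    unfolding v car_pressure_set_eps_def
  proof (rule Inf_greatest, clarify)
    fix s' assume s': "car_m X T \<phi> Z s' e = 0"
    show "ereal s \<le> ereal s'"
    proof (rule ccontr)
      assume "\<not> ?thesis"
      then have "s' \<le> s" by simp
      have "prob (bowen_ball X T n x e \<inter> G) \<le> exp (- s' * real n + \<phi> n x)" if "n \<ge> N" "x \<in> X" for n x
      proof -
        have "s' * real n \<le> s * real n" using \<open>s' \<le> s\<close> by (rule mult_right_mono) simp
        then have "exp (- s * real n + \<phi> n x) \<le> exp (- s' * real n + \<phi> n x)" by simp
        then show ?thesis using le[OF that] by linarith
      qed
      then have "ennreal (prob G) \<le> car_M X T \<phi> Z s' N e" by (intro car_M_ge G(1) Z)
      also have "\<dots> \<le> car_m X T \<phi> Z s' e" by (rule car_M_le_car_m)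
      finally show False using s' G(2) by (simp add: ennreal_eq_0_iff)
    qed
  qed
qed

text \<open>The sets \<open>A - B\<close> are compact, so a small Bowen ball sees only one of them at a time.\<close>
lemma separated_partition:
  assumes P: "finite_meas_partition M P" and "\<eta> > 0"
  obtains B e where "B \<in> sets M" "prob B < \<eta>" "e > 0"
    "\<And>x y A A'. x \<in> A - B \<Longrightarrow> y \<in> A' - B \<Longrightarrow> A \<in> P \<Longrightarrow> A' \<in> P \<Longrightarrow> dist x y < e \<Longrightarrow> A = A'"
proof -
  have fin: "finite P" and sets: "\<And>A. A \<in> P \<Longrightarrow> A \<in> sets M" and UN: "\<Union>P = space M" and dis: "disjoint P"
    using P by (auto simp: finite_meas_partition_def)
  have pos: "\<eta> / (real (card P) + 1) > 0" using \<open>\<eta> > 0\<close> by simp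
  have "\<exists>K. compact K \<and> K \<in> sets M \<and> K \<subseteq> A \<and> prob (A - K) < \<eta> / (real (card P) + 1)" if "A \<in> P" for A
    using inner_regular_compact[OF sets[OF that] pos] by metis
  then obtain K where K: "\<And>A. A \<in> P \<Longrightarrow> compact (K A)" "\<And>A. A \<in> P \<Longrightarrow> K A \<in> sets M"
      "\<And>A. A \<in> P \<Longrightarrow> K A \<subseteq> A" "\<And>A. A \<in> P \<Longrightarrow> prob (A - K A) < \<eta> / (real (card P) + 1)"
    by metis
  define B where "B = (\<Union>A\<in>P. A - K A)"
  have B: "B \<in> sets M" unfolding B_def using fin sets K by (intro sets.finite_UN sets.Diff) auto
  have "prob B \<le> (\<Sum>A\<in>P. prob (A - K A))"
    unfolding B_def using fin sets K by (intro finite_measure_subadditive_finite) auto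
  also have "\<dots> \<le> (\<Sum>A\<in>P. \<eta> / (real (card P) + 1))" using K(4) by (intro sum_mono) (auto intro: less_imp_le)
  also have "\<dots> < \<eta>" using \<open>\<eta> > 0\<close> by (simp add: field_simps)
  finally have prob_B: "prob B < \<eta>" .
  have "\<exists>d>0. \<forall>x\<in>K A. \<forall>y\<in>K A'. d \<le> dist x y" if "A \<in> P" "A' \<in> P" "A \<noteq> A'" for A A'
  proof -
    have "A \<inter> A' = {}" using dis that unfolding disjoint_def by blast
    then have "K A \<inter> K A' = {}" using K(3) that by blast
    then show ?thesis using compact_separated[OF K(1)[OF that(1)] K(1)[OF that(2)]] by metis
  qed
  then obtain d where d: "\<And>A A'. A \<in> P \<Longrightarrow> A' \<in> P \<Longrightarrow> A \<noteq> A' \<Longrightarrow> d A A' > 0"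
    "\<And>A A' x y. A \<in> P \<Longrightarrow> A' \<in> P \<Longrightarrow> A \<noteq> A' \<Longrightarrow> x \<in> K A \<Longrightarrow> y \<in> K A' \<Longrightarrow> d A A' \<le> dist x y"
    by metis
  define Q where "Q = {p \<in> P \<times> P. fst p \<noteq> snd p}"
  \<comment> \<open>The inserted \<open>1\<close> keeps \<open>Min\<close> meaningful when
    \<open>Q\<close> is empty.\<close>
  define e where "e = Min (insert 1 ((\<lambda>p. d (fst p) (snd p)) ` Q))"
  have fQ: "finite Q" using fin by (simp add: Q_def)
  have "e > 0" unfolding e_def using fQ d(1) by (subst Min_gr_iff) (auto simp: Q_def)
  moreover have "A = A'" if h: "x \<in> A - B" "y \<in> A' - B" "A \<in> P" "A' \<in> P" "dist x y < e" for x y A A'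
  proof (rule ccontr)
    assume ne: "A \<noteq> A'"
    have "x \<in> K A" "y \<in> K A'" using h by (auto simp: B_def)
    then have "d A A' \<le> dist x y" using d(2) h ne by blast
    moreover have "e \<le> d A A'"
      unfolding e_def using fQ h ne by (intro Min_le) (auto simp: Q_def image_iff intro!: bexI[of _ "(A, A')"])
    ultimately show False using h by linarith
  qed
  ultimately show ?thesis by (rule that[OF B prob_B])
qed

lemma car_pressure_meas_eps_lower:
  assumes part: "finite_meas_partition M P" and k: "k \<ge> 1"
    and s: "s < part_entropy_rate M T P + (\<integral>x. \<phi> k x \<partial>M) / real k"
  shows "\<exists>e0>0. \<forall>e. e \<le> e0 \<longrightarrow> ereal s \<le> car_pressure_meas_eps X T \<phi> M e"
proof -
  interpret partition_system M T P by unfold_locales (rule part)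
  define \<rho> where "\<rho> = (\<integral>x. \<phi> k x \<partial>M) / real k"
  \<comment> \<open>Six losses of \<open>d\<close>. Three affect the measure of a ball: the cylinder
    bound \<open>a\<close>, the Hamming factor and the cost of mismatches. Three affect
    \<open>\<phi> n\<close> at the centre: the Birkhoff average, uniform continuity and the constant
    \<open>C\<close>.\<close>
  define d where "d = (rate + \<rho> - s) / 6"
  have d: "d > 0" "s = rate + \<rho> - 6 * d"
    using s by (auto simp: d_def \<rho>_def part_entropy_rate_eq field_simps)
  define a where "a = rate - d"
  \<comment> \<open>Solves \<open>card P * exp (- K) \<le> exp d - 1\<close>, the condition of the
    Hamming count; the added \<open>1\<close> ensures \<open>K \<ge> 0\<close>.\<close>
  define K where "K = ln (real (card P) / (exp d - 1) + 1)"
  have ed: "exp d - 1 > 0" using d by simp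
  have c: "real (card P) > 0" using card_P by simp
  have arg: "real (card P) / (exp d - 1) + 1 > 1" using ed c by simp
  have K: "1 + real (card P) * exp (- K) \<le> exp d" "K \<ge> 0"
  proof -
    have "exp (- K) = inverse (real (card P) / (exp d - 1) + 1)"
      using arg by (simp add: K_def exp_minus)
    also have "\<dots> \<le> inverse (real (card P) / (exp d - 1))"
      using ed c by (intro le_imp_inverse_le) auto
    finally have "real (card P) * exp (- K) \<le> real (card P) * inverse (real (card P) / (exp d - 1))"
      using c by (intro mult_left_mono) auto
    also have "\<dots> = exp d - 1" using ed c by (simp add: field_simps)
    finally show "1 + real (card P) * exp (- K) \<le> exp d" by simp
    show "K \<ge> 0" using arg by (simp add: K_def)
  qed
  \<comment> \<open>Mismatches occur only on visits to \<open>B\<close>, at most a proportion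
    \<open>\<eta>\<close> of the time, and cost \<open>K\<close> each, so in total at most
    \<open>n * d\<close>.\<close>
  define \<eta> where "\<eta> = d / (K + 1)"
  have \<eta>: "\<eta> > 0" "K * \<eta> \<le> d" using K d by (auto simp: \<eta>_def field_simps)
  obtain B e1 where B: "B \<in> sets M" "prob B < \<eta>" "e1 > 0"
    and sep: "\<And>x y A A'. x \<in> A - B \<Longrightarrow> y \<in> A' - B \<Longrightarrow> A \<in> P \<Longrightarrow> A' \<in> P \<Longrightarrow> dist x y < e1 \<Longrightarrow> A = A'"
    using separated_partition[OF part \<eta>(1)] by metis
  have "uniformly_continuous_on X (\<phi> k)"
    by (rule compact_uniformly_continuous[OF continuous_\<phi>[OF k] compact_X])
  then obtain e2 where e2: "e2 > 0"
    and unif: "\<And>x y. x \<in> X \<Longrightarrow> y \<in> X \<Longrightarrow> dist y x < e2 \<Longrightarrow> dist (\<phi> k y) (\<phi> k x) < real k * d"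
    using k d unfolding uniformly_continuous_on_def by (metis mult_pos_pos of_nat_0_less_iff less_le_trans zero_less_one)
  obtain C where C: "\<And>n x. n \<ge> 1 \<Longrightarrow> x \<in> X \<Longrightarrow> (\<Sum>i<n. \<phi> k ((T ^^ i) x)) - C \<le> real k * \<phi> n x"
    using \<phi>_ge_birkhoff_sum[OF k] by metis
  have \<phi>_int: "integrable M (\<phi> k)" by (rule continuous_integrable[OF continuous_\<phi>[OF k]])
  obtain Ck where Ck: "\<And>x. x \<in> X \<Longrightarrow> \<bar>\<phi> k x\<bar> \<le> Ck"
    using continuous_bounded[OF continuous_\<phi>[OF k]] by metis
  have mean: "real k * \<rho> - real k * d < (\<integral>x. \<phi> k x \<partial>M)" using k d by (simp add: \<rho>_def)
  define Q where "Q n x \<longleftrightarrow> prob (cyl (name n x)) \<le> exp (- real n * a) \<and> real (visits B n x) \<le> real n * \<eta> \<and>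
      real n * (real k * \<rho> - real k * d) \<le> (\<Sum>i<n. \<phi> k ((T ^^ i) x))" for n x
  have AE1: "AE x in M. \<forall>\<^sub>F n in sequentially. prob (cyl (name n x)) \<le> exp (- real n * a)"
    using d by (intro AE_cyl_small) (simp add: a_def)
  note AE2 = visits_AE_upper[OF B(1,2)]
  have AE3: "AE x in M. \<forall>\<^sub>F n in sequentially. real n * (real k * \<rho> - real k * d) \<le> (\<Sum>i<n. \<phi> k ((T ^^ i) x))"
    by (rule birkhoff_AE_lower[OF \<phi>_int _ mean, of Ck]) (use Ck in \<open>auto simp: space_M abs_le_iff\<close>)
  have AE: "AE x in M. \<forall>\<^sub>F n in sequentially. Q n x"
    using AE1 AE2 AE3 unfolding Q_def by eventually_elim (intro eventually_conj)
  have pm: "Measurable.pred M (Q n)" for n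
  proof -
    have [measurable]: "\<phi> k \<in> borel_measurable M" "B \<in> sets M" using \<phi>_int B by auto
    show ?thesis unfolding Q_def by (intro pred_intros_logic pred_name) measurable
  qed
  obtain G N where G: "G \<in> sets M" "prob G > 1 - 1 / 2" and N: "\<And>n x. n \<ge> N \<Longrightarrow> x \<in> G \<Longrightarrow> Q n x"
    using AE_eventually_uniform[OF AE pm, of "1 / 2"] by auto
  obtain N' where N': "\<bar>C\<bar> / (real k * d) \<le> real N'" using real_arch_simple by blast
  have kd: "real k * d > 0" using k d by simp
  \<comment> \<open>Two points of one Bowen ball are within \<open>2 * e\<close> of each other at
    each time, hence \<open>e1 / 2\<close>; \<open>\<phi> k\<close> is compared only with its value
    at the centre, hence \<open>e2\<close> itself.\<close>
  have "prob (bowen_ball X T n x e \<inter> G) \<le> exp (- s * real n + \<phi> n x)"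
    if e: "e \<le> min (e1 / 2) e2" and n: "n \<ge> max 1 (max N N')" and x: "x \<in> X" for e n x
  proof (cases "bowen_ball X T n x e \<inter> G = {}")
    case True
    then show ?thesis by simp
  next
    case False
    then obtain y where y: "y \<in> bowen_ball X T n x e" "y \<in> G" by blast
    have yX: "y \<in> X" and near: "\<And>i. i < n \<Longrightarrow> dist ((T ^^ i) x) ((T ^^ i) y) < e"
      using y(1) by (auto simp: bowen_ball_def)
    \<comment> \<open>The centre \<open>x\<close> may lie outside \<open>G\<close>; the orbit sum is
      known at \<open>y\<close> and transferred to \<open>x\<close> one time at a time.\<close>
    have "\<phi> k ((T ^^ i) y) - real k * d \<le> \<phi> k ((T ^^ i) x)" if "i < n" for i
      using unif[OF funpow_X[OF yX] funpow_X[OF x], of i i] near[OF that] e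
      by (auto simp: dist_real_def)
    then have "(\<Sum>i<n. \<phi> k ((T ^^ i) y) - real k * d) \<le> (\<Sum>i<n. \<phi> k ((T ^^ i) x))"
      by (intro sum_mono) auto
    moreover have "real n * (real k * \<rho> - real k * d) \<le> (\<Sum>i<n. \<phi> k ((T ^^ i) y))"
      using N[of n y] n y by (simp add: Q_def)
    moreover have "(\<Sum>i<n. \<phi> k ((T ^^ i) x)) - C \<le> real k * \<phi> n x" using n x by (intro C) auto
    moreover have "C \<le> real n * (real k * d)"
    proof -
      have "C \<le> \<bar>C\<bar>" by simp
      also have "\<dots> \<le> real N' * (real k * d)" using N' kd by (simp add: pos_divide_le_eq)
      also have "\<dots> \<le> real n * (real k * d)" using n kd by (intro mult_right_mono) auto
      finally show ?thesis .
    qed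
    ultimately have "real k * (real n * (\<rho> - 3 * d)) \<le> real k * \<phi> n x"
      by (simp add: sum_subtractf algebra_simps)
    then have \<phi>_lower: "real n * (\<rho> - 3 * d) \<le> \<phi> n x" using k by simp
    \<comment> \<open>The template records the element of \<open>P\<close> seen at time
      \<open>i\<close> by some point of the ball that is off \<open>B\<close>; by separation all
      such points agree. The default \<open>{}\<close> occurs only if every point of the ball is in
      \<open>B\<close> at that time, so each mismatch is a visit to \<open>B\<close>.\<close>
    define c where "c i = (if \<exists>z\<in>bowen_ball X T n x e. (T ^^ i) z \<notin> B
        then label ((T ^^ i) (SOME z. z \<in> bowen_ball X T n x e \<and> (T ^^ i) z \<notin> B)) else {})" for i
    have c: "c i = label ((T ^^ i) z)" if z: "z \<in> bowen_ball X T n x e" "(T ^^ i) z \<notin> B" and i: "i < n" for i z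
    proof -
      define w where "w = (SOME z. z \<in> bowen_ball X T n x e \<and> (T ^^ i) z \<notin> B)"
      have w: "w \<in> bowen_ball X T n x e" "(T ^^ i) w \<notin> B"
        unfolding w_def using someI[of "\<lambda>z. z \<in> bowen_ball X T n x e \<and> (T ^^ i) z \<notin> B" z] z by blast+
      have wz: "w \<in> space M" "z \<in> space M" using w z by (auto simp: bowen_ball_def space_M)
      have dw: "dist ((T ^^ i) x) ((T ^^ i) w) < e" and dz: "dist ((T ^^ i) x) ((T ^^ i) z) < e"
        using w(1) z(1) i by (auto simp: bowen_ball_def)
      have "dist ((T ^^ i) w) ((T ^^ i) z) \<le> dist ((T ^^ i) w) ((T ^^ i) x) + dist ((T ^^ i) x) ((T ^^ i) z)"
        by (rule dist_triangle)
      also have "\<dots> < e1" using dw dz e by (simp add: dist_commute)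
      finally have "label ((T ^^ i) w) = label ((T ^^ i) z)"
        using wz w(2) z(2) by (intro sep[of "(T ^^ i) w" _ "(T ^^ i) z"] DiffI in_label label_in funpow_T_space) auto
      then show ?thesis using z by (auto simp: c_def w_def)
    qed
    define b where "b = nat \<lfloor>real n * \<eta>\<rfloor>"
    have b: "real b \<le> real n * \<eta>" using \<eta> by (simp add: b_def)
    have "prob (bowen_ball X T n x e \<inter> G) \<le> exp (d * real n + K * real b) * exp (- real n * a)"
    proof (rule prob_le_hamming[OF _ K, where c = c])
      show "bowen_ball X T n x e \<inter> G \<in> sets M" using bowen_ball_sets[OF x] G(1) by blast
      fix z assume z: "z \<in> bowen_ball X T n x e \<inter> G"
      then have Qz: "Q n z" using N n by simp
      then show "prob (cyl (name n z)) \<le> exp (- real n * a)" by (simp add: Q_def)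
      have "{i. i < n \<and> label ((T ^^ i) z) \<noteq> c i} \<subseteq> {i \<in> {..<n}. (T ^^ i) z \<in> B}"
        using c z by fastforce
      then have "card {i. i < n \<and> label ((T ^^ i) z) \<noteq> c i} \<le> card {i \<in> {..<n}. (T ^^ i) z \<in> B}"
        by (intro card_mono) auto
      also have "\<dots> = visits B n z"
        by (simp add: visits_def indicator_def sum.If_cases Int_def)
      also have "\<dots> \<le> b" using Qz by (simp add: Q_def b_def le_nat_floor)
      finally show "card {i. i < n \<and> label ((T ^^ i) z) \<noteq> c i} \<le> b" .
    qed simp
    also have "\<dots> = exp (d * real n + K * real b - real n * a)" by (simp flip: exp_add)
    also have "\<dots> \<le> exp (- s * real n + \<phi> n x)"
    proof -
      have "K * real b \<le> K * (real n * \<eta>)" using b K(2) by (rule mult_left_mono)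
      also have "\<dots> = real n * (K * \<eta>)" by simp
      also have "\<dots> \<le> real n * d" using \<eta> by (intro mult_left_mono) auto
      finally have "K * real b \<le> real n * d" .
      then have "d * real n + K * real b - real n * a \<le> real n * (3 * d - rate)"
        by (simp add: a_def algebra_simps)
      also have "\<dots> = - s * real n + real n * (\<rho> - 3 * d)" by (simp add: d(2) algebra_simps)
      also have "\<dots> \<le> - s * real n + \<phi> n x" using \<phi>_lower by simp
      finally show ?thesis by simp
    qed
    finally show ?thesis .
  qed
  then have "ereal s \<le> car_pressure_meas_eps X T \<phi> M e" if "e \<le> min (e1 / 2) e2" for e
    using that G by (intro car_pressure_meas_eps_ge[of G "max 1 (max N N')"]) auto
  then show ?thesis using B(3) e2 by (intro exI[of _ "min (e1 / 2) e2"]) auto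
qed

text \<open>Either summand may be infinite. A real \<open>t\<close> strictly below the sum is
  already exceeded for one \<open>P\<close> and then one \<open>k\<close>, since nonempty suprema
  commute with adding a quantity other than minus infinity.\<close>

lemma car_pressure_meas_ge: "ks_entropy M T + pot_star M \<phi> \<le> car_pressure_meas X T \<phi> M"
proof (rule ccontr)
  assume "\<not> ?thesis"
  then have "car_pressure_meas X T \<phi> M < ks_entropy M T + pot_star M \<phi>" by simp
  then obtain t where t: "car_pressure_meas X T \<phi> M < ereal t" "ereal t < ks_entropy M T + pot_star M \<phi>"
    using ereal_dense2 by blast
  obtain P k where P: "finite_meas_partition M P" and k: "k \<ge> 1"
    and tPk: "t < part_entropy_rate M T P + (\<integral>x. \<phi> k x \<partial>M) / real k"
  proof -
    have ne: "{P. finite_meas_partition M P} \<noteq> {}"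
      by (auto simp: finite_meas_partition_def disjoint_def intro!: exI[of _ "{space M}"])
    have "ereal t < (SUP P\<in>{P. finite_meas_partition M P}. ereal (part_entropy_rate M T P) + pot_star M \<phi>)"
      using t(2) ne pot_star_ge[of 1] unfolding ks_entropy_def
      by (subst (asm) SUP_ereal_add_left[symmetric]) auto
    then obtain P where P: "finite_meas_partition M P" "ereal t < ereal (part_entropy_rate M T P) + pot_star M \<phi>"
      by (auto simp: less_SUP_iff)
    then have "ereal t < (SUP k\<in>{1..}. ereal (part_entropy_rate M T P) + ereal ((\<integral>x. \<phi> k x \<partial>M) / real k))"
      unfolding pot_star_def by (subst SUP_ereal_add_right) auto
    then obtain k where "k \<ge> 1" "ereal t < ereal (part_entropy_rate M T P) + ereal ((\<integral>x. \<phi> k x \<partial>M) / real k)"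
      by (auto simp: less_SUP_iff)
    then show ?thesis using that[of P k] P by simp
  qed
  obtain e0 where e0: "e0 > 0" "\<And>e. e \<le> e0 \<Longrightarrow> ereal t \<le> car_pressure_meas_eps X T \<phi> M e"
    using car_pressure_meas_eps_lower[OF P k tPk] by blast
  have "\<forall>\<^sub>F e in at_right 0. ereal t \<le> car_pressure_meas_eps X T \<phi> M e"
    using eventually_at_right_real[OF e0(1)] by eventually_elim (use e0(2) in auto)
  then have "ereal t \<le> car_pressure_meas X T \<phi> M"
    unfolding car_pressure_meas_def by (rule Liminf_bounded)
  then show False using t(1) by simp
qed

end

theorem theoremC:
  fixes X :: "'a::metric_space set" and T :: "'a \<Rightarrow> 'a"
    and \<phi> :: "nat \<Rightarrow> 'a \<Rightarrow> real" and \<mu> :: "'a measure"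
  assumes "compact X"
    and "T ` X \<subseteq> X" and "continuous_on X T"
    and "supadditive_potential X T \<phi>"
    and "prob_space \<mu>" and "space \<mu> = X" and "sets \<mu> = sets (restrict_space borel X)"
    and "ergodic_map \<mu> T"
  shows "car_pressure_meas X T \<phi> \<mu> = lower_cap_meas X T \<phi> \<mu>
       \<and> lower_cap_meas X T \<phi> \<mu> = upper_cap_meas X T \<phi> \<mu>
       \<and> upper_cap_meas X T \<phi> \<mu> = span_pressure X T \<phi> \<mu>
       \<and> span_pressure X T \<phi> \<mu> = ks_entropy \<mu> T + pot_star \<mu> \<phi>"
proof -
  interpret prob_space \<mu> by fact
  interpret supadditive_system \<mu> T X \<phi>
    by unfold_locales (use assms in auto)
  \<comment> \<open>The chain from the Caratheodory pressure through lower and upper capacity to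
    entropy plus \<open>pot_star\<close> returns to the Caratheodory pressure; the spanning pressure
    lies between the Caratheodory and the upper capacity pressure.\<close>
  show ?thesis
    using car_pressure_meas_le_lower_cap_meas lower_cap_meas_le_upper_cap_meas upper_cap_meas_le
      car_pressure_meas_ge car_pressure_meas_le_span_pressure span_pressure_le_upper_cap_meas
    by (metis order.trans order_antisym)
qed

end
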